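(* Let $p,s,m,l,n,d\in\mathbb{N}$ and let $f,g$ be nontrivial radial functions on $\mathbb{D}$. Assume that $1\le p<s$, that $1\le m<l$, and that $l+p=m+s$. Assume that the Toeplitz operators $T_{e^{ip\theta}r^n}$ and $T_{e^{is\theta}r^d}$ do not commute with each other. Suppose that the operator $T_{e^{im\theta}f}+T_{e^{il\theta}g}$ commutes with the operator $T_{e^{ip\theta}r^n}+T_{e^{is\theta}r^d}$. Then $m=p$, $l=s$, and there is a constant $c\in\mathbb{C}$ such that $$T_{e^{im\theta}f}+T_{e^{is\theta}g}=c\left(T_{e^{ip\theta}r^n}+T_{e^{is\theta}r^d}\right).$$
   Context: $\mathbb{N}$ denotes the set of positive integers. $\mathbb{D}$ is the open unit disk in $\mathbb{C}$, with polar coordinates $z=re^{i\theta}$, and $dA=r\,dr\,\frac{d\theta}{\pi}$ is normalized Lebesgue measure on $\mathbb{D}$. $L^2_a(\mathbb{D})$ is the (unweighted) Bergman space, i.e. the closed subspace of analytic functions in $L^2(\mathbb{D},dA)$; the monomials $z^k$, $k\ge 0$, form an orthogonal basis of it. $P:L^2(\mathbb{D},dA)\to L^2_a(\mathbb{D})$ is the orthogonal projection (Bergman projection). For a symbol $u\in L^2(\mathbb{D},dA)$, the Toeplitz operator $T_u$ is defined by $T_u(h)=P(uh)$ for those $h\in L^2_a(\mathbb{D})$ with $uh\in L^2(\mathbb{D},dA)$; its domain contains all bounded analytic functions, in particular all polynomials, so $T_u$ is densely defined. A radial function is a function on $\mathbb{D}$ depending only on $r=|z|$; the radial functions $f,g$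 are taken in $L^2(\mathbb{D},dA)$, and nontrivial means not almost everywhere zero. For a radial function $\phi$ and an integer $q$, $e^{iq\theta}\phi$ denotes the symbol $re^{i\theta}\mapsto e^{iq\theta}\phi(r)$ (a quasihomogeneous symbol of degree $q$). For $q\ge 1$ the operator $T_{e^{iq\theta}\phi}$ maps each $z^k$ to a scalar multiple of $z^{k+q}$, so finite sums and products of such operators are defined on all polynomials. Operators $S$ and $T$ of this kind are said to commute if $ST(z^k)=TS(z^k)$ for all integers $k\ge 0$, and equality of such operators likewise means equality on all $z^k$, $k\geq 0$. *)

theory Defs
  imports "HOL-Analysis.Analysis" "HOL-Complex_Analysis.Complex_Analysis"
begin

abbreviation unit_disk :: "complex set"
  where "unit_disk \<equiv> ball 0 1"

definition disk_measure :: "complex measure"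
  where "disk_measure = density (lebesgue_on unit_disk) (\<lambda>_. ennreal (1 / pi))"

definition L2_disk :: "(complex \<Rightarrow> complex) set"
  where "L2_disk = {u. u \<in> borel_measurable disk_measure \<and>
                       integrable disk_measure (\<lambda>z. (cmod (u z))\<^sup>2)}"

definition inner_disk :: "(complex \<Rightarrow> complex) \<Rightarrow> (complex \<Rightarrow> complex) \<Rightarrow> complex"
  where "inner_disk u v = (LINT z|disk_measure. u z * cnj (v z))"

text \<open>An analytic function on the disk is represented by its extension by zero to the whole
  plane. This makes the representation unique, so that equality of elements of the Bergman space
  is equality in HOL.\<close>

definition bergman_space :: "(complex \<Rightarrow> complex) set"
  where "bergman_space = {h. h holomorphic_on unit_disk \<and> h \<in> L2_disk \<and> (\<forall>z. z \<notin> unit_disk \<longrightarrow> h z = 0)}"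

definition monomial :: "nat \<Rightarrow> complex \<Rightarrow> complex"
  where "monomial k = (\<lambda>z. if z \<in> unit_disk then z ^ k else 0)"

text \<open>The orthogonal projection, meaningful for arguments in \<^const>\<open>L2_disk\<close>.\<close>

definition bergman_proj :: "(complex \<Rightarrow> complex) \<Rightarrow> complex \<Rightarrow> complex"
  where "bergman_proj u =
    (THE h. h \<in> bergman_space \<and> (\<forall>v\<in>bergman_space. inner_disk (\<lambda>z. u z - h z) v = 0))"

type_synonym disk_op = "(complex \<Rightarrow> complex) \<Rightarrow> complex \<Rightarrow> complex"

definition toeplitz_domain :: "(complex \<Rightarrow> complex) \<Rightarrow> (complex \<Rightarrow> complex) set"
  where "toeplitz_domain u = {h \<in> bergman_space. (\<lambda>z. u z * h z) \<in> L2_disk}"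

definition toeplitz :: "(complex \<Rightarrow> complex) \<Rightarrow> disk_op"
  where "toeplitz u h =
    (if h \<in> toeplitz_domain u then bergman_proj (\<lambda>z. u z * h z) else undefined)"

definition op_add :: "disk_op \<Rightarrow> disk_op \<Rightarrow> disk_op"  (infixl "\<oplus>\<^sub>T" 65)
  where "(S \<oplus>\<^sub>T T) h = (\<lambda>z. S h z + T h z)"

definition op_scale :: "complex \<Rightarrow> disk_op \<Rightarrow> disk_op"  (infixr "\<cdot>\<^sub>T" 75)
  where "(c \<cdot>\<^sub>T T) h = (\<lambda>z. c * T h z)"

text \<open>Both relations are tested on monomials only, since the operators may be unbounded.\<close>

definition op_commute :: "disk_op \<Rightarrow> disk_op \<Rightarrow> bool"
  where "op_commute S T \<longleftrightarrow> (\<forall>k. S (T (monomial k)) = T (S (monomial k)))"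

definition op_eq :: "disk_op \<Rightarrow> disk_op \<Rightarrow> bool"  (infix "=\<^sub>T" 50)
  where "S =\<^sub>T T \<longleftrightarrow> (\<forall>k. S (monomial k) = T (monomial k))"

definition radial :: "(complex \<Rightarrow> complex) \<Rightarrow> bool"
  where "radial \<phi> \<longleftrightarrow> (\<forall>z\<in>unit_disk. \<forall>w\<in>unit_disk. cmod z = cmod w \<longrightarrow> \<phi> z = \<phi> w)"

definition nontrivial :: "(complex \<Rightarrow> complex) \<Rightarrow> bool"
  where "nontrivial \<phi> \<longleftrightarrow> \<not> (AE z in disk_measure. \<phi> z = 0)"

definition radial_power :: "nat \<Rightarrow> complex \<Rightarrow> complex"
  where "radial_power n = (\<lambda>z. of_real (cmod z ^ n))"

text \<open>The symbol \<open>e\<^sup>i\<^sup>q\<^sup>\<theta> \<phi>\<close>; its value at the origin, where the argument is a convention, is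
  irrelevant.\<close>

definition quasihom :: "int \<Rightarrow> (complex \<Rightarrow> complex) \<Rightarrow> complex \<Rightarrow> complex"
  where "quasihom q \<phi> = (\<lambda>z. cis (of_int q * Arg z) * \<phi> z)"

end

theory Submission
  imports Defs "HOL-Real_Asymp.Real_Asymp"
begin

text \<open>
  The operator with symbol \<open>e\<^sup>i\<^sup>q\<^sup>\<theta> \<phi>\<close> is a weighted shift on the monomials, whose weights are moments
  of \<open>\<phi>\<close>. Comparing coefficients, the commutation relation says that the weights \<open>\<alpha>\<^sub>k = (k+1+p)/(k+1+(p+n)/2)\<close>,
  \<open>\<beta>\<^sub>k = (k+1+s)/(k+1+(s+d)/2)\<close> and the unknown weights \<open>a\<^sub>k\<close>, \<open>b\<^sub>k\<close> satisfy
  \<open>\<alpha>\<^sub>k a\<^sub>k\<^sub>+\<^sub>p = \<alpha>\<^sub>k\<^sub>+\<^sub>m a\<^sub>k\<close>, \<open>\<beta>\<^sub>k b\<^sub>k\<^sub>+\<^sub>s = \<beta>\<^sub>k\<^sub>+\<^sub>l b\<^sub>k\<close> and one mixed relation.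
  The first two determine \<open>a\<close> and \<open>b\<close>, up to periodic factors \<open>C\<close> (period \<open>p\<close>) and \<open>D\<close> (period \<open>s\<close>), as Gamma
  quotients with known expansions in powers of \<open>1/(k+1)\<close>. In the mixed relation the order zero
  terms show that \<open>C\<close> and \<open>D\<close> both have periods \<open>p\<close> and \<open>s\<close>, and the first nonvanishing order gives
  \<open>D l/s = C m/p\<close>. If \<open>n s \<noteq> d p\<close>, the next order forces \<open>m = p\<close>; if \<open>n s = d p\<close>, everything starts
  one order later and it is the second order after the leading one that forces \<open>m = p\<close>.
  Then \<open>a = C \<alpha>\<close> and \<open>b = C \<beta>\<close> exactly. Finally the moments of \<open>f\<close> along an arithmetic progression
  determine \<open>f\<close>, as in the theorem of Muentz, hence \<open>C\<close> is constant.
\<close>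

text \<open>The truncation orders are dictated by the degenerate case \<open>n s = d p\<close>.
  There both sides of the mixed relation start at order three and the remaining common prefactor at
  order two, so the prefactor is first felt at order five, and the weights must be known up to
  O(x^-6). Passing from a recurrence to its solution sums errors along an arithmetic progression and
  loses one order, hence remainders O(x^-7) for the logarithms. The leading order can only fix the
  ratio of the unknown \<open>C\<close> and \<open>D\<close>. A second comparison eliminates both;
  what it leaves is \<open>m - p\<close> times a factor that does not vanish. The Gamma quotients
  never occur as functions. A finite sum in \<open>1/x\<close> that satisfies the logarithmic
  recurrence up to O(x^-7) is enough: dividing the unknown weights by its exponential leaves a
  convergent product and a periodic factor. The passage from asymptotic to exact equality is
  possible because for \<open>m = p\<close> the quotients \<open>a/\<alpha>\<close> and
  \<open>b/\<beta>\<close> are themselves periodic.\<close>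

section \<open>Expansions in inverse powers\<close>

text \<open>Truncated at order six; the value \<open>c 0\<close> is ignored, the constant term being zero.\<close>

definition expansion :: "(real \<Rightarrow> real) \<Rightarrow> (nat \<Rightarrow> real) \<Rightarrow> bool"
  where "expansion f c \<longleftrightarrow> (\<lambda>x. f x - (\<Sum>i=1..6. c i / x ^ i)) \<in> O(\<lambda>x. 1 / x ^ 7)"

lemma expansion_add:
  assumes "expansion f c" "expansion g d"
  shows "expansion (\<lambda>x. f x + g x) (\<lambda>i. c i + d i)"
  using sum_in_bigo(1)[OF assms[unfolded expansion_def]]
  unfolding expansion_def by (simp add: sum.distrib add_divide_distrib algebra_simps)

lemma expansion_diff:
  assumes "expansion f c" "expansion g d"
  shows "expansion (\<lambda>x. f x - g x) (\<lambda>i. c i - d i)"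
  using sum_in_bigo(2)[OF assms[unfolded expansion_def]]
  unfolding expansion_def by (simp add: sum_subtractf diff_divide_distrib algebra_simps)

lemma expansion_cmult:
  assumes "expansion f c"
  shows "expansion (\<lambda>x. a * f x) (\<lambda>i. a * c i)"
proof -
  have "(\<lambda>x. a * (f x - (\<Sum>i=1..6. c i / x ^ i))) \<in> O(\<lambda>x. 1 / x ^ 7)"
    using assms unfolding expansion_def by (cases "a = 0") simp_all
  then show ?thesis
    unfolding expansion_def by (simp add: right_diff_distrib sum_distrib_left)
qed

lemma expansion_zero: "expansion (\<lambda>x. 0) (\<lambda>i. 0)"
  by (simp add: expansion_def)

lemma expansion_sum:
  assumes "finite J" "\<And>j. j \<in> J \<Longrightarrow> expansion (f j) (c j)"
  shows "expansion (\<lambda>x. \<Sum>j\<in>J. f j x) (\<lambda>i. \<Sum>j\<in>J. c j i)"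
  using assms by (induction J rule: finite_induct) (auto intro: expansion_add expansion_zero)

lemma expansion_ln:
  assumes "c > 0"
  shows "expansion (\<lambda>x. ln (1 + c / x)) (\<lambda>i. (-1) ^ Suc i * c ^ i / real i)"
proof -
  have "(\<lambda>y::real. ln (1 + y) - (y - y^2/2 + y^3/3 - y^4/4 + y^5/5 - y^6/6)) \<in> O[at_right 0](\<lambda>y. y ^ 7)"
    by real_asymp
  moreover have "filterlim (\<lambda>x. c / x) (at_right 0) at_top"
    using assms by real_asymp
  ultimately have "(\<lambda>x. ln (1 + c / x) - ((c/x) - (c/x)^2/2 + (c/x)^3/3 - (c/x)^4/4 + (c/x)^5/5 - (c/x)^6/6))
      \<in> O(\<lambda>x. (c / x) ^ 7)"
    by (rule landau_o.big.compose)
  moreover have "(\<lambda>x. (c / x) ^ 7) \<in> O(\<lambda>x. 1 / x ^ 7)"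
    using assms by (intro bigoI[of _ "c ^ 7"]) (simp add: power_divide power_abs)
  ultimately have "(\<lambda>x. ln (1 + c / x) - ((c/x) - (c/x)^2/2 + (c/x)^3/3 - (c/x)^4/4 + (c/x)^5/5 - (c/x)^6/6))
      \<in> O(\<lambda>x. 1 / x ^ 7)"
    by (rule landau_o.big_trans)
  then show ?thesis
    by (simp add: expansion_def numeral_eq_Suc power_divide mult_ac)
qed

text \<open>The coefficient of \<open>x^-i\<close> in the binomial series of
  \<open>(x + h)^-j\<close>, with the binomial coefficient of negative upper argument rewritten as a
  sign times \<open>(i - 1) choose (j - 1)\<close>.\<close>

definition shift_coeff :: "nat \<Rightarrow> real \<Rightarrow> nat \<Rightarrow> real"
  where "shift_coeff j h i = (if i < j then 0 else (-1) ^ (i - j) * real ((i - 1) choose (j - 1)) * h ^ (i - j))"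

lemma expansion_shift:
  assumes h: "h > 0" and j: "j \<in> {1..5}"
  shows "expansion (\<lambda>x. 1 / (x + h) ^ j) (shift_coeff j h)"
proof -
  have "(\<lambda>y::real. 1 / (1 + y) ^ j - (\<Sum>i=j..6. (-1) ^ (i - j) * real ((i - 1) choose (j - 1)) * y ^ (i - j)))
    \<in> O[at_right 0](\<lambda>y. y ^ (7 - j))"
  proof -
    \<comment> \<open>One numeral at a time, so that every exponent in the series is
      concrete.\<close>
    consider "j = 1" | "j = 2" | "j = 3" | "j = 4" | "j = 5" using j by force
    then show ?thesis
    proof cases
      case 1
      have "(\<lambda>y::real. 1 / (1 + y) - (1 - y + y^2 - y^3 + y^4 - y^5)) \<in> O[at_right 0](\<lambda>y. y ^ 6)"
        by real_asymp
      then show ?thesis by (simp add: 1 numeral_eq_Suc)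
    next
      case 2
      have "(\<lambda>y::real. 1 / (1 + y)^2 - (1 - 2*y + 3*y^2 - 4*y^3 + 5*y^4)) \<in> O[at_right 0](\<lambda>y. y ^ 5)"
        by real_asymp
      then show ?thesis by (simp add: 2 numeral_eq_Suc)
    next
      case 3
      have "(\<lambda>y::real. 1 / (1 + y)^3 - (1 - 3*y + 6*y^2 - 10*y^3)) \<in> O[at_right 0](\<lambda>y. y ^ 4)"
        by real_asymp
      then show ?thesis by (simp add: 3 numeral_eq_Suc)
    next
      case 4
      have "(\<lambda>y::real. 1 / (1 + y)^4 - (1 - 4*y + 10*y^2)) \<in> O[at_right 0](\<lambda>y. y ^ 3)"
        by real_asymp
      then show ?thesis by (simp add: 4 numeral_eq_Suc)
    next
      case 5
      have "(\<lambda>y::real. 1 / (1 + y)^5 - (1 - 5*y)) \<in> O[at_right 0](\<lambda>y. y ^ 2)"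
        by real_asymp
      then show ?thesis by (simp add: 5 numeral_eq_Suc)
    qed
  qed
  moreover have "filterlim (\<lambda>x. h / x) (at_right 0) at_top"
    using h by real_asymp
  ultimately have "(\<lambda>x. 1 / (1 + h / x) ^ j - (\<Sum>i=j..6. (-1) ^ (i - j) * real ((i - 1) choose (j - 1)) * (h / x) ^ (i - j)))
    \<in> O(\<lambda>x. (h / x) ^ (7 - j))"
    by (rule landau_o.big.compose)
  then have "(\<lambda>x. 1 / x ^ j * (1 / (1 + h / x) ^ j - (\<Sum>i=j..6. (-1) ^ (i - j) * real ((i - 1) choose (j - 1)) * (h / x) ^ (i - j))))
    \<in> O(\<lambda>x. 1 / x ^ j * (h / x) ^ (7 - j))"
    by (intro landau_o.big.mult) auto
  also have "(\<lambda>x. 1 / x ^ j * (h / x) ^ (7 - j)) \<in> O(\<lambda>x. 1 / x ^ 7)"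
  proof -
    have "1 / x ^ j * (h / x) ^ (7 - j) = h ^ (7 - j) * (1 / x ^ 7)" for x
    proof -
      have "x ^ j * x ^ (7 - j) = x ^ 7" using j by (subst power_add[symmetric]) auto
      then show ?thesis by (simp add: power_divide)
    qed
    then show ?thesis using h by (intro bigoI[of _ "h ^ (7 - j)"]) (simp add: power_abs)
  qed
  finally have big: "(\<lambda>x. 1 / x ^ j * (1 / (1 + h / x) ^ j - (\<Sum>i=j..6. (-1) ^ (i - j) * real ((i - 1) choose (j - 1)) * (h / x) ^ (i - j))))
    \<in> O(\<lambda>x. 1 / x ^ 7)" .
  have eq: "1 / x ^ j * (1 / (1 + h / x) ^ j - (\<Sum>i=j..6. (-1) ^ (i - j) * real ((i - 1) choose (j - 1)) * (h / x) ^ (i - j)))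
    = 1 / (x + h) ^ j - (\<Sum>i=1..6. shift_coeff j h i / x ^ i)" if "x > 0" for x
  proof -
    have "x ^ j * (1 + h / x) ^ j = (x + h) ^ j"
      using that by (simp add: power_mult_distrib[symmetric] field_simps)
    moreover have "(\<Sum>i=1..6. shift_coeff j h i / x ^ i) = (\<Sum>i=j..6. shift_coeff j h i / x ^ i)"
      using j by (intro sum.mono_neutral_right) (auto simp: shift_coeff_def)
    moreover have "\<dots> = (\<Sum>i=j..6. 1 / x ^ j * ((-1) ^ (i - j) * real ((i - 1) choose (j - 1)) * (h / x) ^ (i - j)))"
    proof (rule sum.cong)
      fix i assume i: "i \<in> {j..6}"
      then have "x ^ i = x ^ j * x ^ (i - j)" by (subst power_add[symmetric]) auto
      then show "shift_coeff j h i / x ^ i = 1 / x ^ j * ((-1) ^ (i - j) * real ((i - 1) choose (j - 1)) * (h / x) ^ (i - j))"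
        using i by (simp add: shift_coeff_def power_divide)
    qed simp
    ultimately show ?thesis
      by (simp add: right_diff_distrib sum_distrib_left)
  qed
  show ?thesis
    unfolding expansion_def
    by (rule landau_o.big.in_cong[THEN iffD1, OF _ big])
       (use eventually_gt_at_top[of 0] in eventually_elim, simp only: eq)
qed

text \<open>Five terms suffice for matching up to order six: in
  \<open>inverse_poly A (x + h) - inverse_poly A x\<close> the coefficient of order \<open>i\<close>
  involves only \<open>A j\<close> with \<open>j < i\<close>.\<close>

definition inverse_poly :: "(nat \<Rightarrow> real) \<Rightarrow> real \<Rightarrow> real"
  where "inverse_poly A x = (\<Sum>j=1..5. A j / x ^ j)"

lemma expansion_inverse_poly_shift:
  assumes "h > 0"
  shows "expansion (\<lambda>x. inverse_poly A (x + h)) (\<lambda>i. \<Sum>j=1..5. A j * shift_coeff j h i)"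
  unfolding inverse_poly_def
  using expansion_sum[of "{1..5}" "\<lambda>j x. A j * (1 / (x + h) ^ j)" "\<lambda>j i. A j * shift_coeff j h i"]
    expansion_cmult[OF expansion_shift[OF assms]] by simp

lemma expansion_inverse_poly:
  "expansion (inverse_poly A) (\<lambda>i. if i \<le> 5 then A i else 0)"
proof -
  have "inverse_poly A x - (\<Sum>i=1..6. (if i \<le> 5 then A i else 0) / x ^ i) = 0" for x
    by (simp add: inverse_poly_def numeral_eq_Suc)
  then show ?thesis
    by (simp only: expansion_def) simp
qed

text \<open>An estimate for every \<open>k\<close> and not only eventually, because it will be
  summed along progressions that start at an arbitrary \<open>k\<close>; \<open>M\<close> absorbs
  the finitely many exceptions.\<close>

lemma expansion_zero_bound:
  assumes "expansion f (\<lambda>_. 0)"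
  obtains M where "\<And>k::nat. \<bar>f (real k + 1)\<bar> \<le> M / (real k + 1) ^ 7"
proof -
  have "f \<in> O(\<lambda>x. 1 / x ^ 7)"
    using assms by (simp add: expansion_def)
  moreover have "filterlim (\<lambda>k::nat. real k + 1) at_top sequentially"
    by real_asymp
  ultimately have "(\<lambda>k::nat. f (real k + 1)) \<in> O(\<lambda>k. 1 / (real k + 1) ^ 7)"
    by (rule landau_o.big.compose)
  then obtain c where "\<forall>\<^sub>F k::nat in sequentially. \<bar>f (real k + 1)\<bar> \<le> c * \<bar>1 / (real k + 1) ^ 7\<bar>"
    by (auto elim!: landau_o.bigE)
  then obtain N where N: "\<And>k::nat. k \<ge> N \<Longrightarrow> \<bar>f (real k + 1)\<bar> \<le> c / (real k + 1) ^ 7"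
    by (auto simp: eventually_sequentially power_abs)
  define M where "M = \<bar>c\<bar> + (\<Sum>k<N. \<bar>f (real k + 1)\<bar> * (real k + 1) ^ 7)"
  have "\<bar>f (real k + 1)\<bar> \<le> M / (real k + 1) ^ 7" for k :: nat
  proof (cases "k < N")
    case True
    then have "\<bar>f (real k + 1)\<bar> * (real k + 1) ^ 7 \<le> (\<Sum>k<N. \<bar>f (real k + 1)\<bar> * (real k + 1) ^ 7)"
      by (intro member_le_sum) auto
    then have "\<bar>f (real k + 1)\<bar> * (real k + 1) ^ 7 \<le> M"
      by (simp add: M_def)
    then show ?thesis
      by (subst pos_le_divide_eq) auto
  next
    case False
    have "0 \<le> (\<Sum>k<N. \<bar>f (real k + 1)\<bar> * (real k + 1) ^ 7)"
      by (intro sum_nonneg) auto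
    then have "c / (real k + 1) ^ 7 \<le> M / (real k + 1) ^ 7"
      by (intro divide_right_mono) (auto simp: M_def)
    with N[of k] False show ?thesis by simp
  qed
  then show thesis by (rule that)
qed

text \<open>As \<open>h \<ge> 1\<close>, the terms are dominated by \<open>1 / (x + i)^2\<close>,
  hence by twice the telescoping difference \<open>1 / (x + i) - 1 / (x + i + 1)\<close>. This is
  the one order in \<open>x\<close> that a summation costs.\<close>

lemma summable_shifted_inverse_squares:
  fixes x h :: real
  assumes x: "x \<ge> 1" and h: "h \<ge> 1"
  shows "summable (\<lambda>i. 1 / (x + real i * h) ^ 2)" "(\<Sum>i. 1 / (x + real i * h) ^ 2) \<le> 2 / x"
proof -
  have le: "1 / (x + real i * h) ^ 2 \<le> 2 * (1 / (x + real i) - 1 / (x + real (Suc i)))" for i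
  proof -
    define y where "y = x + real i"
    have y: "y \<ge> 1" using x by (simp add: y_def)
    have "y \<le> x + real i * h" using h by (simp add: y_def mult_le_cancel_left1)
    then have "1 / (x + real i * h) ^ 2 \<le> 1 / y ^ 2"
      using y by (intro divide_left_mono power_mono mult_pos_pos zero_less_power) auto
    also have "\<dots> \<le> 2 * (1 / y - 1 / (y + 1))"
    proof -
      have "y * (1 + y) \<le> 2 * y ^ 2" using y by (simp add: power2_eq_square distrib_left mult_le_cancel_left1)
      then have "2 / (2 * y ^ 2) \<le> 2 / (y * (1 + y))"
        using y by (intro divide_left_mono mult_pos_pos) auto
      then have "1 / y ^ 2 \<le> 2 / (y * (1 + y))" by simp
      also have "\<dots> = 2 * (1 / y - 1 / (y + 1))" using y by (simp add: field_simps)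
      finally show ?thesis .
    qed
    finally show ?thesis by (simp add: y_def add_ac)
  qed
  have "(\<lambda>i. 1 / (x + real i)) \<longlonglongrightarrow> 0"
    by real_asymp
  then have "(\<lambda>i. 1 / (x + real i) - 1 / (x + real (Suc i))) sums (1 / (x + real 0) - 0)"
    by (rule telescope_sums')
  then have sums: "(\<lambda>i. 2 * (1 / (x + real i) - 1 / (x + real (Suc i)))) sums (2 / x)"
    by (drule_tac sums_mult[where c = 2]) (simp only: of_nat_0 add_0_right diff_zero mult_1_right times_divide_eq_right)
  show summ: "summable (\<lambda>i. 1 / (x + real i * h) ^ 2)"
    by (rule summable_comparison_test[OF _ sums_summable[OF sums]]) (use le in auto)
  show "(\<Sum>i. 1 / (x + real i * h) ^ 2) \<le> 2 / x"
    using suminf_le[OF le summ sums_summable[OF sums]] sums_unique[OF sums] by simp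
qed

lemma periodic_mult:
  fixes C :: "nat \<Rightarrow> 'a"
  assumes "\<And>k. C (k + p) = C k"
  shows "C (k + i * p) = C k"
proof (induction i)
  case (Suc i)
  then show ?case using assms[of "k + i * p"] by (simp add: add_ac)
qed simp

lemma periodic_bigo_1:
  fixes C :: "nat \<Rightarrow> complex"
  assumes "p > 0" "\<And>k. C (k + p) = C k"
  shows "C \<in> O(\<lambda>_. 1)"
proof -
  have "norm (C k) \<le> (\<Sum>j<p. norm (C j))" for k
  proof -
    have "C k = C (k mod p)"
      using periodic_mult[of C p "k mod p" "k div p"] assms(2) by simp
    then show ?thesis
      using assms(1) by (auto intro!: member_le_sum)
  qed
  then show ?thesis
    by (intro bigoI[of _ "\<Sum>j<p. norm (C j)"]) auto
qed

section \<open>Weights of commuting shifts\<close>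

lemma abs_exp_minus_1_le:
  fixes y :: real
  assumes "\<bar>y\<bar> \<le> 1 / 2"
  shows "\<bar>exp y - 1\<bar> \<le> 2 * \<bar>y\<bar>"
proof -
  have y: "\<bar>y\<bar> < 1" using assms by simp
  have "1 - y \<le> exp (- y)" using exp_ge_add_one_self[of "- y"] by simp
  then have "exp y \<le> 1 / (1 - y)"
    using y by (simp add: exp_minus field_simps)
  moreover have "1 / (1 - y) - 1 \<le> 2 * \<bar>y\<bar>"
  proof (cases "y \<ge> 0")
    case True
    then have "0 \<le> y * (1 - 2 * y)" using assms by (intro mult_nonneg_nonneg) auto
    with True y show ?thesis by (simp add: field_simps)
  next
    case False
    then have "1 / (1 - y) \<le> 1" by (simp add: field_simps)
    then show ?thesis by linarith
  qed
  moreover have "1 + y \<le> exp y" by (rule exp_ge_add_one_self)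
  ultimately show ?thesis by linarith
qed

text \<open>Removing \<open>exp Q\<close> leaves a sequence \<open>e\<close> with
  \<open>e (k + p) = e k * exp (\<delta> k)\<close>, where \<open>\<delta>\<close> is summable along
  steps of \<open>p\<close>. So \<open>e\<close> converges along every progression, its limit
  \<open>C\<close> is the periodic factor, and the tail \<open>\<sigma>\<close> of the sum measures
  the distance from it.\<close>

lemma shift_recurrence_asymptotics:
  fixes a :: "nat \<Rightarrow> complex" and Q R :: "real \<Rightarrow> real"
  assumes p: "p > 0"
    and rec: "\<And>k. a (k + p) = of_real (exp (R (real k + 1))) * a k"
    and Q: "expansion (\<lambda>x. R x - (Q (x + real p) - Q x)) (\<lambda>_. 0)"
  obtains C where "\<And>k. C (k + p) = C k" "\<And>k. C k = 0 \<longleftrightarrow> a k = 0"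
    "(\<lambda>k. a k * of_real (exp (- Q (real k + 1))) - C k) \<in> O(\<lambda>k. 1 / of_nat (k + 1) ^ 6)"
proof -
  define \<delta> where "\<delta> k = R (real k + 1) - (Q (real k + 1 + real p) - Q (real k + 1))" for k :: nat
  define e where "e k = a k * of_real (exp (- Q (real k + 1)))" for k
  define \<sigma> where "\<sigma> k = (\<Sum>i. \<delta> (k + i * p))" for k
  obtain M where M: "\<And>k. \<bar>\<delta> k\<bar> \<le> M / (real k + 1) ^ 7"
    using expansion_zero_bound[OF Q] unfolding \<delta>_def by blast
  have M0: "M \<ge> 0"
    using M[of 0] by simp
  \<comment> \<open>Of the seven powers, two make the series converge and five are kept as decay in
    \<open>k\<close>; the tail of the series adds the sixth.\<close>
  have bound: "\<bar>\<delta> (k + i * p)\<bar> \<le> M / (real k + 1) ^ 5 * (1 / (real k + 1 + real i * real p) ^ 2)" for k i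
  proof -
    have "(real k + 1) ^ 5 * (real k + 1 + real i * real p) ^ 2 \<le> (real k + 1 + real i * real p) ^ 5 * (real k + 1 + real i * real p) ^ 2"
      by (intro mult_right_mono power_mono) auto
    also have "\<dots> = (real (k + i * p) + 1) ^ 7"
      by (simp add: power_add[symmetric] add_ac)
    finally have *: "(real k + 1) ^ 5 * (real k + 1 + real i * real p) ^ 2 \<le> (real (k + i * p) + 1) ^ 7" .
    have "0 < real k + 1 + real i * real p" by (rule add_pos_nonneg) auto
    moreover have "0 < real (k + i * p) + 1" by (rule add_nonneg_pos) auto
    ultimately have "M / (real (k + i * p) + 1) ^ 7 \<le> M / ((real k + 1) ^ 5 * (real k + 1 + real i * real p) ^ 2)"
      using M0 * by (intro divide_left_mono mult_pos_pos zero_less_power) auto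
    with M[of "k + i * p"] show ?thesis by simp
  qed
  have summ: "summable (\<lambda>i. \<bar>\<delta> (k + i * p)\<bar>)" for k
  proof (rule summable_comparison_test)
    show "summable (\<lambda>i. M / (real k + 1) ^ 5 * (1 / (real k + 1 + real i * real p) ^ 2))"
      using p by (intro summable_mult summable_shifted_inverse_squares) auto
  qed (use bound in auto)
  have sigma_bound: "\<bar>\<sigma> k\<bar> \<le> 2 * M / (real k + 1) ^ 6" for k
  proof -
    note sq = summable_shifted_inverse_squares[of "real k + 1" "real p"]
    have "\<bar>\<sigma> k\<bar> \<le> (\<Sum>i. \<bar>\<delta> (k + i * p)\<bar>)"
      unfolding \<sigma>_def by (rule summable_rabs[OF summ])
    also have "\<dots> \<le> (\<Sum>i. M / (real k + 1) ^ 5 * (1 / (real k + 1 + real i * real p) ^ 2))"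
      using sq p by (intro suminf_le bound summ summable_mult) auto
    also have "\<dots> = M / (real k + 1) ^ 5 * (\<Sum>i. 1 / (real k + 1 + real i * real p) ^ 2)"
      using sq p by (intro suminf_mult) auto
    also have "\<dots> \<le> M / (real k + 1) ^ 5 * (2 / (real k + 1))"
      using sq p M0 by (intro mult_left_mono) auto
    also have "\<dots> = 2 * M / (real k + 1) ^ 6"
      by (simp add: numeral_eq_Suc mult_ac)
    finally show ?thesis .
  qed
  have e_rec: "e (k + p) = e k * of_real (exp (\<delta> k))" for k
  proof -
    have "exp (R (real k + 1)) * exp (- Q (real (k + p) + 1)) = exp (- Q (real k + 1)) * exp (\<delta> k)"
      by (simp add: \<delta>_def exp_add[symmetric] add_ac)
    then show ?thesis
      unfolding e_def rec by (simp add: mult_ac flip: of_real_mult)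
  qed
  have sigma_rec: "\<sigma> k = \<delta> k + \<sigma> (k + p)" for k
    unfolding \<sigma>_def using suminf_split_head[OF summable_rabs_cancel[OF summ[of k]]]
    by (simp add: add_ac)
  \<comment> \<open>The limit of \<open>e (k + i * p)\<close> as \<open>i\<close> grows.\<close>
  define C where "C k = e k * of_real (exp (\<sigma> k))" for k
  have per: "C (k + p) = C k" for k
    unfolding C_def e_rec sigma_rec[of k] by (simp add: exp_add)
  have "(\<lambda>k. exp (- \<sigma> k) - 1) \<in> O(\<lambda>k. 1 / (real k + 1) ^ 6)"
  proof -
    have so: "\<sigma> \<in> O(\<lambda>k. 1 / (real k + 1) ^ 6)"
      using sigma_bound by (intro bigoI[of _ "2 * M"]) (auto simp: power_abs)
    have "\<sigma> \<longlonglongrightarrow> 0"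
    proof (rule Lim_null_comparison)
      show "(\<lambda>k. 2 * M / (real k + 1) ^ 6) \<longlonglongrightarrow> 0" by real_asymp
    qed (use sigma_bound in auto)
    then have "\<forall>\<^sub>F k in sequentially. \<bar>\<sigma> k\<bar> < 1 / 2"
      by (auto simp: tendsto_iff dist_norm dest: spec[of _ "1/2"])
    then have "(\<lambda>k. exp (- \<sigma> k) - 1) \<in> O(\<sigma>)"
      by (intro bigoI[of _ 2]) (auto elim!: eventually_mono intro: abs_exp_minus_1_le[of "- \<sigma> _", simplified])
    also note so
    finally show ?thesis .
  qed
  then have "(\<lambda>k. of_real (exp (- \<sigma> k) - 1) :: complex) \<in> O(\<lambda>k. 1 / of_nat (k + 1) ^ 6)"
    using landau_o.big.of_real_iff[where 'b = complex, of "\<lambda>k. exp (- \<sigma> k) - 1" sequentially "\<lambda>k. 1 / (real k + 1) ^ 6"]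
    by (simp add: add_ac)
  then have "(\<lambda>k. C k * of_real (exp (- \<sigma> k) - 1)) \<in> O(\<lambda>k. 1 * (1 / of_nat (k + 1) ^ 6))"
    by (intro landau_o.big.mult periodic_bigo_1[OF p, of C] per)
  moreover have "C k * of_real (exp (- \<sigma> k) - 1) = e k - C k" for k
  proof -
    have "of_real (exp (\<sigma> k)) * (of_real (exp (- \<sigma> k)) :: complex) = 1"
      by (simp add: exp_minus flip: of_real_mult)
    then show ?thesis
      by (simp add: C_def algebra_simps)
  qed
  ultimately have "(\<lambda>k. e k - C k) \<in> O(\<lambda>k. 1 / of_nat (k + 1) ^ 6)"
    by simp
  with per show thesis
    by (intro that[of C]) (auto simp: e_def C_def)
qed

section \<open>Stirling coefficients of Gamma quotients\<close>

lemma expansion_cong: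
  assumes "expansion f c" "\<And>i. i \<in> {1..6} \<Longrightarrow> c i = d i"
  shows "expansion f d"
proof -
  have "(\<Sum>i=1..6. c i / x ^ i) = (\<Sum>i=1..6. d i / x ^ i)" for x
    using assms(2) by (intro sum.cong) auto
  with assms(1) show ?thesis by (simp only: expansion_def)
qed

definition log_coeff :: "real \<Rightarrow> nat \<Rightarrow> real"
  where "log_coeff c i = (-1) ^ Suc i * c ^ i / real i"

definition shifted_coeff :: "(nat \<Rightarrow> real) \<Rightarrow> real \<Rightarrow> nat \<Rightarrow> real"
  where "shifted_coeff A h i = (\<Sum>j=1..5. A j * shift_coeff j h i)"

text \<open>Up to a constant this is \<open>(-1)\<^sup>j\<^sup>+\<^sup>1 s\<^sup>j B\<^sub>j\<^sub>+\<^sub>1(c/s) / (j (j+1))\<close> with Bernoulli polynomials, the coefficients in the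
  Stirling expansion of \<open>ln \<Gamma>((x+c)/s)\<close>.\<close>

definition bernoulli_part :: "nat \<Rightarrow> real \<Rightarrow> real \<Rightarrow> real"
  where "bernoulli_part j s c =
    (if j = 1 then (c ^ 2 / s - c) / 2
     else if j = 2 then - (c ^ 3 / s - 3 / 2 * c ^ 2 + s * c / 2) / 6
     else if j = 3 then (c ^ 4 / s - 2 * c ^ 3 + s * c ^ 2) / 12
     else if j = 4 then - (c ^ 5 / s - 5 / 2 * c ^ 4 + 5 / 3 * s * c ^ 3 - s ^ 3 * c / 6) / 20
     else (c ^ 6 / s - 3 * c ^ 5 + 5 / 2 * s * c ^ 4 - s ^ 3 * c ^ 2 / 2) / 30)"

text \<open>Coefficients of \<open>ln (\<Gamma>((x+u+h)/s) \<Gamma>((x+v)/s) / (\<Gamma>((x+u)/s) \<Gamma>((x+v+h)/s)))\<close>.\<close>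

definition gamma_coeff :: "real \<Rightarrow> real \<Rightarrow> real \<Rightarrow> real \<Rightarrow> nat \<Rightarrow> real"
  where "gamma_coeff s h u v i = bernoulli_part i s (u + h) - bernoulli_part i s u
    - bernoulli_part i s (v + h) + bernoulli_part i s v"

lemma atLeastAtMost_1_5: "{1..5::nat} = {1, 2, 3, 4, 5}" by auto

lemma choose_small:
  "(3::nat) choose 2 = 3" "(4::nat) choose 2 = 6" "(5::nat) choose 2 = 10"
  "(4::nat) choose 3 = 4" "(5::nat) choose 3 = 10" "(5::nat) choose 4 = 5"
  by (simp_all add: numeral_eq_Suc)

lemma shifted_coeff_simps:
  "shifted_coeff A h (Suc 0) = A (Suc 0)"
  "shifted_coeff A h 2 = A 2 - A (Suc 0) * h"
  "shifted_coeff A h 3 = A 3 - 2 * A 2 * h + A (Suc 0) * h ^ 2"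
  "shifted_coeff A h 4 = A 4 - 3 * A 3 * h + 3 * A 2 * h ^ 2 - A (Suc 0) * h ^ 3"
  "shifted_coeff A h 5 = A 5 - 4 * A 4 * h + 6 * A 3 * h ^ 2 - 4 * A 2 * h ^ 3 + A (Suc 0) * h ^ 4"
  "shifted_coeff A h 6 = - 5 * A 5 * h + 10 * A 4 * h ^ 2 - 10 * A 3 * h ^ 3 + 5 * A 2 * h ^ 4 - A (Suc 0) * h ^ 5"
  unfolding shifted_coeff_def atLeastAtMost_1_5
  by (simp_all add: shift_coeff_def choose_small)

text \<open>The functional equation \<open>\<Gamma>(z + 1) = z \<Gamma>(z)\<close> at
  \<open>z = (x + c)/s\<close>, taken relative to \<open>c = 0\<close> and read off in coefficients:
  the right-hand side belongs to \<open>ln (1 + c / x) - (c / s) * ln (1 + s / x)\<close>. The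
  second term stems from the factor \<open>x^(c/s)\<close> of the Gamma quotient, whose logarithm is
  no series in \<open>1/x\<close>.\<close>

lemma bernoulli_part_difference:
  assumes "s > 0" "i \<in> {1..6}"
  shows "shifted_coeff (\<lambda>j. bernoulli_part j s c) s i - (if i \<le> 5 then bernoulli_part i s c else 0)
    = (-1) ^ Suc i * (c ^ i - c * s ^ (i - 1)) / real i"
proof -
  have "i \<in> {1, 2, 3, 4, 5, 6}" using assms by auto
  then show ?thesis
    using assms(1)
    by (elim insertE emptyE; simp add: bernoulli_part_def shifted_coeff_simps;
        simp add: field_simps power_numeral_reduce)
qed

text \<open>The logarithm of \<open>(x + u) / (x + v)\<close>, split so that each summand expands in
  \<open>1/x\<close>.\<close>

definition log_frac :: "real \<Rightarrow> real \<Rightarrow> real \<Rightarrow> real"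
  where "log_frac u v x = ln (1 + u / x) - ln (1 + v / x)"

lemma exp_log_frac:
  assumes "u \<ge> 0" "v \<ge> 0" "x > 0"
  shows "exp (log_frac u v x) = (x + u) / (x + v)"
proof -
  have "1 + u / x = (x + u) / x" "1 + v / x = (x + v) / x"
    using assms by (simp_all add: field_simps)
  moreover have "0 < (x + u) / x" "0 < (x + v) / x"
    using assms by simp_all
  ultimately show ?thesis
    using assms(3) by (simp add: log_frac_def exp_diff)
qed

lemma expansion_log_frac:
  assumes "u > 0" "v > 0"
  shows "expansion (log_frac u v) (\<lambda>i. log_coeff u i - log_coeff v i)"
  unfolding log_frac_def log_coeff_def by (intro expansion_diff expansion_ln assms)

lemma expansion_shifted:
  assumes "h > 0"
  shows "expansion (\<lambda>x. inverse_poly A (x + h)) (shifted_coeff A h)"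
  unfolding shifted_coeff_def by (rule expansion_inverse_poly_shift[OF assms])

lemma gamma_coeff_solves:
  assumes "s > 0" "h > 0" "u > 0" "v > 0"
  shows "expansion (\<lambda>x. (log_frac (u + h) (v + h) x - log_frac u v x) -
    (inverse_poly (gamma_coeff s h u v) (x + s) - inverse_poly (gamma_coeff s h u v) x)) (\<lambda>_. 0)"
proof (rule expansion_cong)
  show "expansion (\<lambda>x. (log_frac (u + h) (v + h) x - log_frac u v x) -
    (inverse_poly (gamma_coeff s h u v) (x + s) - inverse_poly (gamma_coeff s h u v) x))
    (\<lambda>i. (log_coeff (u + h) i - log_coeff (v + h) i - (log_coeff u i - log_coeff v i)) -
      (shifted_coeff (gamma_coeff s h u v) s i - (if i \<le> 5 then gamma_coeff s h u v i else 0)))"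
    using assms by (intro expansion_diff expansion_log_frac expansion_shifted expansion_inverse_poly) auto
next
  fix i :: nat assume i: "i \<in> {1..6}"
  define E where "E c = (-1) ^ Suc i * (c ^ i - c * s ^ (i - 1)) / real i" for c
  have E: "shifted_coeff (\<lambda>j. bernoulli_part j s c) s i - (if i \<le> 5 then bernoulli_part i s c else 0) = E c" for c
    unfolding E_def by (rule bernoulli_part_difference[OF assms(1) i])
  have "shifted_coeff (gamma_coeff s h u v) s i = shifted_coeff (\<lambda>j. bernoulli_part j s (u + h)) s i
    - shifted_coeff (\<lambda>j. bernoulli_part j s u) s i - shifted_coeff (\<lambda>j. bernoulli_part j s (v + h)) s i
    + shifted_coeff (\<lambda>j. bernoulli_part j s v) s i"
    by (simp add: shifted_coeff_def gamma_coeff_def sum.distrib sum_subtractf algebra_simps)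
  then have "shifted_coeff (gamma_coeff s h u v) s i - (if i \<le> 5 then gamma_coeff s h u v i else 0)
    = E (u + h) - E u - E (v + h) + E v"
    using E[of "u + h"] E[of u] E[of "v + h"] E[of v] by (auto simp: gamma_coeff_def split: if_splits)
  \<comment> \<open>The part of \<open>E\<close> linear in its argument drops out of the alternating
    sum, since \<open>(u + h) - u - (v + h) + v = 0\<close>.\<close>
  also have "\<dots> = log_coeff (u + h) i - log_coeff (v + h) i - (log_coeff u i - log_coeff v i)"
    by (simp add: E_def log_coeff_def algebra_simps add_divide_distrib diff_divide_distrib)
  finally show "(log_coeff (u + h) i - log_coeff (v + h) i - (log_coeff u i - log_coeff v i)) -
      (shifted_coeff (gamma_coeff s h u v) s i - (if i \<le> 5 then gamma_coeff s h u v i else 0)) = 0"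
    by simp
qed

text \<open>With \<open>\<alpha>(x) = (x+p)/(x+q)\<close>, and with \<open>A\<close>, \<open>B\<close> the exponentials of the truncated solutions of the two pure
  relations, these are the logarithms of \<open>\<alpha>(x) B(x+p) / (\<alpha>(x+l) B(x))\<close> and \<open>\<alpha>(x+l) B(x) / (\<beta>(x) A(x+s))\<close>. Exchanging
  \<open>p, q, l\<close> with \<open>s, r, m\<close> in the first one gives the corresponding quotient for \<open>\<beta>\<close> and \<open>A\<close>.\<close>

definition exchange_log :: "real \<Rightarrow> real \<Rightarrow> real \<Rightarrow> real \<Rightarrow> real \<Rightarrow> real \<Rightarrow> real"
  where "exchange_log p s q r l x = log_frac p q x - log_frac (p + l) (q + l) x
    + (inverse_poly (gamma_coeff s l s r) (x + p) - inverse_poly (gamma_coeff s l s r) x)"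

definition exchange_coeff :: "real \<Rightarrow> real \<Rightarrow> real \<Rightarrow> real \<Rightarrow> real \<Rightarrow> nat \<Rightarrow> real"
  where "exchange_coeff p s q r l i = (log_coeff p i - log_coeff q i)
    - (log_coeff (p + l) i - log_coeff (q + l) i)
    + (shifted_coeff (gamma_coeff s l s r) p i - (if i \<le> 5 then gamma_coeff s l s r i else 0))"

definition prefactor_log :: "real \<Rightarrow> real \<Rightarrow> real \<Rightarrow> real \<Rightarrow> real \<Rightarrow> real \<Rightarrow> real \<Rightarrow> real"
  where "prefactor_log p s q r m l x = (log_frac (p + l) (q + l) x - log_frac s r x)
    + (inverse_poly (gamma_coeff s l s r) x - inverse_poly (gamma_coeff p m p q) (x + s))"

definition prefactor_coeff :: "real \<Rightarrow> real \<Rightarrow> real \<Rightarrow> real \<Rightarrow> real \<Rightarrow> real \<Rightarrow> nat \<Rightarrow> real"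
  where "prefactor_coeff p s q r m l i = (log_coeff (p + l) i - log_coeff (q + l) i - (log_coeff s i - log_coeff r i))
    + ((if i \<le> 5 then gamma_coeff s l s r i else 0) - shifted_coeff (gamma_coeff p m p q) s i)"

lemma expansion_exchange_log:
  assumes "p > 0" "s > 0" "q > 0" "r > 0" "l > 0"
  shows "expansion (exchange_log p s q r l) (exchange_coeff p s q r l)"
  unfolding exchange_log_def exchange_coeff_def using assms
  by (intro expansion_diff expansion_add expansion_log_frac expansion_shifted expansion_inverse_poly) auto

lemma expansion_prefactor_log:
  assumes "p > 0" "s > 0" "q > 0" "r > 0" "l > 0"
  shows "expansion (prefactor_log p s q r m l) (prefactor_coeff p s q r m l)"
  unfolding prefactor_log_def prefactor_coeff_def using assms
  by (intro expansion_diff expansion_add expansion_log_frac expansion_shifted expansion_inverse_poly) auto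

text \<open>The Gamma quotient is trivial for \<open>h = 0\<close> and for \<open>u = v\<close>,
  whence the common factor. Pulling it out before expanding keeps the polynomial identities below
  manageable.\<close>

lemma gamma_coeff_factor:
  assumes "s > 0"
  shows "gamma_coeff s h u v (Suc 0) = (h / s * (u - v))"
    and "gamma_coeff s h u v 2 = - (h / s * (u - v)) * (u + v + h - s) / 2"
    and "gamma_coeff s h u v 3 = (h / s * (u - v)) *
      (4 * (u^2 + u * v + v^2) + 6 * h * (u + v) + 4 * h^2 - 6 * s * (u + v + h) + 2 * s^2) / 12"
    and "gamma_coeff s h u v 4 = - (h / s * (u - v)) *
      (5 * (u^3 + u^2 * v + u * v^2 + v^3) + 10 * h * (u^2 + u * v + v^2) + 10 * h^2 * (u + v) + 5 * h^3
       - 5 / 2 * s * (4 * (u^2 + u * v + v^2) + 6 * h * (u + v) + 4 * h^2) + 5 * s^2 * (u + v + h)) / 20"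
    and "gamma_coeff s h u v 5 = (h / s * (u - v)) *
      (6 * (u^4 + u^3 * v + u^2 * v^2 + u * v^3 + v^4) + 15 * h * (u^3 + u^2 * v + u * v^2 + v^3) + 20 * h^2 * (u^2 + u * v + v^2) + 15 * h^3 * (u + v) + 6 * h^4
       - 3 * s * (5 * (u^3 + u^2 * v + u * v^2 + v^3) + 10 * h * (u^2 + u * v + v^2) + 10 * h^2 * (u + v) + 5 * h^3)
       + 5 / 2 * s^2 * (4 * (u^2 + u * v + v^2) + 6 * h * (u + v) + 4 * h^2) - s^4) / 30"
  using assms by (simp_all add: gamma_coeff_def bernoulli_part_def field_simps power_numeral_reduce)

lemmas coeff_simps = exchange_coeff_def prefactor_coeff_def log_coeff_def shifted_coeff_simps gamma_coeff_factor

lemma exchange_coeff_1: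
  assumes "s > 0"
  shows "exchange_coeff p s q r l 1 = 0"
  using assms by (simp add: coeff_simps)

text \<open>For \<open>q = (p + n) / 2\<close> and \<open>r = (s + d) / 2\<close> the factor
  \<open>s * q - p * r\<close> equals \<open>(s * n - p * d) / 2\<close>: this is where the two
  cases separate.\<close>

lemma exchange_coeff_2:
  assumes "s > 0"
  shows "exchange_coeff p s q r l 2 = - (l / s) * (s * q - p * r)"
  using assms by (simp add: coeff_simps field_simps power_numeral_reduce)

text \<open>Makes the quotient of the third coefficient by the second the same on both sides of the
  mixed relation, so that after elimination of \<open>C\<close> and \<open>D\<close> only the
  prefactor survives at order three.\<close>

lemma exchange_coeff_3_proportional:
  assumes "s > 0" "p > 0" "l = m + s - p"
  shows "exchange_coeff p s q r l 3 * (m / p) = - exchange_coeff s p r q m 3 * (l / s)"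
  using assms(1,2) unfolding assms(3) by (simp add: coeff_simps field_simps power_numeral_reduce)

text \<open>If \<open>s * q \<noteq> p * r\<close>, this can vanish only for \<open>m = p\<close>.
  If \<open>s * q = p * r\<close>, it vanishes identically and the coefficient of order two has to
  take over.\<close>

lemma prefactor_coeff_1:
  assumes "s > 0" "p > 0" "l = m + s - p"
  shows "prefactor_coeff p s q r m l 1 = (p - m) * (r / s - q / p)"
  using assms(1,2) unfolding assms(3) by (simp add: coeff_simps field_simps power_numeral_reduce)

text \<open>Removes the division by \<open>s\<close> from the factor of
  \<open>gamma_coeff_factor\<close> when \<open>u = s\<close> and \<open>v = s * t\<close>, before
  the polynomials are expanded.\<close>

lemma divide_mult_diff_cancel:
  fixes l s t :: real
  assumes "s > 0"
  shows "(l / s) * (s - s * t) = l * (1 - t)"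
  using assms by (simp add: field_simps)

text \<open>The degenerate case is \<open>s q = p r\<close>, parametrised by \<open>t = q/p = r/s\<close>.\<close>

lemma exchange_coeff_2_degenerate:
  assumes "s > 0" "p > 0"
  shows "exchange_coeff p s (p * t) (s * t) l 2 = 0"
  using assms by (simp add: exchange_coeff_2)

lemma exchange_coeff_3_degenerate:
  assumes "s > 0"
  shows "exchange_coeff p s (p * t) (s * t) l 3 = - l * (p * t * (s - p) * (t - 1))"
  using assms by (simp add: coeff_simps divide_mult_diff_cancel, simp add: field_simps power_numeral_reduce)

text \<open>The leading coefficient times a bracket. Exchanging \<open>p\<close> with
  \<open>s\<close> and \<open>l\<close> with \<open>m\<close> changes only the last summand of the
  bracket: the others are symmetric, because \<open>l - s = m - p\<close> in the
  application.\<close>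

lemma exchange_coeff_5_degenerate:
  assumes "s > 0"
  shows "exchange_coeff p s (p * t) (s * t) l 5 = - l * (p * t * (s - p) * (t - 1)) *
    (((p + s) * (1 + t)) ^ 2 - (p * s * t + (p + s * t) * (s + p * t))
      + 2 * (l - s) * ((p + s) * (1 + t)) + (2 * l - s) * (l - s))"
  using assms by (simp add: coeff_simps divide_mult_diff_cancel, simp add: field_simps power_numeral_reduce)

text \<open>The subtracted difference is that of the last summands in
  \<open>exchange_coeff_5_degenerate\<close> for the two sides. It cancels on elimination and leaves
  \<open>(m - p) * (s - p)\<close> times a quadratic in \<open>t\<close> that is always
  positive.\<close>

lemma prefactor_coeff_2_degenerate:
  assumes "s > 0" "p > 0" "l = m + s - p"
  shows "prefactor_coeff p s (p * t) (s * t) m l 2 =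
    (m - p) * (s - p) * (1 + (t ^ 2 - t) / 2) - ((2 * l - s) * (l - s) - (2 * m - p) * (m - p))"
  using assms(1,2) unfolding assms(3)
  by (simp add: coeff_simps divide_mult_diff_cancel, simp add: field_simps power_numeral_reduce)

section \<open>Products of exponentials and periodic coefficients\<close>

lemma bigo_inverse_power:
  fixes c :: real
  assumes "k \<le> i"
  shows "(\<lambda>x. c / x ^ i) \<in> O(\<lambda>x. 1 / x ^ k)"
proof (rule bigoI[of _ "\<bar>c\<bar>"])
  show "\<forall>\<^sub>F x::real in at_top. norm (c / x ^ i) \<le> \<bar>c\<bar> * norm (1 / x ^ k)"
    using eventually_ge_at_top[of 1]
  proof eventually_elim
    case (elim x)
    then have "\<bar>c\<bar> / x ^ i \<le> \<bar>c\<bar> / x ^ k"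
      using assms by (intro divide_left_mono power_increasing mult_pos_pos) auto
    then show ?case using elim by simp
  qed
qed

lemma bigo_tendsto_0:
  fixes f g :: "'a \<Rightarrow> 'b::real_normed_field"
  assumes "f \<in> O[F](g)" "(g \<longlongrightarrow> 0) F"
  shows "(f \<longlongrightarrow> 0) F"
proof -
  from assms(1) obtain c where c: "\<forall>\<^sub>F x in F. norm (f x) \<le> c * norm (g x)"
    by (auto elim!: landau_o.bigE)
  moreover have "((\<lambda>x. c * norm (g x)) \<longlongrightarrow> 0) F"
    using tendsto_mult_left[OF tendsto_norm[OF assms(2)], of c] by simp
  ultimately show ?thesis
    by (rule Lim_null_comparison)
qed

lemma expansion_truncate:
  assumes f: "expansion f c" and k: "1 \<le> k" "k \<le> 7"
  shows "(\<lambda>x. f x - (\<Sum>i=1..<k. c i / x ^ i)) \<in> O(\<lambda>x. 1 / x ^ k)"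
proof -
  have "(\<lambda>x. 1 / x ^ 7) \<in> O(\<lambda>x. 1 / x ^ k :: real)"
    by (rule bigo_inverse_power) (use k in auto)
  with f have "(\<lambda>x. f x - (\<Sum>i=1..6. c i / x ^ i)) \<in> O(\<lambda>x. 1 / x ^ k)"
    unfolding expansion_def by (rule landau_o.big_trans)
  moreover have "(\<lambda>x. \<Sum>i=k..<7. c i / x ^ i) \<in> O(\<lambda>x. 1 / x ^ k)"
    by (intro big_sum_in_bigo bigo_inverse_power) auto
  ultimately have "(\<lambda>x. (f x - (\<Sum>i=1..6. c i / x ^ i)) + (\<Sum>i=k..<7. c i / x ^ i)) \<in> O(\<lambda>x. 1 / x ^ k)"
    by (rule sum_in_bigo)
  moreover have "(\<Sum>i=1..6. c i / x ^ i) = (\<Sum>i=1..<k. c i / x ^ i) + (\<Sum>i=k..<7. c i / x ^ i)" for x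
    using k by (subst sum.atLeastLessThan_concat) (auto intro!: sum.cong)
  ultimately show ?thesis by simp
qed

lemma abs_exp_minus_linear_le:
  fixes y :: real
  assumes "\<bar>y\<bar> \<le> 1 / 2"
  shows "\<bar>exp y - 1 - y\<bar> \<le> 2 * y ^ 2"
proof -
  have y: "\<bar>y\<bar> < 1" using assms by simp
  have "1 - y \<le> exp (- y)" using exp_ge_add_one_self[of "- y"] by simp
  then have "exp y \<le> 1 / (1 - y)"
    using y by (simp add: exp_minus field_simps)
  moreover have "1 / (1 - y) - 1 - y \<le> 2 * y ^ 2"
  proof -
    have "1 / (1 - y) - 1 - y = y ^ 2 / (1 - y)"
      using y by (simp add: field_simps power2_eq_square)
    also have "\<dots> \<le> y ^ 2 / (1 / 2)"
      using assms by (intro divide_left_mono) auto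
    finally show ?thesis by simp
  qed
  moreover have "1 + y \<le> exp y" by (rule exp_ge_add_one_self)
  ultimately show ?thesis by linarith
qed

lemma exp_minus_linear_bigo:
  fixes f :: "real \<Rightarrow> real"
  assumes "f \<in> O(\<lambda>x. 1 / x ^ n)" "n > 0"
  shows "(\<lambda>x. exp (f x) - 1 - f x) \<in> O(\<lambda>x. 1 / x ^ (2 * n))"
proof -
  have "((\<lambda>x::real. 1 / x ^ n) \<longlongrightarrow> 0) at_top"
    using assms(2) by real_asymp
  then have "(f \<longlongrightarrow> 0) at_top"
    by (rule bigo_tendsto_0[OF assms(1)])
  then have "\<forall>\<^sub>F x in at_top. \<bar>f x\<bar> < 1 / 2"
    by (auto simp: tendsto_iff dist_norm dest: spec[of _ "1/2"])
  then have "(\<lambda>x. exp (f x) - 1 - f x) \<in> O(\<lambda>x. f x ^ 2)"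
    by (intro bigoI[of _ 2]) (auto elim!: eventually_mono intro!: abs_exp_minus_linear_le)
  also have "(\<lambda>x. f x ^ 2) \<in> O(\<lambda>x. (1 / x ^ n) ^ 2)"
    by (intro landau_o.big_power assms)
  finally show ?thesis
    by (simp add: power_divide power_mult[symmetric] mult.commute)
qed

text \<open>Up to order \<open>2 * n - 1\<close> the function \<open>exp g - 1\<close> agrees with
  \<open>g\<close>, and \<open>exp w\<close> contributes only through the product of the two leading
  coefficients, which sits at order \<open>(n - 1) + n\<close>.\<close>

lemma exp_product_expansion:
  assumes g: "expansion g c" and w: "expansion w d" and n: "n = 2 \<or> n = 3"
    and c0: "\<And>i. 1 \<le> i \<Longrightarrow> i < n \<Longrightarrow> c i = 0"
    and d0: "\<And>i. 1 \<le> i \<Longrightarrow> i < n - 1 \<Longrightarrow> d i = 0"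
  shows "(\<lambda>x. exp (w x) * (exp (g x) - 1) - ((\<Sum>i=n..<2*n. c i / x ^ i) + d (n - 1) * c n / x ^ (2 * n - 1)))
    \<in> O(\<lambda>x. 1 / x ^ (2 * n))"
proof -
  have n': "1 \<le> n" "n \<le> 7" "1 \<le> 2 * n" "2 * n \<le> 7" "1 \<le> n - 1" "n - 1 \<le> 7" "n \<le> 2 * (n - 1)" "n > 0"
    using n by auto
  define S where "S x = (\<Sum>i=n..<2*n. c i / x ^ i)" for x :: real
  have "(\<Sum>i=1..<2*n. c i / x ^ i) = S x" for x
    unfolding S_def using n' c0 by (intro sum.mono_neutral_right) auto
  then have gS: "(\<lambda>x. g x - S x) \<in> O(\<lambda>x. 1 / x ^ (2 * n))"
    using expansion_truncate[OF g n'(3,4)] by simp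
  have "(\<Sum>i=1..<n. c i / x ^ i) = 0" for x :: real
    using c0 by (intro sum.neutral) auto
  then have "g \<in> O(\<lambda>x. 1 / x ^ n)"
    using expansion_truncate[OF g n'(1,2)] by simp
  from sum_in_bigo(1)[OF exp_minus_linear_bigo[OF this n'(8)] gS]
  have eS: "(\<lambda>x. (exp (g x) - 1) - S x) \<in> O(\<lambda>x. 1 / x ^ (2 * n))"
    by (simp add: algebra_simps)
  have SO: "S \<in> O(\<lambda>x. 1 / x ^ n)"
    unfolding S_def by (intro big_sum_in_bigo bigo_inverse_power) auto
  have "(\<lambda>x. 1 / x ^ (2 * n)) \<in> O(\<lambda>x. 1 / x ^ n :: real)"
    by (rule bigo_inverse_power) simp
  from sum_in_bigo(1)[OF landau_o.big_trans[OF eS this] SO]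
  have eO: "(\<lambda>x. exp (g x) - 1) \<in> O(\<lambda>x. 1 / x ^ n)"
    by (simp add: algebra_simps)
  have Sn: "(\<lambda>x. S x - c n / x ^ n) \<in> O(\<lambda>x. 1 / x ^ Suc n)"
  proof -
    have "S x - c n / x ^ n = (\<Sum>i=Suc n..<2*n. c i / x ^ i)" for x
      unfolding S_def using n' by (subst sum.atLeast_Suc_lessThan) auto
    moreover have "(\<lambda>x. \<Sum>i=Suc n..<2*n. c i / x ^ i) \<in> O(\<lambda>x. 1 / x ^ Suc n)"
      by (intro big_sum_in_bigo bigo_inverse_power) auto
    ultimately show ?thesis by simp
  qed
  have "(\<Sum>i=1..<n-1. d i / x ^ i) = 0" for x :: real
    using d0 by (intro sum.neutral) auto
  then have "w \<in> O(\<lambda>x. 1 / x ^ (n - 1))"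
    using expansion_truncate[OF w n'(5,6)] by simp
  then have "(\<lambda>x. exp (w x) - 1 - w x) \<in> O(\<lambda>x. 1 / x ^ (2 * (n - 1)))"
    by (rule exp_minus_linear_bigo) (use n' in auto)
  also have "(\<lambda>x. 1 / x ^ (2 * (n - 1))) \<in> O(\<lambda>x. 1 / x ^ n :: real)"
    by (rule bigo_inverse_power) (use n' in auto)
  finally have "(\<lambda>x. exp (w x) - 1 - w x) \<in> O(\<lambda>x. 1 / x ^ n)" .
  moreover have "(\<Sum>i=1..<n. d i / x ^ i) = d (n - 1) / x ^ (n - 1)" for x :: real
  proof -
    have "{1..<n} = insert (n - 1) {1..<n-1}" using n by auto
    then show ?thesis using d0 by simp
  qed
  then have "(\<lambda>x. w x - d (n - 1) / x ^ (n - 1)) \<in> O(\<lambda>x. 1 / x ^ n)"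
    using expansion_truncate[OF w n'(1,2)] by simp
  ultimately have "(\<lambda>x. (exp (w x) - 1 - w x) + (w x - d (n - 1) / x ^ (n - 1))) \<in> O(\<lambda>x. 1 / x ^ n)"
    by (rule sum_in_bigo)
  then have wO: "(\<lambda>x. exp (w x) - 1 - d (n - 1) / x ^ (n - 1)) \<in> O(\<lambda>x. 1 / x ^ n)"
    by (simp add: algebra_simps)
  have w1: "(\<lambda>x. 1 + d (n - 1) / x ^ (n - 1)) \<in> O(\<lambda>x. 1)"
    using bigo_inverse_power[of 0 "n - 1" "d (n - 1)"] by (intro sum_in_bigo) auto
  \<comment> \<open>The total error is split into three: that of \<open>exp w\<close> times
    \<open>exp g - 1\<close>, that of \<open>exp g - 1\<close> times the two known terms of
    \<open>exp w\<close>, and that of replacing \<open>S\<close> by its leading term next to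
    \<open>d (n - 1)\<close>. Each has order \<open>2 * n\<close>.\<close>
  have "(\<lambda>x. (exp (w x) - 1 - d (n - 1) / x ^ (n - 1)) * (exp (g x) - 1)) \<in> O(\<lambda>x. 1 / x ^ n * (1 / x ^ n))"
    by (intro landau_o.big.mult wO eO)
  moreover have "(\<lambda>x. (1 + d (n - 1) / x ^ (n - 1)) * ((exp (g x) - 1) - S x)) \<in> O(\<lambda>x. 1 * (1 / x ^ (2 * n)))"
    by (intro landau_o.big.mult w1 eS)
  moreover have "(\<lambda>x. d (n - 1) / x ^ (n - 1) * (S x - c n / x ^ n)) \<in> O(\<lambda>x. 1 / x ^ (n - 1) * (1 / x ^ Suc n))"
    by (intro landau_o.big.mult Sn bigo_inverse_power) auto
  moreover have "(\<lambda>x. 1 / x ^ n * (1 / x ^ n)) = (\<lambda>x::real. 1 / x ^ (2 * n))"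
    "(\<lambda>x. 1 / x ^ (n - 1) * (1 / x ^ Suc n)) = (\<lambda>x::real. 1 / x ^ (2 * n))"
    "(\<lambda>x. 1 * (1 / x ^ (2 * n))) = (\<lambda>x::real. 1 / x ^ (2 * n))"
    using n by (auto simp: numeral_eq_Suc mult_ac)
  ultimately have "(\<lambda>x. (exp (w x) - 1 - d (n - 1) / x ^ (n - 1)) * (exp (g x) - 1)
     + (1 + d (n - 1) / x ^ (n - 1)) * ((exp (g x) - 1) - S x) + d (n - 1) / x ^ (n - 1) * (S x - c n / x ^ n))
     \<in> O(\<lambda>x. 1 / x ^ (2 * n))"
    by (simp only: sum_in_bigo)
  moreover have "(exp (w x) - 1 - d (n - 1) / x ^ (n - 1)) * (exp (g x) - 1)
     + (1 + d (n - 1) / x ^ (n - 1)) * ((exp (g x) - 1) - S x) + d (n - 1) / x ^ (n - 1) * (S x - c n / x ^ n)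
     = exp (w x) * (exp (g x) - 1) - (S x + d (n - 1) * c n / x ^ (2 * n - 1))" for x
  proof -
    have identity: "(a - 1 - y) * e + (1 + y) * (e - t) + y * (t - z) = a * e - (t + y * z)" for a y e t z :: real
      by (simp add: algebra_simps)
    have "d (n - 1) / x ^ (n - 1) * (c n / x ^ n) = d (n - 1) * c n / x ^ (2 * n - 1)"
      using n by (auto simp: numeral_eq_Suc mult_ac)
    then show ?thesis by (subst identity) simp
  qed
  ultimately show ?thesis by (simp add: S_def)
qed

lemma periodic_tendsto_0:
  fixes P :: "nat \<Rightarrow> complex"
  assumes "p > 0" "\<And>k. P (k + p) = P k" "P \<longlonglongrightarrow> 0"
  shows "P k = 0"
proof -
  have "filterlim (\<lambda>i. k + i * p) sequentially sequentially"
    using assms(1) by (intro filterlim_subseq strict_monoI) simp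
  then have "(\<lambda>i. P (k + i * p)) \<longlonglongrightarrow> 0"
    using assms(3) by (rule filterlim_compose[rotated])
  then have "(\<lambda>i::nat. P k) \<longlonglongrightarrow> 0"
    using periodic_mult[of P p] assms(2) by simp
  then show ?thesis by (simp add: LIMSEQ_const_iff)
qed

lemma bigo_inverse_power_nat:
  assumes "j \<le> i"
  shows "(\<lambda>k. 1 / of_nat (k + 1) ^ i :: complex) \<in> O(\<lambda>k. 1 / of_nat (k + 1) ^ j)"
proof (intro bigoI[of _ 1] always_eventually allI)
  fix k
  have "1 / real (k + 1) ^ i \<le> 1 / real (k + 1) ^ j"
    using assms by (intro divide_left_mono power_increasing mult_pos_pos zero_less_power) auto
  then show "norm (1 / of_nat (k + 1) ^ i :: complex) \<le> 1 * norm (1 / of_nat (k + 1) ^ j :: complex)"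
    by (simp only: norm_divide norm_power norm_of_nat norm_one mult_1)
qed

text \<open>Uniqueness of asymptotic expansions survives periodic coefficients: the coefficient of
  order zero tends to zero along each residue class and so vanishes, and multiplication by
  \<open>k + 1\<close> lowers the remaining orders.\<close>

lemma periodic_expansion_zero:
  fixes P :: "nat \<Rightarrow> nat \<Rightarrow> complex"
  assumes p: "p > 0" and per: "\<And>j k. P j (k + p) = P j k"
    and O: "(\<lambda>k. \<Sum>j<n. P j k / of_nat (k + 1) ^ j) \<in> O(\<lambda>k. 1 / of_nat (k + 1) ^ n)"
    and j: "j < n"
  shows "P j k = 0"
  using O j per
proof (induction n arbitrary: P j k)
  case 0
  from 0(2) show ?case by simp
next
  case (Suc n)
  note per = Suc.prems(3)
  let ?x = "\<lambda>k::nat. of_nat (k + 1) :: complex"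
  have tail: "(\<lambda>k. (\<Sum>j<n. P (Suc j) k / ?x k ^ Suc j)) \<in> O(\<lambda>k. 1 / ?x k)"
  proof (rule big_sum_in_bigo)
    fix j
    have "(\<lambda>k. 1 / ?x k ^ Suc j) \<in> O(\<lambda>k. 1 / ?x k)"
      using bigo_inverse_power_nat[of 1 "Suc j"] by (simp only: power_one_right)
    from landau_o.big.mult[OF periodic_bigo_1[OF p, of "P (Suc j)", OF per] this]
    show "(\<lambda>k. P (Suc j) k / ?x k ^ Suc j) \<in> O(\<lambda>k. 1 / ?x k)"
      by (simp only: mult_1 times_divide_eq_right mult_1_right)
  qed
  have "(\<lambda>k. 1 / ?x k ^ Suc n) \<in> O(\<lambda>k. 1 / ?x k)"
    using bigo_inverse_power_nat[of 1 "Suc n"] by (simp only: power_one_right)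
  with Suc.prems(1) have "(\<lambda>k. \<Sum>j<Suc n. P j k / ?x k ^ j) \<in> O(\<lambda>k. 1 / ?x k)"
    by (rule landau_o.big_trans)
  from sum_in_bigo(2)[OF this tail] have "P 0 \<in> O(\<lambda>k. 1 / ?x k)"
    by (simp only: sum.lessThan_Suc_shift power_0 div_by_1 add_diff_cancel_right')
  moreover have "(\<lambda>k. 1 / ?x k) \<longlonglongrightarrow> 0"
  proof -
    have "(\<lambda>k. 1 / (real k + 1)) \<longlonglongrightarrow> 0" by real_asymp
    then have "(\<lambda>k. complex_of_real (1 / (real k + 1))) \<longlonglongrightarrow> of_real 0"
      by (rule tendsto_of_real)
    then show ?thesis by (simp add: add_ac)
  qed
  ultimately have "P 0 \<longlonglongrightarrow> 0"
    by (rule bigo_tendsto_0)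
  then have P0: "P 0 k = 0" for k
    using periodic_tendsto_0[OF p, of "P 0", OF per] by blast
  have "(\<lambda>k. ?x k * (\<Sum>j<Suc n. P j k / ?x k ^ j)) \<in> O(\<lambda>k. ?x k * (1 / ?x k ^ Suc n))"
    by (rule landau_o.big.mult[OF landau_o.big_refl Suc.prems(1)])
  moreover have "?x k * (\<Sum>j<Suc n. P j k / ?x k ^ j) = (\<Sum>j<n. P (Suc j) k / ?x k ^ j)" for k
  proof -
    have "?x k \<noteq> 0" by (simp del: of_nat_Suc)
    then show ?thesis
      by (simp add: sum.lessThan_Suc_shift P0 sum_distrib_left del: sum.lessThan_Suc of_nat_Suc)
  qed
  moreover have "?x k * (1 / ?x k ^ Suc n) = 1 / ?x k ^ n" for k
  proof -
    have "?x k \<noteq> 0" by (simp del: of_nat_Suc)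
    then show ?thesis by (simp del: of_nat_Suc)
  qed
  ultimately have "(\<lambda>k. \<Sum>j<n. P (Suc j) k / ?x k ^ j) \<in> O(\<lambda>k. 1 / ?x k ^ n)"
    by (simp only: simp_thms)
  then have "P (Suc j) k = 0" if "j < n" for j k
    using Suc.IH[of "\<lambda>j. P (Suc j)"] that per by blast
  with P0 Suc.prems(2) show ?case
    by (cases j) auto
qed

section \<open>Asymptotics of the unknown weights\<close>

lemma exp_inverse_poly_tendsto:
  assumes "h \<ge> 0"
  shows "(\<lambda>k. exp (inverse_poly A (real k + 1 + h))) \<longlonglongrightarrow> 1"
proof -
  have "(inverse_poly A \<longlongrightarrow> 0) at_top"
    unfolding inverse_poly_def
    by (intro tendsto_null_sum real_tendsto_divide_at_top tendsto_const filterlim_pow_at_top filterlim_ident) auto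
  moreover have "filterlim (\<lambda>k. real k + 1 + h) at_top sequentially"
    by real_asymp
  ultimately have "(\<lambda>k. inverse_poly A (real k + 1 + h)) \<longlonglongrightarrow> 0"
    by (rule filterlim_compose)
  then show ?thesis
    using tendsto_exp by fastforce
qed

lemma tendsto_imp_bigo_1:
  fixes f :: "nat \<Rightarrow> real"
  assumes "f \<longlonglongrightarrow> c"
  shows "(\<lambda>k. of_real (f k) :: complex) \<in> O(\<lambda>_. 1)"
proof -
  have "(\<lambda>k. of_real (f k) :: complex) \<longlonglongrightarrow> of_real c"
    using assms by (rule tendsto_of_real)
  then show ?thesis
    by (intro bigoI_tendsto[where c = "of_real c"]) auto
qed

lemma shift_recurrence_expansion:
  fixes a :: "nat \<Rightarrow> complex" and Q R :: "real \<Rightarrow> real"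
  assumes p: "p > 0"
    and rec: "\<And>k. a (k + p) = of_real (exp (R (real k + 1))) * a k"
    and Q: "expansion (\<lambda>x. R x - (inverse_poly A (x + real p) - inverse_poly A x)) (\<lambda>_. 0)"
  obtains C where "\<And>k. C (k + p) = C k" "\<And>k. C k = 0 \<longleftrightarrow> a k = 0"
    "(\<lambda>k. a k - C k * of_real (exp (inverse_poly A (real k + 1)))) \<in> O(\<lambda>k. 1 / of_nat (k + 1) ^ 6)"
proof -
  obtain C where C: "\<And>k. C (k + p) = C k" "\<And>k. C k = 0 \<longleftrightarrow> a k = 0"
    and O: "(\<lambda>k. a k * of_real (exp (- inverse_poly A (real k + 1))) - C k) \<in> O(\<lambda>k. 1 / of_nat (k + 1) ^ 6)"
    using shift_recurrence_asymptotics[OF p rec Q] by blast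
  have "(\<lambda>k. complex_of_real (exp (inverse_poly A (real k + 1)))) \<in> O(\<lambda>_. 1)"
    using tendsto_imp_bigo_1[OF exp_inverse_poly_tendsto[of 0 A]] by simp
  from landau_o.big.mult[OF O this]
  have "(\<lambda>k. (a k * of_real (exp (- inverse_poly A (real k + 1))) - C k) * of_real (exp (inverse_poly A (real k + 1))))
    \<in> O(\<lambda>k. 1 / of_nat (k + 1) ^ 6)"
    by simp
  moreover have "(a k * of_real (exp (- inverse_poly A (real k + 1))) - C k) * of_real (exp (inverse_poly A (real k + 1)))
    = a k - C k * of_real (exp (inverse_poly A (real k + 1)))" for k
    by (simp add: left_diff_distrib mult.assoc exp_minus flip: of_real_mult)
  ultimately show thesis
    using C by (intro that[of C]) simp_all
qed

text \<open>The weights see \<open>n\<close> and \<open>d\<close> only through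
  \<open>q = (p + n) / 2\<close> and \<open>r = (s + d) / 2\<close>, here arbitrary positive
  reals.\<close>

locale commuting_weights =
  fixes p s m l :: nat and q r :: real
  assumes p: "1 \<le> p" "p < s" and m: "1 \<le> m" "m < l" and lp: "l + p = m + s"
    and q: "q > 0" and r: "r > 0"
begin

definition \<alpha> :: "nat \<Rightarrow> real" where "\<alpha> k = (real k + 1 + real p) / (real k + 1 + q)"
definition \<beta> :: "nat \<Rightarrow> real" where "\<beta> k = (real k + 1 + real s) / (real k + 1 + r)"

definition A where "A = inverse_poly (gamma_coeff p m p q)"
definition B where "B = inverse_poly (gamma_coeff s l s r)"

lemma pos: "real p > 0" "real s > 0" "real m > 0" "real l > 0" "\<alpha> k > 0" "\<beta> k > 0"
  using p m q r by (auto simp: \<alpha>_def \<beta>_def intro!: divide_pos_pos add_pos_pos)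

lemma alpha_log: "\<alpha> (k + i) = exp (log_frac (real p + real i) (q + real i) (real k + 1))"
  using p q by (subst exp_log_frac) (auto simp: \<alpha>_def add_ac)

lemma beta_log: "\<beta> (k + i) = exp (log_frac (real s + real i) (r + real i) (real k + 1))"
  using p r by (subst exp_log_frac) (auto simp: \<beta>_def add_ac)

end

locale commuting_weights_solution = commuting_weights +
  fixes a b :: "nat \<Rightarrow> complex"
  assumes eq1: "\<And>k. of_real (\<alpha> k) * a (k + p) = of_real (\<alpha> (k + m)) * a k"
    and eq2: "\<And>k. of_real (\<alpha> k) * b (k + p) + of_real (\<beta> k) * a (k + s)
      = a k * of_real (\<beta> (k + m)) + b k * of_real (\<alpha> (k + l))"
    and eq3: "\<And>k. of_real (\<beta> k) * b (k + s) = of_real (\<beta> (k + l)) * b k"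
begin

text \<open>The multiplier \<open>\<alpha> (k + m) / \<alpha> k\<close> is the exponential of a
  \<open>log_frac\<close> shifted by \<open>m\<close> minus the unshifted one, the kind of
  right-hand side that \<open>gamma_coeff_solves\<close> treats.\<close>

lemma obtain_C:
  obtains C where "\<And>k. C (k + p) = C k" "\<And>k. C k = 0 \<longleftrightarrow> a k = 0"
    "(\<lambda>k. a k - C k * of_real (exp (A (real k + 1)))) \<in> O(\<lambda>k. 1 / of_nat (k + 1) ^ 6)"
proof -
  have "a (k + p) = of_real (exp (log_frac (real p + real m) (q + real m) (real k + 1) - log_frac p q (real k + 1))) * a k" for k
    using eq1[of k] alpha_log[of k 0] alpha_log[of k m] pos(5)[of k]
    by (simp add: exp_diff field_simps)
  note rec = shift_recurrence_expansion[where R = "\<lambda>x. log_frac (real p + real m) (q + real m) x - log_frac p q x"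
      and a = a and p = p and A = "gamma_coeff p m p q", OF _ this gamma_coeff_solves]
  show thesis
    by (rule rec) (use that p m q in \<open>auto simp: A_def\<close>)
qed

lemma obtain_D:
  obtains D where "\<And>k. D (k + s) = D k" 
    "(\<lambda>k. b k - D k * of_real (exp (B (real k + 1)))) \<in> O(\<lambda>k. 1 / of_nat (k + 1) ^ 6)"
proof -
  have "b (k + s) = of_real (exp (log_frac (real s + real l) (r + real l) (real k + 1) - log_frac s r (real k + 1))) * b k" for k
    using eq3[of k] beta_log[of k 0] beta_log[of k l] pos(6)[of k]
    by (simp add: exp_diff field_simps)
  note rec = shift_recurrence_expansion[where R = "\<lambda>x. log_frac (real s + real l) (r + real l) x - log_frac s r x"
      and a = b and p = s and A = "gamma_coeff s l s r", OF _ this gamma_coeff_solves]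
  show thesis
    by (rule rec) (use that p m r in \<open>auto simp: B_def\<close>)
qed

lemma alpha_tendsto: "(\<lambda>k. \<alpha> (k + i)) \<longlonglongrightarrow> 1" and beta_tendsto: "(\<lambda>k. \<beta> (k + i)) \<longlonglongrightarrow> 1"
  unfolding \<alpha>_def \<beta>_def using q r by real_asymp+

end

locale commuting_weights_asymptotics = commuting_weights_solution +
  fixes C D :: "nat \<Rightarrow> complex"
  assumes C_per: "\<And>k. C (k + p) = C k" and C_zero: "\<And>k. C k = 0 \<longleftrightarrow> a k = 0"
    and C_asymp: "(\<lambda>k. a k - C k * of_real (exp (A (real k + 1)))) \<in> O(\<lambda>k. 1 / of_nat (k + 1) ^ 6)"
    and D_per: "\<And>k. D (k + s) = D k"
    and D_asymp: "(\<lambda>k. b k - D k * of_real (exp (B (real k + 1)))) \<in> O(\<lambda>k. 1 / of_nat (k + 1) ^ 6)"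
begin

lemma diff_tendsto_0:
  fixes z Z :: "nat \<Rightarrow> complex"
  assumes "P > 0" "\<And>k. Z (k + P) = Z k" "(\<lambda>k. z k - Z k * of_real (exp (inverse_poly c (real k + 1)))) \<in> O(\<lambda>k. 1 / of_nat (k + 1) ^ 6)"
  shows "(\<lambda>k. z k - Z k) \<longlonglongrightarrow> 0"
proof -
  have "(\<lambda>k. 1 / of_nat (k + 1) ^ 6 :: complex) \<longlonglongrightarrow> 0"
  proof -
    have "(\<lambda>k. 1 / (real k + 1) ^ 6) \<longlonglongrightarrow> 0" by real_asymp
    then have "(\<lambda>k. complex_of_real (1 / (real k + 1) ^ 6)) \<longlonglongrightarrow> of_real 0"
      by (rule tendsto_of_real)
    then show ?thesis by (simp add: add_ac)
  qed
  from bigo_tendsto_0[OF assms(3) this]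
  have 1: "(\<lambda>k. z k - Z k * of_real (exp (inverse_poly c (real k + 1)))) \<longlonglongrightarrow> 0" .
  have "(\<lambda>k. 1 * (of_real (exp (inverse_poly c (real k + 1))) - 1) :: complex) \<longlonglongrightarrow> 1 * (of_real 1 - 1)"
    using exp_inverse_poly_tendsto[of 0 c]
    by (intro tendsto_mult tendsto_diff tendsto_of_real tendsto_const) simp
  then have lim: "(\<lambda>k. 1 * (of_real (exp (inverse_poly c (real k + 1))) - 1) :: complex) \<longlonglongrightarrow> 0"
    by (simp only: of_real_1 diff_self mult_zero_right)
  have "(\<lambda>k. Z k * (of_real (exp (inverse_poly c (real k + 1))) - 1)) \<in> O(\<lambda>k. 1 * (of_real (exp (inverse_poly c (real k + 1))) - 1))"
    by (intro landau_o.big.mult periodic_bigo_1[OF assms(1), of Z, OF assms(2)]) simp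
  from tendsto_add[OF 1 bigo_tendsto_0[OF this lim]] show ?thesis
    by (simp add: algebra_simps)
qed

lemma weighted_diff_tendsto_0:
  fixes z Z :: "nat \<Rightarrow> complex" and u :: "nat \<Rightarrow> real"
  assumes "P > 0" "\<And>k. Z (k + P) = Z k" "(\<lambda>k. z k - Z k) \<longlonglongrightarrow> 0" "u \<longlonglongrightarrow> 1"
  shows "(\<lambda>k. of_real (u k) * z (k + i) - Z (k + i)) \<longlonglongrightarrow> 0"
proof -
  have "(\<lambda>k. of_real (u k) * (z (k + i) - Z (k + i))) \<longlonglongrightarrow> of_real 1 * 0"
    using assms(3,4) by (intro tendsto_mult tendsto_of_real LIMSEQ_ignore_initial_segment[where f = "\<lambda>k. z k - Z k"])
  moreover have "(\<lambda>k. (of_real (u k) - 1) * Z (k + i)) \<longlonglongrightarrow> 0"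
  proof (rule bigo_tendsto_0)
    have "(\<lambda>k. Z (k + i)) \<in> O(\<lambda>_. 1)"
      using assms(2)[of "_ + i"] by (intro periodic_bigo_1[OF assms(1)]) (simp add: add_ac)
    then show "(\<lambda>k. (of_real (u k) - 1) * Z (k + i)) \<in> O(\<lambda>k. (of_real (u k) - 1) * 1)"
      by (intro landau_o.big.mult) auto
    have "(\<lambda>k. (of_real (u k) - 1) * 1 :: complex) \<longlonglongrightarrow> (of_real 1 - 1) * 1"
      using assms(4) by (intro tendsto_intros)
    then show "(\<lambda>k. (of_real (u k) - 1) * 1 :: complex) \<longlonglongrightarrow> 0" by simp
  qed
  ultimately have "(\<lambda>k. of_real (u k) * (z (k + i) - Z (k + i)) + (of_real (u k) - 1) * Z (k + i)) \<longlonglongrightarrow> of_real 1 * 0 + 0"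
    by (rule tendsto_add)
  then show ?thesis by (simp add: algebra_simps)
qed

lemma a_tendsto: "(\<lambda>k. a k - C k) \<longlonglongrightarrow> 0"
  using diff_tendsto_0[of p C a] p C_per C_asymp by (simp add: A_def)

lemma b_tendsto: "(\<lambda>k. b k - D k) \<longlonglongrightarrow> 0"
  using diff_tendsto_0[of s D b] p D_per D_asymp by (simp add: B_def)

text \<open>The difference of both sides tends to zero and has period \<open>p s\<close>.\<close>

lemma limits_exchange: "D (k + p) - D k = C k - C (k + s)"
proof -
  define h where "h k = D (k + p) - D k - (C k - C (k + s))" for k
  have pos: "p > 0" "s > 0" using p by auto
  note a = weighted_diff_tendsto_0[OF pos(1) C_per a_tendsto]
  note b = weighted_diff_tendsto_0[OF pos(2) D_per b_tendsto]
  have "(\<lambda>k. ((\<alpha> k * b (k + p) - D (k + p)) - (\<alpha> (k + l) * b (k + 0) - D (k + 0)))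
    - ((\<beta> (k + m) * a (k + 0) - C (k + 0)) - (\<beta> k * a (k + s) - C (k + s)))) \<longlonglongrightarrow> (0 - 0) - (0 - 0)"
    using alpha_tendsto[of 0] beta_tendsto[of 0] 
    by (intro tendsto_diff a b alpha_tendsto beta_tendsto) simp_all
  moreover have "((\<alpha> k * b (k + p) - D (k + p)) - (\<alpha> (k + l) * b (k + 0) - D (k + 0)))
    - ((\<beta> (k + m) * a (k + 0) - C (k + 0)) - (\<beta> k * a (k + s) - C (k + s))) = - h k" for k
    using eq2[of k] unfolding h_def by (simp add: algebra_simps)
  ultimately have "(\<lambda>k. - h k) \<longlonglongrightarrow> 0"
    by simp
  then have "h \<longlonglongrightarrow> 0"
    by (simp add: tendsto_minus_cancel_left[symmetric])
  moreover have "h (k + p * s) = h k" for k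
  proof -
    have C: "C (j + p * s) = C j" and D: "D (j + p * s) = D j" for j
      using periodic_mult[of C p j s, OF C_per] periodic_mult[of D s j p, OF D_per]
      by (simp_all add: mult.commute)
    show ?thesis
      unfolding h_def using C[of k] C[of "k + s"] D[of k] D[of "k + p"]
      by (simp only: add.assoc add.commute[of "p * s"])
  qed
  ultimately have "h k = 0"
    using pos by (intro periodic_tendsto_0[of "p * s" h]) auto
  then show ?thesis by (simp add: h_def)
qed

text \<open>The right-hand side of \<open>limits_exchange\<close> has period \<open>p\<close>, so
  \<open>D\<close> changes by a constant amount with each step of length \<open>p\<close>. But
  \<open>s\<close> such steps bring \<open>D\<close> back to its value, so the amount is
  zero.\<close>

lemma D_per': "D (k + p) = D k" and C_per': "C (k + s) = C k"
proof -
  define h where "h = D (k + p) - D k"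
  have "D (k + i * p) = D k + of_nat i * h" for i
  proof (induction i)
    case (Suc i)
    have "D (k + i * p + p) - D (k + i * p) = C (k + i * p) - C (k + s + i * p)"
      using limits_exchange[of "k + i * p"] by (simp add: add_ac)
    also have "\<dots> = h"
      using periodic_mult[of C p _ i, OF C_per] limits_exchange[of k] by (simp add: h_def)
    finally show ?case using Suc by (simp add: algebra_simps)
  qed simp
  from this[of s] have "D k = D k + of_nat s * h"
    using periodic_mult[of D s k p, OF D_per] by (simp add: mult.commute)
  then have "h = 0" using p by simp
  then show "D (k + p) = D k" "C (k + s) = C k"
    using limits_exchange[of k] by (simp_all add: h_def)
qed

end

lemma sequence_bigo_of_real:
  assumes "f \<in> O(\<lambda>x. 1 / x ^ n)"
  shows "(\<lambda>k. of_real (f (real k + 1)) :: complex) \<in> O(\<lambda>k. 1 / of_nat (k + 1) ^ n)"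
proof -
  have "filterlim (\<lambda>k::nat. real k + 1) at_top sequentially"
    by real_asymp
  with assms have "(\<lambda>k::nat. f (real k + 1)) \<in> O(\<lambda>k. 1 / (real k + 1) ^ n)"
    by (rule landau_o.big.compose)
  then show ?thesis
    using landau_o.big.of_real_iff[where 'b = complex, of "\<lambda>k. f (real k + 1)" sequentially "\<lambda>k. 1 / (real k + 1) ^ n"]
    by (simp add: add_ac)
qed

section \<open>Matching coefficients in the mixed relation\<close>

context commuting_weights_asymptotics
begin

abbreviation "g \<equiv> exchange_log p s q r l"
text \<open>In the mixed relation \<open>b\<close> occurs as shifted minus unshifted and
  \<open>a\<close> as unshifted minus shifted; hence the logarithm of the inverse quotient.\<close>

abbreviation "h \<equiv> \<lambda>x. - 1 * exchange_log s p r q m x"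
abbreviation "w \<equiv> prefactor_log p s q r m l"

lemma exp_g: "\<alpha> k * exp (B (real k + 1 + real p)) = \<alpha> (k + l) * exp (B (real k + 1)) * exp (g (real k + 1))"
  using alpha_log[of k 0] alpha_log[of k l]
  by (simp add: exchange_log_def B_def exp_add exp_diff)

lemma exp_h: "\<beta> (k + m) * exp (A (real k + 1)) = \<beta> k * exp (A (real k + 1 + real s)) * exp (h (real k + 1))"
  using beta_log[of k 0] beta_log[of k m]
  by (simp add: exchange_log_def A_def exp_add exp_diff exp_minus)

lemma exp_w: "\<alpha> (k + l) * exp (B (real k + 1)) = \<beta> k * exp (A (real k + 1 + real s)) * exp (w (real k + 1))"
  using beta_log[of k 0] alpha_log[of k l]
  by (simp add: prefactor_log_def A_def B_def exp_add exp_diff)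

text \<open>The mixed relation says \<open>\<alpha> k * b (k + p) - \<alpha> (k + l) * b k = \<beta>
  (k + m) * a k - \<beta> k * a (k + s)\<close>. As \<open>D\<close> is invariant under
  \<open>p\<close> and \<open>C\<close> under \<open>s\<close>, each side becomes a periodic factor
  times a difference of exponentials, up to a remainder. Dividing by
  \<open>\<beta> k * exp (A (real k + 1 + real s))\<close> gathers all other factors in
  \<open>exp w\<close>.\<close>

lemma weight_relation_bigo:
  "(\<lambda>k. D k * of_real (exp (w (real k + 1)) * (exp (g (real k + 1)) - 1)) - C k * of_real (exp (h (real k + 1)) - 1))
    \<in> O(\<lambda>k. 1 / of_nat (k + 1) ^ 6)"
proof -
  define ea where "ea k = a k - C k * of_real (exp (A (real k + 1)))" for k
  define eb where "eb k = b k - D k * of_real (exp (B (real k + 1)))" for k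
  have shift: "(\<lambda>k. f (k + i)) \<in> O(\<lambda>k. 1 / of_nat (k + 1) ^ 6)"
    if "f \<in> O(\<lambda>k. 1 / of_nat (k + 1) ^ 6)" for f :: "nat \<Rightarrow> complex" and i
  proof -
    have "filterlim (\<lambda>k. k + i) sequentially sequentially"
      by (rule filterlim_add_const_nat_at_top)
    with that have "(\<lambda>k. f (k + i)) \<in> O(\<lambda>k. 1 / of_nat (k + i + 1) ^ 6)"
      by (rule landau_o.big.compose)
    also have "(\<lambda>k. 1 / of_nat (k + i + 1) ^ 6 :: complex) \<in> O(\<lambda>k. 1 / of_nat (k + 1) ^ 6)"
    proof (intro bigoI[of _ 1] always_eventually allI)
      fix k
      have "1 / real (k + i + 1) ^ 6 \<le> 1 / real (k + 1) ^ 6"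
        by (intro divide_left_mono power_mono mult_pos_pos zero_less_power) auto
      then show "norm (1 / of_nat (k + i + 1) ^ 6 :: complex) \<le> 1 * norm (1 / of_nat (k + 1) ^ 6 :: complex)"
        by (simp only: norm_divide norm_power norm_of_nat norm_one mult_1)
    qed
    finally show ?thesis .
  qed
  have mult_1: "(\<lambda>k. of_real (u k) * f k) \<in> O(\<lambda>k. 1 / of_nat (k + 1) ^ 6)"
    if "u \<longlonglongrightarrow> c" "f \<in> O(\<lambda>k. 1 / of_nat (k + 1) ^ 6)" for u c and f :: "nat \<Rightarrow> complex"
    using landau_o.big.mult[OF tendsto_imp_bigo_1[OF that(1)] that(2)] by (simp only: mult_1)
  have alpha0: "\<alpha> \<longlonglongrightarrow> 1" and beta0: "\<beta> \<longlonglongrightarrow> 1"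
    using alpha_tendsto[of 0] beta_tendsto[of 0] by simp_all
  have ea: "ea \<in> O(\<lambda>k. 1 / of_nat (k + 1) ^ 6)" and eb: "eb \<in> O(\<lambda>k. 1 / of_nat (k + 1) ^ 6)"
    using C_asymp D_asymp by (simp_all only: ea_def[abs_def] eb_def[abs_def])
  define T where "T k = (of_real (\<beta> (k + m)) * ea k - of_real (\<beta> k) * ea (k + s))
    - (of_real (\<alpha> k) * eb (k + p) - of_real (\<alpha> (k + l)) * eb k)" for k
  have T: "T \<in> O(\<lambda>k. 1 / of_nat (k + 1) ^ 6)"
    unfolding T_def
    by (intro sum_in_bigo(2) mult_1[OF alpha_tendsto] mult_1[OF beta_tendsto] mult_1[OF alpha0] mult_1[OF beta0]
        shift[OF ea] shift[OF eb] ea eb)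
  define v where "v k = 1 / (\<beta> k * exp (A (real k + 1 + real s)))" for k
  have "v \<longlonglongrightarrow> 1 / (1 * 1)"
    unfolding v_def A_def by (intro tendsto_divide tendsto_mult tendsto_const beta0 exp_inverse_poly_tendsto) auto
  from mult_1[OF this T] have "(\<lambda>k. of_real (v k) * T k) \<in> O(\<lambda>k. 1 / of_nat (k + 1) ^ 6)" .
  moreover have "of_real (v k) * T k = D k * of_real (exp (w (real k + 1)) * (exp (g (real k + 1)) - 1)) - C k * of_real (exp (h (real k + 1)) - 1)" for k
  proof -
    define y where "y = \<beta> k * exp (A (real k + 1 + real s))"
    have y: "y > 0" using pos(6)[of k] by (simp add: y_def)
    have 1: "\<alpha> k * exp (B (real k + 1 + real p)) - \<alpha> (k + l) * exp (B (real k + 1)) = y * (exp (w (real k + 1)) * (exp (g (real k + 1)) - 1))"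
      unfolding exp_g exp_w y_def by (simp only: right_diff_distrib mult.assoc mult_1_right)
    have 2: "\<beta> (k + m) * exp (A (real k + 1)) - \<beta> k * exp (A (real k + 1 + real s)) = y * (exp (h (real k + 1)) - 1)"
      unfolding exp_h y_def by (simp only: right_diff_distrib mult.assoc mult_1_right)
    have "T k = D k * (of_real (\<alpha> k) * of_real (exp (B (real k + 1 + real p))) - of_real (\<alpha> (k + l)) * of_real (exp (B (real k + 1))))
      - C k * (of_real (\<beta> (k + m)) * of_real (exp (A (real k + 1))) - of_real (\<beta> k) * of_real (exp (A (real k + 1 + real s))))"
      using eq2[of k] unfolding T_def ea_def eb_def D_per' C_per'
      by (simp add: algebra_simps)
    also have "\<dots> = of_real y * (D k * of_real (exp (w (real k + 1)) * (exp (g (real k + 1)) - 1)) - C k * of_real (exp (h (real k + 1)) - 1))"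
      using arg_cong[OF 1, of complex_of_real] arg_cong[OF 2, of complex_of_real]
      by (simp only: of_real_diff of_real_mult) (simp only: right_diff_distrib mult.assoc mult.left_commute[of "D k"] mult.left_commute[of "C k"])
    finally show ?thesis
      using y by (simp add: v_def y_def[symmetric])
  qed
  ultimately show ?thesis by simp
qed

text \<open>Two orders are extracted: the leading one, and order \<open>2 * n - 1\<close>, where the
  prefactor first enters and which is the last one below the remainder.\<close>

lemma coefficient_matching:
  assumes n: "n = 2 \<or> n = 3"
    and g0: "\<And>i. 1 \<le> i \<Longrightarrow> i < n \<Longrightarrow> exchange_coeff p s q r l i = 0"
    and h0: "\<And>i. 1 \<le> i \<Longrightarrow> i < n \<Longrightarrow> exchange_coeff s p r q m i = 0"
    and w0: "\<And>i. 1 \<le> i \<Longrightarrow> i < n - 1 \<Longrightarrow> prefactor_coeff p s q r m l i = 0"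
  shows "D k * of_real (exchange_coeff p s q r l n) = C k * of_real (- exchange_coeff s p r q m n)"
    and "D k * of_real (exchange_coeff p s q r l (2 * n - 1) + prefactor_coeff p s q r m l (n - 1) * exchange_coeff p s q r l n)
      = C k * of_real (- exchange_coeff s p r q m (2 * n - 1))"
proof -
  define G where "G = exchange_coeff p s q r l"
  define H where "H i = - 1 * exchange_coeff s p r q m i" for i
  define W where "W = prefactor_coeff p s q r m l"
  have g: "expansion g G" and w: "expansion w W"
    using pos q r unfolding G_def W_def
    by (auto intro!: expansion_exchange_log expansion_prefactor_log)
  have "expansion h (\<lambda>i. - 1 * exchange_coeff s p r q m i)"
    by (rule expansion_cmult, rule expansion_exchange_log) (use pos q r in auto)
  then have h: "expansion h H"
    by (simp only: H_def[abs_def])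
  have zero: "expansion (\<lambda>x. 0) (\<lambda>i. 0)" by (rule expansion_zero)
  define SG where "SG x = ((\<Sum>i=n..<2*n. G i / x ^ i) + W (n - 1) * G n / x ^ (2 * n - 1))" for x
  \<comment> \<open>The summand with factor \<open>0\<close> gives this the shape of
    \<open>exp_product_expansion\<close> with the zero function in place of
    \<open>w\<close>.\<close>
  define SH where "SH x = ((\<Sum>i=n..<2*n. H i / x ^ i) + 0 * H n / x ^ (2 * n - 1))" for x
  have bigo_g: "(\<lambda>x. exp (w x) * (exp (g x) - 1) - SG x) \<in> O(\<lambda>x. 1 / x ^ (2 * n))"
    using exp_product_expansion[OF g w n] g0 w0 by (simp only: G_def W_def SG_def)
  have bigo_h: "(\<lambda>x. (exp (h x) - 1) - SH x) \<in> O(\<lambda>x. 1 / x ^ (2 * n))"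
    using exp_product_expansion[OF h zero n] h0 by (simp only: H_def SH_def mult_zero_right exp_zero mult_1)
  \<comment> \<open>The coefficient of order \<open>n + j\<close>. Multiplying the relation by
    \<open>(k + 1) ^ n\<close> makes it the coefficient of order \<open>j\<close>.\<close>
  define P where "P j k = D k * of_real (G (n + j) + (if j = n - 1 then W (n - 1) * G n else 0)) - C k * of_real (H (n + j))" for j k
  have per: "P j (k + p * s) = P j k" for j k
    unfolding P_def using periodic_mult[of C p k s, OF C_per] periodic_mult[of D s k p, OF D_per]
    by (simp add: mult.commute)
  have "(\<lambda>k. 1 / of_nat (k + 1) ^ 6 :: complex) \<in> O(\<lambda>k. 1 / of_nat (k + 1) ^ (2 * n))"
    using n by (intro bigo_inverse_power_nat) auto
  note main = landau_o.big_trans[OF weight_relation_bigo this]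
  let ?x = "\<lambda>k. of_nat (k + 1) :: complex"
  have pp: "p > 0" "s > 0" "p * s > 0" using p by auto
  note CD = periodic_bigo_1[OF pp(1), of C, OF C_per] periodic_bigo_1[OF pp(2), of D, OF D_per]
  have "(\<lambda>k. D k * of_real (exp (w (real k + 1)) * (exp (g (real k + 1)) - 1) - SG (real k + 1))
      - C k * of_real ((exp (h (real k + 1)) - 1) - SH (real k + 1))) \<in> O(\<lambda>k. 1 / ?x k ^ (2 * n))"
    using sum_in_bigo(2)[OF landau_o.big.mult[OF CD(2) sequence_bigo_of_real[OF bigo_g]]
      landau_o.big.mult[OF CD(1) sequence_bigo_of_real[OF bigo_h]]]
    by (simp only: mult_1)
  from sum_in_bigo(2)[OF main this]
  have "(\<lambda>k. D k * of_real (SG (real k + 1)) - C k * of_real (SH (real k + 1))) \<in> O(\<lambda>k. 1 / ?x k ^ (2 * n))"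
    by (simp only: of_real_diff right_diff_distrib) (simp add: algebra_simps)
  from landau_o.big.mult[OF landau_o.big_refl[of "\<lambda>k. ?x k ^ n"] this]
  have "(\<lambda>k. ?x k ^ n * (D k * of_real (SG (real k + 1)) - C k * of_real (SH (real k + 1)))) \<in> O(\<lambda>k. ?x k ^ n * (1 / ?x k ^ (2 * n)))" .
  moreover have "?x k ^ n * (1 / ?x k ^ (2 * n)) = 1 / ?x k ^ n" for k
    by (simp add: mult_2 power_add del: of_nat_Suc)
  moreover have "?x k ^ n * (D k * of_real (SG (real k + 1)) - C k * of_real (SH (real k + 1)))
    = (\<Sum>j<n. P j k / ?x k ^ j)" for k
  proof -
    define y where "y = real k + 1"
    have y: "y \<noteq> 0" "?x k = of_real y" by (auto simp: y_def add_ac)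
    have "y ^ n * SG y = (\<Sum>j<n. (G (n + j) + (if j = n - 1 then W (n - 1) * G n else 0)) / y ^ j)"
      using n y(1) by (elim disjE) (simp_all add: SG_def numeral_eq_Suc field_simps)
    moreover have "y ^ n * SH y = (\<Sum>j<n. H (n + j) / y ^ j)"
      using n y(1) by (elim disjE) (simp_all add: SH_def numeral_eq_Suc field_simps)
    moreover have "?x k ^ n * (D k * of_real (SG y) - C k * of_real (SH y)) = D k * of_real (y ^ n * SG y) - C k * of_real (y ^ n * SH y)"
      unfolding y(2) by (simp add: algebra_simps)
    ultimately show ?thesis
      unfolding y_def[symmetric] y(2) P_def
      by (simp add: sum_subtractf diff_divide_distrib sum_distrib_left)
  qed
  ultimately have "(\<lambda>k. \<Sum>j<n. P j k / ?x k ^ j) \<in> O(\<lambda>k. 1 / ?x k ^ n)"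
    by (simp only:)
  from periodic_expansion_zero[where P = P, OF pp(3) per this]
  have "P 0 k = 0" "P (n - 1) k = 0" using n by auto
  then show "D k * of_real (exchange_coeff p s q r l n) = C k * of_real (- exchange_coeff s p r q m n)"
    "D k * of_real (exchange_coeff p s q r l (2 * n - 1) + prefactor_coeff p s q r m l (n - 1) * exchange_coeff p s q r l n)
      = C k * of_real (- exchange_coeff s p r q m (2 * n - 1))"
    using n by (auto simp: P_def G_def H_def W_def numeral_eq_Suc eq_neg_iff_add_eq_0)
qed

lemma real_lp: "real l = real m + real s - real p"
  using lp by (metis add_diff_cancel_right' of_nat_add)

lemma leading_relation:
  assumes "\<not> (q = p \<and> r = s)"
  shows "D k * of_real (l / s) = C k * of_real (m / p)" and "C k \<noteq> 0 \<Longrightarrow> m = p"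
proof -
  note pos' = pos(1-4) and l = real_lp
  have "D k * of_real (l / s) = C k * of_real (m / p) \<and> (C k \<noteq> 0 \<longrightarrow> m = p)"
  proof (cases "s * q = p * r")
    case False
    define \<kappa> where "\<kappa> = real s * q - real p * r"
    have \<kappa>: "\<kappa> \<noteq> 0" using False by (simp add: \<kappa>_def)
    define G where "G = exchange_coeff p s q r l"
    define H where "H i = - exchange_coeff s p r q m i" for i
    have G2: "G 2 = - (l / s) * \<kappa>"
      unfolding G_def \<kappa>_def by (rule exchange_coeff_2[OF pos'(2)])
    have H2: "H 2 = - (m / p) * \<kappa>"
      unfolding H_def \<kappa>_def by (subst exchange_coeff_2[OF pos'(1)]) (simp add: algebra_simps)
    have one: "i = 1" if "1 \<le> i" "i < 2" for i :: nat using that by simp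
    have 2: "D k * of_real (G 2) = C k * of_real (H 2)"
      and 3: "D k * of_real (G 3 + prefactor_coeff p s q r m l 1 * G 2) = C k * of_real (H 3)"
    proof -
      have "exchange_coeff p s q r l i = 0" "exchange_coeff s p r q m i = 0" if "1 \<le> i" "i < 2" for i :: nat
        using one[OF that] exchange_coeff_1[OF pos'(2)] exchange_coeff_1[OF pos'(1)] by simp_all
      moreover have "prefactor_coeff p s q r m l i = 0" if "1 \<le> i" "i < 2 - 1" for i :: nat
        using that by simp
      ultimately show "D k * of_real (G 2) = C k * of_real (H 2)"
        "D k * of_real (G 3 + prefactor_coeff p s q r m l 1 * G 2) = C k * of_real (H 3)"
        using coefficient_matching[where n = 2 and k = k] by (simp_all add: G_def H_def)
    qed
    have first: "D k * of_real (l / s) = C k * of_real (m / p)"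
    proof -
      have "D k * of_real (l / s) * of_real (- \<kappa>) = C k * of_real (m / p) * of_real (- \<kappa>)"
        using 2 unfolding G2 H2 by (simp only: mult_minus_left mult_minus_right of_real_minus of_real_mult mult.assoc)
      moreover have "complex_of_real (- \<kappa>) \<noteq> 0" using \<kappa> by simp
      ultimately show ?thesis by (metis mult_right_cancel)
    qed
    moreover have "m = p" if "C k \<noteq> 0"
    proof -
      have "D k \<noteq> 0" using first that pos' by auto
      \<comment> \<open>Eliminates \<open>C\<close>: the equation of order three is multiplied by
        \<open>H 2\<close>, that of order two by \<open>H 3\<close>.\<close>
      have "D k * of_real ((G 3 + prefactor_coeff p s q r m l 1 * G 2) * H 2) = D k * of_real (H 3 * G 2)"
        using arg_cong[OF 3, of "\<lambda>z. z * of_real (H 2)"] arg_cong[OF 2, of "\<lambda>z. z * of_real (H 3)"]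
        by (simp only: of_real_mult mult_ac)
      then have "(G 3 + prefactor_coeff p s q r m l 1 * G 2) * H 2 = H 3 * G 2"
        using \<open>D k \<noteq> 0\<close> by (simp only: mult_cancel_left of_real_eq_iff) simp
      moreover have "G 3 * H 2 = H 3 * G 2"
      proof -
        have "G 3 * (m / p) = H 3 * (l / s)"
          unfolding G_def H_def by (rule exchange_coeff_3_proportional[OF pos'(2,1) l])
        then have "- \<kappa> * (G 3 * (m / p)) = - \<kappa> * (H 3 * (l / s))" by simp
        then show ?thesis by (simp add: G2 H2 mult_ac)
      qed
      ultimately have "prefactor_coeff p s q r m l 1 * (G 2 * H 2) = 0"
        by (simp add: algebra_simps)
      moreover have "G 2 * H 2 \<noteq> 0" using \<kappa> pos' by (simp add: G2 H2)
      ultimately have "prefactor_coeff p s q r m l 1 = 0" by simp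
      then have "(real p - real m) * (r / s - q / p) = 0"
        unfolding prefactor_coeff_1[OF pos'(2,1) l] .
      moreover have "r / s - q / p \<noteq> 0"
        using False pos' by (auto simp: field_simps)
      ultimately show ?thesis by simp
    qed
    ultimately show ?thesis by blast
  next
    case True
    define t where "t = q / p"
    have t: "q = p * t" "r = s * t" "t > 0"
      using pos' q True by (auto simp: t_def field_simps)
    \<comment> \<open>The value \<open>t = 1\<close> would mean \<open>q = p\<close> and
      \<open>r = s\<close>, the case of analytic symbols.\<close>
    have "t \<noteq> 1" using assms t by auto
    define \<kappa> where "\<kappa> = t * (real s - real p) * (t - 1)"
    have \<kappa>: "\<kappa> \<noteq> 0" using t \<open>t \<noteq> 1\<close> p by (simp add: \<kappa>_def)
    define G where "G = exchange_coeff p s (p * t) (s * t) l"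
    define H where "H i = - exchange_coeff s p (s * t) (p * t) m i" for i
    define W where "W = prefactor_coeff p s (p * t) (s * t) m l"
    have G3: "G 3 = - (real l * real p) * \<kappa>"
      unfolding G_def \<kappa>_def by (subst exchange_coeff_3_degenerate[OF pos'(2)]) (simp add: algebra_simps)
    have H3: "H 3 = - (real m * real s) * \<kappa>"
      unfolding H_def \<kappa>_def by (subst exchange_coeff_3_degenerate[OF pos'(1)]) (simp add: algebra_simps)
    \<comment> \<open>The part of the bracket in \<open>exchange_coeff_5_degenerate\<close> that is
      symmetric in \<open>p\<close> and \<open>s\<close>.\<close>
    define e where "e = ((real p + s) * (1 + t)) ^ 2 - (p * s * t + (p + s * t) * (s + p * t))"
    have G5: "G 5 = G 3 * (e + 2 * (real l - s) * ((real p + s) * (1 + t)) + (2 * real l - s) * (real l - s))"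
      unfolding G_def exchange_coeff_3_degenerate[OF pos'(2)] exchange_coeff_5_degenerate[OF pos'(2)] e_def by simp
    have H5: "H 5 = H 3 * (e + 2 * (real m - p) * ((real p + s) * (1 + t)) + (2 * real m - p) * (real m - p))"
      unfolding H_def exchange_coeff_3_degenerate[OF pos'(1)] exchange_coeff_5_degenerate[OF pos'(1)] e_def
      by (simp add: add_ac mult_ac)
    have W2: "W 2 = (real m - p) * (real s - p) * (1 + (t ^ 2 - t) / 2)
      - ((2 * real l - s) * (real l - s) - (2 * real m - p) * (real m - p))"
      unfolding W_def by (rule prefactor_coeff_2_degenerate[OF pos'(2,1) l])
    have W1: "W 1 = 0"
      unfolding W_def prefactor_coeff_1[OF pos'(2,1) l] using pos' by simp
    have cases: "i = 1 \<or> i = 2" if "1 \<le> i" "i < 3" for i :: nat using that by auto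
    have 3: "D k * of_real (G 3) = C k * of_real (H 3)"
      and 5: "D k * of_real (G 5 + W 2 * G 3) = C k * of_real (H 5)"
    proof -
      have "exchange_coeff p s q r l i = 0" "exchange_coeff s p r q m i = 0" if "1 \<le> i" "i < 3" for i :: nat
        using cases[OF that] exchange_coeff_1[OF pos'(2)] exchange_coeff_1[OF pos'(1)]
          exchange_coeff_2_degenerate[OF pos'(2,1)] exchange_coeff_2_degenerate[OF pos'(1,2)]
        by (auto simp: t)
      moreover have "prefactor_coeff p s q r m l i = 0" if "1 \<le> i" "i < 3 - 1" for i :: nat
      proof -
        have "i = 1" using that by simp
        then show ?thesis using W1 by (simp add: W_def t)
      qed
      ultimately show "D k * of_real (G 3) = C k * of_real (H 3)"
        "D k * of_real (G 5 + W 2 * G 3) = C k * of_real (H 5)"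
        using coefficient_matching[where n = 3 and k = k] by (simp_all add: G_def H_def W_def t)
    qed
    have first: "D k * of_real (l / s) = C k * of_real (m / p)"
    proof -
      have "D k * of_real (real l * real p) * of_real (- \<kappa>) = C k * of_real (real m * real s) * of_real (- \<kappa>)"
        using 3 unfolding G3 H3 by (simp only: mult_minus_left mult_minus_right of_real_minus of_real_mult mult.assoc)
      moreover have "complex_of_real (- \<kappa>) \<noteq> 0" using \<kappa> by simp
      ultimately have "D k * of_real (real l * real p) = C k * of_real (real m * real s)" by (metis mult_right_cancel)
      then show ?thesis using pos' by (simp add: field_simps)
    qed
    moreover have "m = p" if "C k \<noteq> 0"
    proof -
      have "D k \<noteq> 0" using first that pos' by auto
      have "D k * of_real ((G 5 + W 2 * G 3) * H 3) = D k * of_real (H 5 * G 3)"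
        using arg_cong[OF 5, of "\<lambda>z. z * of_real (H 3)"] arg_cong[OF 3, of "\<lambda>z. z * of_real (H 5)"]
        by (simp only: of_real_mult mult_ac)
      then have "(G 5 + W 2 * G 3) * H 3 = H 5 * G 3"
        using \<open>D k \<noteq> 0\<close> by (simp only: mult_cancel_left of_real_eq_iff) simp
      moreover have "(G 5 + W 2 * G 3) * H 3 - H 5 * G 3
        = (real m - p) * ((real s - p) * (1 + (t ^ 2 - t) / 2) * (G 3 * H 3))"
      proof -
        have identity: "(g * (e + 2 * (y * z) + v) + (c * (w * u) - (v - v')) * g) * h - h * ((e + 2 * (y * z) + v') * g)
            = c * (w * (u * (g * h)))" for g e y z v v' c w u h :: real
          by (simp add: algebra_simps)
        have "real l - s = real m - p" by (simp add: l)
        then show ?thesis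
          unfolding G5 H5 W2 by (simp only: mult.assoc identity)
      qed
      moreover have "G 3 * H 3 \<noteq> 0" using \<kappa> pos' by (simp add: G3 H3)
      moreover have "1 + (t ^ 2 - t) / 2 > 0"
      proof -
        have "0 \<le> (t - 1 / 2) ^ 2" by simp
        then have "t ^ 2 - t \<ge> - (1 / 4)" by (simp add: power2_eq_square algebra_simps)
        moreover have "1 + x / 2 > 0" if "x \<ge> - (1 / 4)" for x :: real
          using that by simp
        ultimately show ?thesis by blast
      qed
      ultimately show ?thesis using p by simp
    qed
    ultimately show ?thesis by blast
  qed
  then show "D k * of_real (l / s) = C k * of_real (m / p)" "C k \<noteq> 0 \<Longrightarrow> m = p"
    by auto
qed

text \<open>When \<open>m = p\<close>, the first relation says that \<open>a k / \<alpha> k\<close>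
  has period \<open>p\<close>. It differs from the periodic \<open>C k\<close> by a null sequence,
  so the two agree exactly. The same holds for \<open>b k / \<beta> k\<close> and
  \<open>D k\<close>, and \<open>D = C\<close> because \<open>l / s\<close> and \<open>m / p\<close>
  are both one.\<close>

lemma explicit_solution:
  assumes "\<not> (q = p \<and> r = s)" "m = p"
  shows "a k = C k * of_real (\<alpha> k)" "b k = C k * of_real (\<beta> k)"
proof -
  have "l = s" using lp assms(2) by simp
  have "D k = C k"
    using leading_relation(1)[OF assms(1), of k] pos by (simp add: assms(2) \<open>l = s\<close>)
  have quotient: "z k = Z k * of_real (u k)"
    if "P > 0" "\<And>k. Z (k + P) = Z k" "\<And>k. of_real (u k) * z (k + P) = of_real (u (k + P)) * z k"
      "\<And>k. u k > 0" "u \<longlonglongrightarrow> 1" "(\<lambda>k. z k - Z k) \<longlonglongrightarrow> 0"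
    for z Z :: "nat \<Rightarrow> complex" and u :: "nat \<Rightarrow> real" and P
  proof -
    have u0: "u k \<noteq> 0" for k using that(4)[of k] by simp
    have "(\<lambda>k. 1 / u k) \<longlonglongrightarrow> 1 / 1"
      by (intro tendsto_divide tendsto_const that(5)) simp
    then have "(\<lambda>k. of_real (1 / u k) * z (k + 0) - Z (k + 0)) \<longlonglongrightarrow> 0"
      by (intro weighted_diff_tendsto_0[OF that(1,2,6)]) simp
    moreover have "of_real (1 / u (k + P)) * z (k + P) - Z (k + P) = of_real (1 / u k) * z k - Z k" for k
      using that(2)[of k] that(3)[of k] u0[of k] u0[of "k + P"] by (simp add: field_simps)
    ultimately have "of_real (1 / u k) * z k - Z k = 0"
      using periodic_tendsto_0[OF that(1), of "\<lambda>k. of_real (1 / u k) * z k - Z k" k] by simp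
    then show ?thesis using u0[of k] by (simp add: field_simps)
  qed
  show "a k = C k * of_real (\<alpha> k)"
    using eq1 alpha_tendsto[of 0] p pos(5) by (intro quotient[where P = p] C_per a_tendsto) (auto simp: assms(2))
  show "b k = C k * of_real (\<beta> k)"
    unfolding \<open>D k = C k\<close>[symmetric]
    using eq3 beta_tendsto[of 0] p pos(6) by (intro quotient[where P = s] D_per b_tendsto) (auto simp: \<open>l = s\<close>)
qed

end

theorem (in commuting_weights_solution) weights_determined:
  assumes "\<not> (q = p \<and> r = s)" and "a k \<noteq> 0"
  obtains C where "m = p" "l = s" "\<And>k. C (k + p) = C k"
    "\<And>k. a k = C k * of_real (\<alpha> k)" "\<And>k. b k = C k * of_real (\<beta> k)"
proof -
  obtain C where C: "\<And>k. C (k + p) = C k" "\<And>k. C k = 0 \<longleftrightarrow> a k = 0"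
    "(\<lambda>k. a k - C k * of_real (exp (A (real k + 1)))) \<in> O(\<lambda>k. 1 / of_nat (k + 1) ^ 6)"
    using obtain_C by blast
  obtain D where D: "\<And>k. D (k + s) = D k"
    "(\<lambda>k. b k - D k * of_real (exp (B (real k + 1)))) \<in> O(\<lambda>k. 1 / of_nat (k + 1) ^ 6)"
    using obtain_D by blast
  interpret commuting_weights_asymptotics p s m l q r a b C D
    by unfold_locales (fact C D)+
  have "m = p" using leading_relation(2)[OF assms(1), of k] assms(2) C(2) by blast
  moreover from this have "l = s" using lp by simp
  ultimately show thesis
    using explicit_solution[OF assms(1)] C(1) by (intro that[of C]) auto
qed

section \<open>Radial functions on the disk\<close>

lemma nn_integral_lborel_shear:
  fixes F :: "real \<times> real \<Rightarrow> ennreal"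
  assumes [measurable]: "F \<in> borel_measurable borel"
  shows "(\<integral>\<^sup>+ z. F (fst z + a * snd z, snd z) \<partial>lborel) = (\<integral>\<^sup>+ z. F z \<partial>lborel)"
    and "(\<integral>\<^sup>+ z. F (fst z, snd z + a * fst z) \<partial>lborel) = (\<integral>\<^sup>+ z. F z \<partial>lborel)"
proof -
  have F: "F \<in> borel_measurable (borel \<Otimes>\<^sub>M borel)"
    using assms by (simp add: borel_prod)
  have [measurable]: "F \<in> borel_measurable (lborel \<Otimes>\<^sub>M lborel)"
    using assms by (simp add: lborel_prod)
  have shift: "(\<integral>\<^sup>+ x. f (x + t) \<partial>lborel) = (\<integral>\<^sup>+ x. f x \<partial>lborel)"
    if "f \<in> borel_measurable borel" for f :: "real \<Rightarrow> ennreal" and t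
    using nn_integral_real_affine[OF that, of 1 t] by (simp add: add.commute)
  have m1: "(\<lambda>x. F (x, y)) \<in> borel_measurable borel" "(\<lambda>x. F (y, x)) \<in> borel_measurable borel" for y
    using F by measurable
  have "(\<integral>\<^sup>+ z. F (fst z + a * snd z, snd z) \<partial>lborel) = (\<integral>\<^sup>+ y. \<integral>\<^sup>+ x. F (x + a * y, y) \<partial>lborel \<partial>lborel)"
    unfolding lborel_prod[symmetric] by (subst lborel_pair.nn_integral_snd[symmetric]) auto
  also have "\<dots> = (\<integral>\<^sup>+ y. \<integral>\<^sup>+ x. F (x, y) \<partial>lborel \<partial>lborel)"
    by (intro nn_integral_cong shift m1)
  also have "\<dots> = (\<integral>\<^sup>+ z. F z \<partial>lborel)"
    unfolding lborel_prod[symmetric] by (subst lborel_pair.nn_integral_snd) auto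
  finally show "(\<integral>\<^sup>+ z. F (fst z + a * snd z, snd z) \<partial>lborel) = (\<integral>\<^sup>+ z. F z \<partial>lborel)" .
  have "(\<integral>\<^sup>+ z. F (fst z, snd z + a * fst z) \<partial>lborel) = (\<integral>\<^sup>+ x. \<integral>\<^sup>+ y. F (x, y + a * x) \<partial>lborel \<partial>lborel)"
    unfolding lborel_prod[symmetric] by (subst lborel.nn_integral_fst[symmetric]) auto
  also have "\<dots> = (\<integral>\<^sup>+ x. \<integral>\<^sup>+ y. F (x, y) \<partial>lborel \<partial>lborel)"
    by (intro nn_integral_cong shift m1)
  also have "\<dots> = (\<integral>\<^sup>+ z. F z \<partial>lborel)"
    unfolding lborel_prod[symmetric] by (subst lborel.nn_integral_fst) auto
  finally show "(\<integral>\<^sup>+ z. F (fst z, snd z + a * fst z) \<partial>lborel) = (\<integral>\<^sup>+ z. F z \<partial>lborel)" .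
qed

lemma measurable_Complex [measurable]: "(\<lambda>z. Complex (fst z) (snd z)) \<in> borel \<rightarrow>\<^sub>M borel"
  by (intro borel_measurable_continuous_onI continuous_intros)

text \<open>Gives access to iterated integrals over the complex plane; the volumes of boxes
  determine the measure.\<close>

lemma lborel_complex: "(lborel :: complex measure) = distr lborel borel (\<lambda>z. Complex (fst z) (snd z))"
proof (rule lborel_eqI)
  fix l u :: complex
  assume le: "\<And>b. b \<in> Basis \<Longrightarrow> l \<bullet> b \<le> u \<bullet> b"
  have "emeasure (distr lborel borel (\<lambda>z. Complex (fst z) (snd z))) (box l u)
    = emeasure lborel (box (Re l, Im l) (Re u, Im u))"
    by (subst emeasure_distr) (auto intro!: arg_cong[where f = "emeasure lborel"] simp: box_def Basis_complex_def Basis_prod_def inner_complex_def)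
  also have "\<dots> = (\<Prod>b\<in>Basis. ((Re u, Im u) - (Re l, Im l)) \<bullet> b)"
    using le[of 1] le[of \<i>]
    by (intro emeasure_lborel_box) (auto simp: Basis_complex_def Basis_prod_def inner_complex_def)
  also have "\<dots> = (\<Prod>b\<in>Basis. (u - l) \<bullet> b)"
    by (simp add: Basis_complex_def Basis_prod_def inner_complex_def mult.commute)
  finally show "emeasure (distr lborel borel (\<lambda>z. Complex (fst z) (snd z))) (box l u) = (\<Prod>b\<in>Basis. (u - l) \<bullet> b)" .
qed simp

text \<open>A rotation is a product of three shears.\<close>

lemma nn_integral_lborel_rotation:
  fixes F :: "complex \<Rightarrow> ennreal"
  assumes [measurable]: "F \<in> borel_measurable borel" and \<omega>: "cmod \<omega> = 1" "Re \<omega> \<noteq> -1"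
  shows "(\<integral>\<^sup>+ z. F (\<omega> * z) \<partial>lborel) = (\<integral>\<^sup>+ z. F z \<partial>lborel)"
proof -
  define G where "G z = F (Complex (fst z) (snd z))" for z
  define s where "s = Im \<omega>"
  \<comment> \<open>With \<open>s\<close> the sine of the angle, this is minus the tangent of half
    the angle; hence the exclusion of the half turn.\<close>
  define t where "t = - (Im \<omega> / (1 + Re \<omega>))"
  have G [measurable]: "G \<in> borel_measurable borel"
    unfolding G_def by measurable
  have re: "1 + Re \<omega> \<noteq> 0" using \<omega>(2) by linarith
  have sq: "Re \<omega> ^ 2 + Im \<omega> ^ 2 = 1"
    using \<omega>(1) by (simp add: cmod_def)
  have ts: "1 + t * s = Re \<omega>" "t * (1 + Re \<omega>) = - s"
  proof -
    have "Im \<omega> ^ 2 = (1 - Re \<omega>) * (1 + Re \<omega>)"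
      using sq by (simp add: power2_eq_square algebra_simps)
    then have "Im \<omega> ^ 2 / (1 + Re \<omega>) = 1 - Re \<omega>" using re by simp
    then show "1 + t * s = Re \<omega>" by (simp add: t_def s_def power2_eq_square)
    show "t * (1 + Re \<omega>) = - s" using re by (simp add: t_def s_def)
  qed
  define G1 where "G1 z = G (fst z + t * snd z, snd z)" for z
  define G2 where "G2 z = G1 (fst z, snd z + s * fst z)" for z
  have G12 [measurable]: "G1 \<in> borel_measurable borel" "G2 \<in> borel_measurable borel"
    unfolding G1_def G2_def by (measurable; simp add: borel_prod[symmetric])+
  have rot: "G2 (fst z + t * snd z, snd z) = F (\<omega> * Complex (fst z) (snd z))" for z
  proof -
    obtain x y where z: "z = (x, y)" by (cases z)
    have "y + s * (x + t * y) = s * x + (1 + t * s) * y"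
      by (simp add: algebra_simps)
    then have 1: "y + s * (x + t * y) = s * x + Re \<omega> * y"
      by (simp only: ts)
    have "x + t * y + t * (s * x + Re \<omega> * y) = (1 + t * s) * x + (t * (1 + Re \<omega>)) * y"
      by (simp add: algebra_simps)
    then have 2: "x + t * y + t * (s * x + Re \<omega> * y) = Re \<omega> * x - s * y"
      by (simp only: ts mult_minus_left add_uminus_conv_diff)
    have "\<omega> * Complex x y = Complex (Re \<omega> * x - s * y) (s * x + Re \<omega> * y)"
      by (simp add: complex_eq_iff s_def)
    then show ?thesis
      by (simp only: G2_def G1_def G_def z fst_conv snd_conv 1 2)
  qed
  have "(\<integral>\<^sup>+ z. F (\<omega> * z) \<partial>lborel) = (\<integral>\<^sup>+ z. F (\<omega> * Complex (fst z) (snd z)) \<partial>lborel)"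
    by (subst lborel_complex, subst nn_integral_distr) auto
  also have "\<dots> = (\<integral>\<^sup>+ z. G2 (fst z + t * snd z, snd z) \<partial>lborel)"
    by (simp only: rot)
  also have "\<dots> = (\<integral>\<^sup>+ z. G2 z \<partial>lborel)"
    by (rule nn_integral_lborel_shear) simp
  also have "\<dots> = (\<integral>\<^sup>+ z. G1 z \<partial>lborel)"
    unfolding G2_def by (rule nn_integral_lborel_shear) simp
  also have "\<dots> = (\<integral>\<^sup>+ z. G z \<partial>lborel)"
    unfolding G1_def by (rule nn_integral_lborel_shear) simp
  also have "\<dots> = (\<integral>\<^sup>+ z. F z \<partial>lborel)"
    unfolding G_def by (subst lborel_complex, subst nn_integral_distr) auto
  finally show ?thesis .
qed

lemma distr_lborel_rotation:
  assumes "cmod \<omega> = 1" "Re \<omega> \<noteq> -1"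
  shows "distr lborel borel (\<lambda>z. \<omega> * z) = lborel"
proof (rule measure_eqI)
  fix X assume "X \<in> sets (distr lborel borel (\<lambda>z. \<omega> * z))"
  then have X: "X \<in> sets borel" by simp
  have "emeasure (distr lborel borel (\<lambda>z. \<omega> * z)) X = (\<integral>\<^sup>+ z. indicator X z \<partial>distr lborel borel (\<lambda>z. \<omega> * z))"
    using X by simp
  also have "\<dots> = (\<integral>\<^sup>+ z. indicator X (\<omega> * z) \<partial>lborel)"
    using X by (subst nn_integral_distr) auto
  also have "\<dots> = (\<integral>\<^sup>+ z. indicator X z \<partial>lborel)"
    using X by (intro nn_integral_lborel_rotation assms) auto
  also have "\<dots> = emeasure lborel X"
    using X by simp
  finally show "emeasure (distr lborel borel (\<lambda>z. \<omega> * z)) X = emeasure lborel X" .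
qed simp

lemma lebesgue_rotation:
  assumes "cmod \<omega> = 1" "Re \<omega> \<noteq> -1"
  shows "(\<lambda>z. \<omega> * z) \<in> lebesgue \<rightarrow>\<^sub>M lebesgue" "distr lebesgue lebesgue (\<lambda>z. \<omega> * z) = lebesgue"
proof -
  have eq: "distr lebesgue lborel (\<lambda>z. \<omega> * z) = lborel"
  proof -
    have "distr lebesgue lborel (\<lambda>z. \<omega> * z) = distr lborel borel (\<lambda>z. \<omega> * z)"
      by (simp add: distr_completion cong: distr_cong)
    then show ?thesis by (simp add: distr_lborel_rotation[OF assms])
  qed
  then show "(\<lambda>z. \<omega> * z) \<in> lebesgue \<rightarrow>\<^sub>M lebesgue"
    by (simp add: completion.measurable_completion2 measurable_completion)
  show "distr lebesgue lebesgue (\<lambda>z. \<omega> * z) = lebesgue"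
    using completion.completion_distr_eq[of "\<lambda>z. \<omega> * z" lborel lborel] eq
    by (simp add: measurable_completion)
qed

section \<open>Normalized area measure and the law of the radius\<close>

lemma space_disk_measure [simp]: "space disk_measure = unit_disk"
  by (simp add: disk_measure_def space_restrict_space)

lemma sets_disk_measure: "A \<in> sets disk_measure \<longleftrightarrow> A \<subseteq> unit_disk \<and> A \<in> sets lebesgue"
  unfolding disk_measure_def sets_density
  by (subst sets_restrict_space_iff) (auto simp: borel_open)

lemma emeasure_disk_measure:
  assumes "A \<in> sets disk_measure"
  shows "emeasure disk_measure A = ennreal (1 / pi) * emeasure lebesgue A"
proof -
  have "emeasure disk_measure A = ennreal (1 / pi) * emeasure (lebesgue_on unit_disk) A"
    using assms unfolding disk_measure_def by (subst emeasure_density_const) auto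
  then show ?thesis
    using assms by (subst (asm) emeasure_restrict_space) (auto simp: sets_disk_measure borel_open)
qed

lemma borel_measurable_disk_measure:
  "f \<in> borel_measurable disk_measure \<longleftrightarrow> f \<in> borel_measurable (lebesgue_on unit_disk)"
  by (simp add: disk_measure_def)

lemma measurable_disk_measure_continuous_on:
  fixes f :: "complex \<Rightarrow> 'b::{second_countable_topology, real_normed_vector}"
  assumes "continuous_on unit_disk f"
  shows "f \<in> borel_measurable disk_measure"
  unfolding borel_measurable_disk_measure
  by (rule continuous_imp_measurable_on_sets_lebesgue[OF assms]) (auto simp: borel_open)

lemma measurable_disk_measure_borel:
  assumes "f \<in> borel_measurable borel"
  shows "f \<in> borel_measurable disk_measure"
  unfolding borel_measurable_disk_measure
  by (rule measurable_restrict_space1) (simp add: assms measurable_completion)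

lemma emeasure_disk_measure_ball:
  assumes "0 \<le> t" "t \<le> 1"
  shows "emeasure disk_measure (ball 0 t) = ennreal (t ^ 2)" and "emeasure disk_measure (unit_disk \<inter> cball 0 t) = ennreal (t ^ 2)"
proof -
  have "emeasure disk_measure (ball 0 t) = ennreal (1 / pi) * ennreal (pi * t ^ 2)"
    using assms by (subst emeasure_disk_measure) (auto simp: sets_disk_measure borel_open emeasure_ball unit_ball_vol_2)
  then show 1: "emeasure disk_measure (ball 0 t) = ennreal (t ^ 2)"
    by (simp add: ennreal_mult[symmetric])
  have sets: "ball 0 t \<in> sets disk_measure" "unit_disk \<inter> cball 0 t \<in> sets disk_measure"
    using assms by (auto simp: sets_disk_measure borel_open)
  show "emeasure disk_measure (unit_disk \<inter> cball 0 t) = ennreal (t ^ 2)"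
  proof (rule antisym)
    have "emeasure disk_measure (unit_disk \<inter> cball 0 t) = ennreal (1 / pi) * emeasure lebesgue (unit_disk \<inter> cball 0 t)"
      by (rule emeasure_disk_measure[OF sets(2)])
    also have "\<dots> \<le> ennreal (1 / pi) * emeasure lebesgue (cball (0::complex) t)"
      by (intro mult_left_mono emeasure_mono) auto
    also have "\<dots> = ennreal (t ^ 2)"
      using assms by (simp add: emeasure_cball unit_ball_vol_2 ennreal_mult[symmetric])
    finally show "emeasure disk_measure (unit_disk \<inter> cball 0 t) \<le> ennreal (t ^ 2)" .
    have "emeasure disk_measure (ball 0 t) \<le> emeasure disk_measure (unit_disk \<inter> cball 0 t)"
      using assms by (intro emeasure_mono sets) auto
    then show "ennreal (t ^ 2) \<le> emeasure disk_measure (unit_disk \<inter> cball 0 t)"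
      by (simp add: 1)
  qed
qed

interpretation disk: finite_measure disk_measure
  by standard (use emeasure_disk_measure_ball(1)[of 1] in auto)

lemma measurable_cmod_disk [measurable]: "cmod \<in> borel_measurable disk_measure"
  by (rule measurable_disk_measure_borel) simp

text \<open>The radial half of polar coordinates. Both measures are compared on half-lines, using
  that the disk of radius \<open>x\<close> has mass \<open>x ^ 2\<close>.\<close>

lemma distr_disk_measure_cmod:
  "distr disk_measure borel cmod = density lborel (\<lambda>r. ennreal (2 * r * indicator {0..1} r))"
proof (rule measure_eqI_lessThan)
  fix x :: real
  have eq: "emeasure (distr disk_measure borel cmod) {x<..} = emeasure disk_measure (cmod -` {x<..} \<inter> unit_disk)" for x
    by (subst emeasure_distr) auto
  show "emeasure (distr disk_measure borel cmod) {x<..} < \<infinity>"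
    unfolding eq by (simp add: less_top[symmetric])
  consider "x < 0" | "0 \<le> x" "x \<le> 1" | "1 < x" by linarith
  then show "emeasure (distr disk_measure borel cmod) {x<..} = emeasure (density lborel (\<lambda>r. ennreal (2 * r * indicator {0..1} r))) {x<..}"
  proof cases
    case 1
    then have "cmod -` {x<..} \<inter> unit_disk = ball 0 1" by (auto intro: less_le_trans[OF _ norm_ge_zero])
    moreover have "emeasure (density lborel (\<lambda>r. ennreal (2 * r * indicator {0..1} r))) {x<..} = (\<integral>\<^sup>+ r. ennreal (2 * r) * indicator {0..1} r \<partial>lborel)"
      using 1 by (subst emeasure_density) (auto intro!: nn_integral_cong simp: indicator_def)
    moreover have "\<dots> = ennreal (1 ^ 2 - 0 ^ 2)"
      by (rule nn_integral_FTC_Icc[where F = "\<lambda>r. r ^ 2"]) (auto intro!: derivative_eq_intros)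
    ultimately show ?thesis
      unfolding eq using emeasure_disk_measure_ball(1)[of 1] by simp
  next
    case 2
    then have "cmod -` {x<..} \<inter> unit_disk = space disk_measure - (unit_disk \<inter> cball 0 x)" by auto
    moreover have "emeasure disk_measure (space disk_measure - (unit_disk \<inter> cball 0 x)) = emeasure disk_measure (space disk_measure) - emeasure disk_measure (unit_disk \<inter> cball 0 x)"
      by (rule emeasure_Diff) (auto simp: sets_disk_measure borel_open intro!: sets.Int)
    moreover have "emeasure (density lborel (\<lambda>r. ennreal (2 * r * indicator {0..1} r))) {x<..} = (\<integral>\<^sup>+ r. ennreal (2 * r) * indicator {x..1} r \<partial>lborel)"
    proof -
      have "ennreal (2 * r * indicator {0..1} r) * indicator {x<..} r = ennreal (2 * r) * indicator {x..1} r" if "r \<noteq> x" for r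
        using 2 that by (cases "x < r"; cases "r \<le> 1") auto
      then have "AE r in lborel. ennreal (2 * r * indicator {0..1} r) * indicator {x<..} r = ennreal (2 * r) * indicator {x..1} r"
        by (rule eventually_mono[OF AE_lborel_singleton[of x]])
      then show ?thesis
        by (subst emeasure_density) (auto intro: nn_integral_cong_AE)
    qed
    moreover have "\<dots> = ennreal (1 ^ 2 - x ^ 2)"
      using 2 by (intro nn_integral_FTC_Icc[where F = "\<lambda>r. r ^ 2"]) (auto intro!: derivative_eq_intros)
    ultimately show ?thesis
      unfolding eq using 2 emeasure_disk_measure_ball(1)[of 1] emeasure_disk_measure_ball(2)[of x]
      by (simp add: ennreal_minus[symmetric])
  next
    case 3
    then have "cmod -` {x<..} \<inter> unit_disk = {}" by auto
    moreover have "emeasure (density lborel (\<lambda>r. ennreal (2 * r * indicator {0..1} r))) {x<..} = (\<integral>\<^sup>+ r. 0 \<partial>(lborel::real measure))"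
    proof -
      have "ennreal (2 * r * indicator {0..1} r) * indicator {x<..} r = 0" for r
        using 3 by (cases "x < r") auto
      then have "(\<integral>\<^sup>+ r. ennreal (2 * r * indicator {0..1} r) * indicator {x<..} r \<partial>lborel) = (\<integral>\<^sup>+ r. 0 \<partial>(lborel::real measure))"
        by (rule nn_integral_cong)
      then show ?thesis
        by (subst emeasure_density) auto
    qed
    ultimately show ?thesis
      unfolding eq by simp
  qed
qed auto

lemma integral_disk_measure_power: "(LINT z|disk_measure. cmod z ^ n) = 2 / (real n + 2)"
proof -
  have "(LINT z|disk_measure. cmod z ^ n) = (LINT r|distr disk_measure borel cmod. r ^ n)"
    by (subst integral_distr) auto
  also have "\<dots> = (LINT r|lborel. 2 * r ^ Suc n * indicator {0..1} r)"
    unfolding distr_disk_measure_cmod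
    by (subst integral_density) (auto intro!: Bochner_Integration.integral_cong simp: indicator_def)
  also have "\<dots> = 2 / (real n + 2) * 1 ^ Suc (Suc n) - 2 / (real n + 2) * 0 ^ Suc (Suc n)"
  proof (rule integral_FTC_Icc_real)
    show "((\<lambda>r. 2 / (real n + 2) * r ^ Suc (Suc n)) has_real_derivative 2 * r ^ Suc n) (at r)" for r
      by (rule DERIV_cong[OF DERIV_cmult[OF DERIV_pow]]) (simp add: field_simps del: power_Suc)
  qed auto
  finally show ?thesis by simp
qed

lemma disk_measure_rotation:
  assumes "cmod \<omega> = 1" "Re \<omega> \<noteq> -1"
  shows "(\<lambda>z. \<omega> * z) \<in> disk_measure \<rightarrow>\<^sub>M disk_measure" "distr disk_measure disk_measure (\<lambda>z. \<omega> * z) = disk_measure"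
proof -
  note rot = lebesgue_rotation[OF assms]
  have vimage: "(\<lambda>z. \<omega> * z) -` A \<inter> unit_disk = (\<lambda>z. \<omega> * z) -` A" if "A \<subseteq> unit_disk" for A
    using that assms(1) by (auto simp: norm_mult subset_iff)
  have sets: "(\<lambda>z. \<omega> * z) -` A \<in> sets lebesgue" if "A \<in> sets lebesgue" for A
    using measurable_sets[OF rot(1) that] by simp
  show meas: "(\<lambda>z. \<omega> * z) \<in> disk_measure \<rightarrow>\<^sub>M disk_measure"
  proof (rule measurableI)
    show "\<omega> * z \<in> space disk_measure" if "z \<in> space disk_measure" for z
      using that assms(1) by (simp add: norm_mult)
    show "(\<lambda>z. \<omega> * z) -` A \<inter> space disk_measure \<in> sets disk_measure" if "A \<in> sets disk_measure" for A
      using that sets vimage[of A] by (auto simp: sets_disk_measure)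
  qed
  show "distr disk_measure disk_measure (\<lambda>z. \<omega> * z) = disk_measure"
  proof (rule measure_eqI)
    fix A assume "A \<in> sets (distr disk_measure disk_measure (\<lambda>z. \<omega> * z))"
    then have A: "A \<in> sets disk_measure" by simp
    then have A': "A \<subseteq> unit_disk" "A \<in> sets lebesgue" by (auto simp: sets_disk_measure)
    have "emeasure (distr disk_measure disk_measure (\<lambda>z. \<omega> * z)) A = emeasure disk_measure ((\<lambda>z. \<omega> * z) -` A)"
      using A by (subst emeasure_distr[OF meas]) (simp_all add: vimage[OF A'(1)])
    also have "\<dots> = ennreal (1 / pi) * emeasure lebesgue ((\<lambda>z. \<omega> * z) -` A)"
      using measurable_sets[OF meas A] by (intro emeasure_disk_measure) (simp add: vimage[OF A'(1)])
    also have "emeasure lebesgue ((\<lambda>z. \<omega> * z) -` A) = emeasure (distr lebesgue lebesgue (\<lambda>z. \<omega> * z)) A"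
      using A' by (subst emeasure_distr[OF rot(1)]) auto
    also have "\<dots> = emeasure lebesgue A"
      by (simp add: rot(2))
    finally show "emeasure (distr disk_measure disk_measure (\<lambda>z. \<omega> * z)) A = emeasure disk_measure A"
      by (simp add: emeasure_disk_measure[OF A])
  qed simp
qed

lemma integral_disk_rotation:
  fixes f :: "complex \<Rightarrow> complex"
  assumes "cmod \<omega> = 1" "Re \<omega> \<noteq> -1" "f \<in> borel_measurable disk_measure"
  shows "(LINT z|disk_measure. f (\<omega> * z)) = (LINT z|disk_measure. f z)"
  using integral_distr[OF disk_measure_rotation(1)[OF assms(1,2)] assms(3)]
  by (simp add: disk_measure_rotation(2)[OF assms(1,2)])

lemma measurable_cnj [measurable]: "cnj \<in> borel_measurable borel"
  by (intro borel_measurable_continuous_onI continuous_intros)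

text \<open>Rotation by \<open>\<omega>\<close> preserves the measure and multiplies the integrand
  by \<open>\<omega> ^ i * cnj \<omega> ^ j\<close>, so the integral vanishes once that factor
  differs from one.\<close>

lemma integral_angular_zero:
  fixes \<psi> :: "complex \<Rightarrow> complex"
  assumes \<psi>: "radial \<psi>" "\<psi> \<in> borel_measurable disk_measure" and ij: "i \<noteq> j"
  shows "(LINT z|disk_measure. \<psi> z * sgn z ^ i * cnj (sgn z) ^ j) = 0"
proof -
  define N where "N = \<bar>real i - real j\<bar>"
  \<comment> \<open>A quarter turn divided by the distance of \<open>i\<close> and \<open>j\<close>:
    the factor becomes \<open>\<i>\<close> or \<open>- \<i>\<close>, and
    \<open>Re \<omega> \<ge> 0\<close> keeps clear of the excluded half turn.\<close>
  define \<omega> where "\<omega> = cis (pi / (2 * N))"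
  have N: "N \<ge> 1"
    using ij by (auto simp: N_def)
  have angle: "0 \<le> pi / (2 * N)" "pi / (2 * N) \<le> pi / 2"
    using N by (auto simp: divide_simps)
  then have "Re \<omega> \<ge> 0"
    unfolding \<omega>_def by (simp, intro cos_ge_zero) auto
  then have \<omega>: "cmod \<omega> = 1" "Re \<omega> \<noteq> -1"
    by (simp_all add: \<omega>_def)
  have factor: "\<omega> ^ i * cnj \<omega> ^ j \<noteq> 1"
  proof -
    define x where "x = (real i - real j) * (pi / (2 * N))"
    have "x = pi / 2 \<or> x = - (pi / 2)"
      using N unfolding N_def x_def by (cases "real i \<ge> real j") (auto simp: field_simps abs_if)
    then have "cis x = \<i> \<or> cis x = - \<i>"
      by (metis cis_pi_half cis_minus_pi_half)
    moreover have "\<omega> ^ i * cnj \<omega> ^ j = cis x"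
      by (simp add: \<omega>_def x_def Complex.DeMoivre cis_cnj cis_mult algebra_simps diff_divide_distrib)
    ultimately show ?thesis by (auto simp: complex_eq_iff)
  qed
  define F where "F z = \<psi> z * sgn z ^ i * cnj (sgn z) ^ j" for z
  have meas: "F \<in> borel_measurable disk_measure"
  proof -
    have "(\<lambda>z. sgn z ^ i * cnj (sgn z) ^ j) \<in> borel_measurable disk_measure"
      by (rule measurable_disk_measure_borel) measurable
    from borel_measurable_times[OF \<psi>(2) this] show ?thesis
      unfolding F_def by (simp add: mult.assoc)
  qed
  have rot: "F (\<omega> * z) = (\<omega> ^ i * cnj \<omega> ^ j) * F z" if "z \<in> unit_disk" for z
  proof -
    have "\<omega> * z \<in> unit_disk" "cmod (\<omega> * z) = cmod z"
      using that \<omega>(1) by (simp_all add: norm_mult)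
    then have "\<psi> (\<omega> * z) = \<psi> z"
      using \<psi>(1) that unfolding radial_def by blast
    moreover have "sgn \<omega> = \<omega>" using \<omega>(1) by (simp add: sgn_div_norm)
    ultimately show ?thesis
      by (simp add: F_def sgn_mult power_mult_distrib mult_ac)
  qed
  have "(LINT z|disk_measure. F z) = (LINT z|disk_measure. F (\<omega> * z))"
    using integral_disk_rotation[OF \<omega> meas] by simp
  also have "\<dots> = (LINT z|disk_measure. (\<omega> ^ i * cnj \<omega> ^ j) * F z)"
    by (intro Bochner_Integration.integral_cong) (auto simp: rot)
  also have "\<dots> = (\<omega> ^ i * cnj \<omega> ^ j) * (LINT z|disk_measure. F z)"
    by simp
  finally have "(1 - \<omega> ^ i * cnj \<omega> ^ j) * (LINT z|disk_measure. F z) = 0"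
    by (simp add: algebra_simps)
  then show ?thesis
    using factor by (simp add: F_def)
qed

section \<open>Square integrable functions on the disk\<close>

lemma L2_disk_measurable: "u \<in> L2_disk \<Longrightarrow> u \<in> borel_measurable disk_measure"
  by (simp add: L2_disk_def)

lemma L2_disk_mult_integrable:
  assumes "u \<in> L2_disk" "v \<in> L2_disk"
  shows "integrable disk_measure (\<lambda>z. u z * v z)"
proof (rule Bochner_Integration.integrable_bound)
  show "integrable disk_measure (\<lambda>z. (cmod (u z))\<^sup>2 + (cmod (v z))\<^sup>2)"
    using assms by (intro Bochner_Integration.integrable_add) (auto simp: L2_disk_def)
  show "(\<lambda>z. u z * v z) \<in> borel_measurable disk_measure"
    using assms by (intro borel_measurable_times L2_disk_measurable)
  have "cmod (u z * v z) \<le> (cmod (u z))\<^sup>2 + (cmod (v z))\<^sup>2" for z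
  proof -
    have "2 * cmod (u z) * cmod (v z) \<le> (cmod (u z))\<^sup>2 + (cmod (v z))\<^sup>2"
      by (rule sum_squares_bound)
    moreover have "0 \<le> cmod (u z) * cmod (v z)" by simp
    ultimately show ?thesis unfolding norm_mult by linarith
  qed
  then show "AE z in disk_measure. norm (u z * v z) \<le> norm ((cmod (u z))\<^sup>2 + (cmod (v z))\<^sup>2)"
    by simp
qed

lemma L2_disk_bounded_mult:
  assumes u: "u \<in> L2_disk" and b: "b \<in> borel_measurable disk_measure" "\<And>z. z \<in> unit_disk \<Longrightarrow> cmod (b z) \<le> K"
  shows "(\<lambda>z. b z * u z) \<in> L2_disk"
  unfolding L2_disk_def
proof (intro CollectI conjI)
  show m: "(\<lambda>z. b z * u z) \<in> borel_measurable disk_measure"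
    by (intro borel_measurable_times b L2_disk_measurable u)
  show "integrable disk_measure (\<lambda>z. (cmod (b z * u z))\<^sup>2)"
  proof (rule Bochner_Integration.integrable_bound)
    show "integrable disk_measure (\<lambda>z. K\<^sup>2 * (cmod (u z))\<^sup>2)"
      using u by (simp add: L2_disk_def)
    show "(\<lambda>z. (cmod (b z * u z))\<^sup>2) \<in> borel_measurable disk_measure"
      using m by measurable
    show "AE z in disk_measure. norm ((cmod (b z * u z))\<^sup>2) \<le> norm (K\<^sup>2 * (cmod (u z))\<^sup>2)"
      using b(2) by (auto simp: norm_mult power_mult_distrib intro!: mult_right_mono power_mono)
  qed
qed

lemma L2_disk_1: "(\<lambda>_. 1) \<in> L2_disk"
  by (simp add: L2_disk_def)

lemma L2_disk_bounded:
  assumes "b \<in> borel_measurable disk_measure" "\<And>z. z \<in> unit_disk \<Longrightarrow> cmod (b z) \<le> K"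
  shows "b \<in> L2_disk"
  using L2_disk_bounded_mult[OF L2_disk_1 assms] by simp

lemma L2_disk_integrable: "u \<in> L2_disk \<Longrightarrow> integrable disk_measure u"
  using L2_disk_mult_integrable[OF _ L2_disk_1] by simp

lemma L2_disk_add:
  assumes "u \<in> L2_disk" "v \<in> L2_disk"
  shows "(\<lambda>z. u z + v z) \<in> L2_disk"
  unfolding L2_disk_def
proof (intro CollectI conjI)
  show m: "(\<lambda>z. u z + v z) \<in> borel_measurable disk_measure"
    by (intro borel_measurable_add L2_disk_measurable assms)
  show "integrable disk_measure (\<lambda>z. (cmod (u z + v z))\<^sup>2)"
  proof (rule Bochner_Integration.integrable_bound)
    show "integrable disk_measure (\<lambda>z. 2 * (cmod (u z))\<^sup>2 + 2 * (cmod (v z))\<^sup>2)"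
      using assms by (intro Bochner_Integration.integrable_add) (auto simp: L2_disk_def)
    show "(\<lambda>z. (cmod (u z + v z))\<^sup>2) \<in> borel_measurable disk_measure"
      using m by measurable
    have "(cmod (u z + v z))\<^sup>2 \<le> 2 * (cmod (u z))\<^sup>2 + 2 * (cmod (v z))\<^sup>2" for z
    proof -
      have "(cmod (u z + v z))\<^sup>2 \<le> (cmod (u z) + cmod (v z))\<^sup>2"
        by (intro power_mono norm_triangle_ineq) simp
      moreover have "2 * cmod (u z) * cmod (v z) \<le> (cmod (u z))\<^sup>2 + (cmod (v z))\<^sup>2"
        by (rule sum_squares_bound)
      ultimately show ?thesis by (simp add: power2_sum)
    qed
    then show "AE z in disk_measure. norm ((cmod (u z + v z))\<^sup>2) \<le> norm (2 * (cmod (u z))\<^sup>2 + 2 * (cmod (v z))\<^sup>2)"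
      by simp
  qed
qed

lemma L2_disk_cmult: "u \<in> L2_disk \<Longrightarrow> (\<lambda>z. c * u z) \<in> L2_disk"
  by (rule L2_disk_bounded_mult[of _ "\<lambda>_. c" "cmod c"]) auto

lemma L2_disk_diff:
  assumes "u \<in> L2_disk" "v \<in> L2_disk"
  shows "(\<lambda>z. u z - v z) \<in> L2_disk"
  using L2_disk_add[OF assms(1) L2_disk_cmult[OF assms(2), of "-1"]] by simp

lemma L2_disk_cnj: "u \<in> L2_disk \<Longrightarrow> (\<lambda>z. cnj (u z)) \<in> L2_disk"
  by (auto simp: L2_disk_def intro: measurable_compose[OF _ measurable_cnj])

lemma AE_disk_nonzero: "AE z in disk_measure. z \<noteq> 0"
proof (rule AE_I[where N = "{0}"])
  show "emeasure disk_measure {0} = 0"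
    by (subst emeasure_disk_measure) (auto simp: sets_disk_measure)
qed (auto simp: sets_disk_measure)

section \<open>The Bergman space and its projection\<close>

lemma bergman_spaceD:
  assumes "v \<in> bergman_space"
  shows "v holomorphic_on unit_disk" "v \<in> L2_disk" "\<And>z. z \<notin> unit_disk \<Longrightarrow> v z = 0"
  using assms by (auto simp: bergman_space_def)

lemma bergman_space_lincomb:
  assumes "u \<in> bergman_space" "v \<in> bergman_space"
  shows "(\<lambda>z. x * u z + y * v z) \<in> bergman_space"
  using assms by (auto simp: bergman_space_def intro!: holomorphic_intros L2_disk_add L2_disk_cmult)

lemma monomial_measurable: "monomial k \<in> borel_measurable disk_measure"
proof (rule measurable_disk_measure_continuous_on)
  have "continuous_on unit_disk (\<lambda>z::complex. z ^ k)"
    by (intro continuous_intros)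
  then show "continuous_on unit_disk (monomial k)"
    by (rule continuous_on_eq) (simp add: monomial_def)
qed

lemma monomial_in_bergman: "monomial k \<in> bergman_space"
proof -
  have "(\<lambda>z. z ^ k) holomorphic_on unit_disk"
    by (intro holomorphic_intros)
  then have "monomial k holomorphic_on unit_disk"
    by (rule holomorphic_transform) (simp add: monomial_def)
  moreover have "monomial k \<in> L2_disk"
    by (rule L2_disk_bounded[of _ 1, OF monomial_measurable]) (auto simp: monomial_def norm_power intro: power_le_one)
  ultimately show ?thesis
    by (auto simp: bergman_space_def monomial_def)
qed

lemma continuous_AE_zero:
  fixes f :: "complex \<Rightarrow> real"
  assumes "continuous_on unit_disk f" "AE z in disk_measure. f z = 0" "z \<in> unit_disk"
  shows "f z = 0"
proof (rule ccontr)
  assume "f z \<noteq> 0"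
  define U where "U = {w \<in> unit_disk. f w \<noteq> 0}"
  have "open (unit_disk \<inter> f -` (- {0}))"
    using assms(1) by (intro continuous_open_preimage) auto
  then have U: "open U" by (simp add: U_def vimage_def Int_def)
  have "z \<in> U" using \<open>f z \<noteq> 0\<close> assms(3) by (simp add: U_def)
  obtain N where N: "{w \<in> space disk_measure. f w \<noteq> 0} \<subseteq> N" "N \<in> null_sets disk_measure"
    using assms(2) by (auto simp: eventually_ae_filter)
  have sets: "U \<in> sets disk_measure"
    using U by (auto simp: sets_disk_measure borel_open U_def)
  have "emeasure disk_measure U = 0"
    using N sets by (intro emeasure_eq_0[OF null_setsD2[OF N(2)] null_setsD1[OF N(2)]]) (auto simp: U_def)
  then have "emeasure lebesgue U = 0"
    using emeasure_disk_measure[OF sets] by simp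
  then have "negligible U"
    using U by (auto simp: negligible_iff_null_sets null_sets_def borel_open)
  then show False
    using U \<open>z \<in> U\<close> open_not_negligible by blast
qed

text \<open>The difference \<open>w\<close> of two candidates is orthogonal to itself. So it
  vanishes almost everywhere, by continuity on the whole disk, and outside the disk by the
  convention of extension by zero.\<close>

lemma bergman_proj_eqI:
  assumes u: "u \<in> L2_disk" and h: "h \<in> bergman_space"
    and orth: "\<And>v. v \<in> bergman_space \<Longrightarrow> inner_disk (\<lambda>z. u z - h z) v = 0"
  shows "bergman_proj u = h"
  unfolding bergman_proj_def
proof (rule the_equality)
  show "h \<in> bergman_space \<and> (\<forall>v\<in>bergman_space. inner_disk (\<lambda>z. u z - h z) v = 0)"
    using h orth by blast
next
  fix g assume "g \<in> bergman_space \<and> (\<forall>v\<in>bergman_space. inner_disk (\<lambda>z. u z - g z) v = 0)"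
  then have g: "g \<in> bergman_space" "\<And>v. v \<in> bergman_space \<Longrightarrow> inner_disk (\<lambda>z. u z - g z) v = 0"
    by auto
  define w where "w z = h z - g z" for z
  have w: "w \<in> bergman_space"
    using bergman_space_lincomb[OF h g(1), of 1 "-1"] by (simp add: w_def[abs_def])
  have int: "integrable disk_measure (\<lambda>z. (u z - y z) * cnj (w z))" if "y \<in> bergman_space" for y
    by (intro L2_disk_mult_integrable L2_disk_diff L2_disk_cnj u bergman_spaceD w that)
  have "0 = inner_disk (\<lambda>z. u z - g z) w - inner_disk (\<lambda>z. u z - h z) w"
    using g(2)[OF w] orth[OF w] by simp
  also have "\<dots> = (LINT z|disk_measure. (u z - g z) * cnj (w z) - (u z - h z) * cnj (w z))"
    unfolding inner_disk_def by (subst Bochner_Integration.integral_diff) (auto intro: int g(1) h)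
  also have "\<dots> = (LINT z|disk_measure. complex_of_real ((cmod (w z))\<^sup>2))"
  proof (intro Bochner_Integration.integral_cong refl)
    fix z
    have "(u z - g z) * cnj (w z) - (u z - h z) * cnj (w z) = w z * cnj (w z)"
      by (simp add: w_def algebra_simps)
    also have "\<dots> = complex_of_real ((cmod (w z))\<^sup>2)"
      by (rule complex_norm_square[symmetric])
    finally show "(u z - g z) * cnj (w z) - (u z - h z) * cnj (w z) = complex_of_real ((cmod (w z))\<^sup>2)" .
  qed
  finally have "(LINT z|disk_measure. (cmod (w z))\<^sup>2) = 0"
    by (metis integral_complex_of_real of_real_eq_0_iff)
  moreover have "integrable disk_measure (\<lambda>z. (cmod (w z))\<^sup>2)"
    using bergman_spaceD(2)[OF w] by (simp add: L2_disk_def)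
  ultimately have "AE z in disk_measure. (cmod (w z))\<^sup>2 = 0"
    by (subst (asm) integral_nonneg_eq_0_iff_AE) auto
  moreover have "continuous_on unit_disk (\<lambda>z. (cmod (w z))\<^sup>2)"
    by (intro continuous_intros holomorphic_on_imp_continuous_on bergman_spaceD w)
  ultimately have "w z = 0" if "z \<in> unit_disk" for z
    using continuous_AE_zero[of "\<lambda>z. (cmod (w z))\<^sup>2" z] that by simp
  moreover have "w z = 0" if "z \<notin> unit_disk" for z
    using bergman_spaceD(3)[OF w that] .
  ultimately have "w z = 0" for z
    by blast
  then show "g = h"
    by (simp add: w_def fun_eq_iff)
qed

lemma radialD:
  assumes "radial \<phi>" "z \<in> unit_disk" "w \<in> unit_disk" "cmod z = cmod w"
  shows "\<phi> z = \<phi> w"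
  using assms unfolding radial_def by blast

lemma radial_mult_cmod:
  assumes "radial \<phi>"
  shows "radial (\<lambda>z. \<phi> z * F (cmod z))"
  unfolding radial_def
proof (intro ballI impI)
  fix z w assume "z \<in> unit_disk" "w \<in> unit_disk" and eq: "cmod z = cmod w"
  from radialD[OF assms this] show "\<phi> z * F (cmod z) = \<phi> w * F (cmod w)"
    by (simp only: eq)
qed

lemma cmod_mult_sgn: "complex_of_real (cmod z) * sgn z = z"
  by (cases "z = 0") (simp_all add: sgn_div_norm scaleR_conv_of_real)

lemma power_sgn: "z ^ i = of_real (cmod z ^ i) * sgn z ^ i" for z :: complex
  using cmod_mult_sgn[of z] by (metis of_real_power power_mult_distrib)

lemma sgn_power_cancel: "of_real (cmod z ^ i) * (sgn z ^ i * cnj (sgn z) ^ i) = of_real (cmod z ^ i)"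
proof (cases "z = 0")
  case False
  then have "sgn z * cnj (sgn z) = 1"
    by (simp add: complex_norm_square[symmetric] norm_sgn)
  then show ?thesis by (metis mult_1_right power_mult_distrib power_one)
qed (cases i; simp)

lemma integral_radial_monomials:
  assumes \<psi>: "radial \<psi>" "\<psi> \<in> L2_disk"
  shows "(LINT z|disk_measure. \<psi> z * sgn z ^ j * cnj (z ^ i)) =
    (if i = j then LINT z|disk_measure. \<psi> z * of_real (cmod z ^ j) else 0)"
proof -
  have eq: "\<psi> z * sgn z ^ j * cnj (z ^ i) = (\<psi> z * of_real (cmod z ^ i)) * sgn z ^ j * cnj (sgn z) ^ i" for z
    by (subst power_sgn[of z i]) (simp add: mult_ac)
  show ?thesis
  proof (cases "i = j")
    case True
    have "(\<psi> z * of_real (cmod z ^ j)) * sgn z ^ j * cnj (sgn z) ^ j = \<psi> z * of_real (cmod z ^ j)" for z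
      using sgn_power_cancel[of z j] by (simp add: mult.assoc)
    then show ?thesis
      unfolding eq unfolding True by (simp only: if_True simp_thms)
  next
    case False
    have "(\<lambda>z. \<psi> z * of_real (cmod z ^ i)) \<in> borel_measurable disk_measure"
      by (intro borel_measurable_times L2_disk_measurable \<psi> measurable_disk_measure_borel) measurable
    then have "(LINT z|disk_measure. (\<psi> z * of_real (cmod z ^ i)) * sgn z ^ j * cnj (sgn z) ^ i) = 0"
      using False by (intro integral_angular_zero radial_mult_cmod[OF \<psi>(1), of "\<lambda>r. of_real (r ^ i)"]) auto
    then show ?thesis
      unfolding eq using False by (simp only: if_False)
  qed
qed

lemma bergman_power_series:
  assumes "v \<in> bergman_space"
  obtains c where "\<And>z. z \<in> unit_disk \<Longrightarrow> (\<lambda>i. c i * z ^ i) sums v z"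
  using holomorphic_power_series[OF bergman_spaceD(1)[OF assms]] that[of "\<lambda>i. (deriv ^^ i) v 0 / fact i"] by simp

text \<open>Where \<open>\<psi>\<close> lives, the Taylor series of \<open>v\<close> converges
  absolutely and uniformly, so it may be integrated term by term; angular orthogonality keeps only
  the term of index \<open>j\<close>.\<close>

lemma truncated_radial_inner:
  assumes \<psi>: "radial \<psi>" "\<psi> \<in> L2_disk" and c: "\<And>z. z \<in> unit_disk \<Longrightarrow> (\<lambda>i. c i * z ^ i) sums v z"
    and \<rho>: "0 \<le> \<rho>" "\<rho> < 1" and supp: "\<And>z. z \<in> unit_disk \<Longrightarrow> cmod z > \<rho> \<Longrightarrow> \<psi> z = 0"
  shows "(LINT z|disk_measure. \<psi> z * sgn z ^ j * cnj (v z)) = cnj (c j) * (LINT z|disk_measure. \<psi> z * of_real (cmod z ^ j))"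
proof -
  \<comment> \<open>A point of the disk beyond \<open>\<rho>\<close>: convergence there gives
    absolute convergence at \<open>\<rho>\<close>.\<close>
  define x where "x = complex_of_real ((1 + \<rho>) / 2)"
  have "cmod x = (1 + \<rho>) / 2"
    using \<rho> by (simp add: x_def del: of_real_divide of_real_add)
  then have x: "x \<in> unit_disk" "\<rho> < cmod x"
    using \<rho> by auto
  have "summable (\<lambda>i. cmod (c i * complex_of_real \<rho> ^ i))"
    using powser_insidea[OF sums_summable[OF c[OF x(1)]], of "complex_of_real \<rho>"] x(2) \<rho> by simp
  then have summ: "summable (\<lambda>i. cmod (c i) * \<rho> ^ i)"
    using \<rho> by (simp add: norm_mult norm_power)
  define K where "K = (\<Sum>i. cmod (c i) * \<rho> ^ i)"
  have meas_sgn: "(\<lambda>z. sgn z ^ j) \<in> borel_measurable disk_measure"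
    by (rule measurable_disk_measure_borel) measurable
  have int: "integrable disk_measure (\<lambda>z. \<psi> z * sgn z ^ j * cnj (z ^ i))" for i
  proof (rule Bochner_Integration.integrable_bound[OF L2_disk_integrable[OF \<psi>(2)]])
    show "(\<lambda>z. \<psi> z * sgn z ^ j * cnj (z ^ i)) \<in> borel_measurable disk_measure"
      by (intro borel_measurable_times L2_disk_measurable \<psi> meas_sgn measurable_disk_measure_borel) measurable
    have "cmod (\<psi> z * sgn z ^ j * cnj (z ^ i)) \<le> cmod (\<psi> z)" if "z \<in> unit_disk" for z
    proof -
      have "cmod (sgn z ^ j) \<le> 1" "cmod (cnj (z ^ i)) \<le> 1"
        using that by (auto simp: norm_power norm_sgn intro: power_le_one)
      then have "cmod (sgn z ^ j) * cmod (cnj (z ^ i)) \<le> 1"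
        by (intro mult_le_one) auto
      from mult_left_mono[OF this, of "cmod (\<psi> z)"] show ?thesis
        by (simp add: norm_mult mult.assoc)
    qed
    then show "AE z in disk_measure. norm (\<psi> z * sgn z ^ j * cnj (z ^ i)) \<le> norm (\<psi> z)"
      by (intro AE_I2) simp
  qed
  define S where "S N z = \<psi> z * sgn z ^ j * cnj (\<Sum>i<N. c i * z ^ i)" for N z
  have S_eq: "S N z = (\<Sum>i<N. cnj (c i) * (\<psi> z * sgn z ^ j * cnj (z ^ i)))" for N z
    by (simp add: S_def sum_distrib_left mult_ac)
  have int_S: "(LINT z|disk_measure. S N z) = cnj (c j) * (LINT z|disk_measure. \<psi> z * of_real (cmod z ^ j))" if "j < N" for N
  proof -
    have "(LINT z|disk_measure. S N z) = (\<Sum>i<N. cnj (c i) * (LINT z|disk_measure. \<psi> z * sgn z ^ j * cnj (z ^ i)))"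
      unfolding S_eq using int by (subst Bochner_Integration.integral_sum) auto
    also have "\<dots> = (\<Sum>i<N. if i = j then cnj (c j) * (LINT z|disk_measure. \<psi> z * of_real (cmod z ^ j)) else 0)"
      unfolding integral_radial_monomials[OF \<psi>] by (intro sum.cong) auto
    finally show ?thesis using that by simp
  qed
  have "(\<lambda>N. LINT z|disk_measure. S N z) \<longlonglongrightarrow> (LINT z|disk_measure. \<psi> z * sgn z ^ j * cnj (v z))"
  proof (rule integral_dominated_convergence)
    show "integrable disk_measure (\<lambda>z. K * cmod (\<psi> z))"
      using L2_disk_integrable[OF \<psi>(2)] by simp
    have lim: "(\<lambda>N. S N z) \<longlonglongrightarrow> \<psi> z * sgn z ^ j * cnj (v z)" if "z \<in> unit_disk" for z
      unfolding S_def using c[OF that, unfolded sums_def] by (intro tendsto_intros)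
    then show "AE z in disk_measure. (\<lambda>N. S N z) \<longlonglongrightarrow> \<psi> z * sgn z ^ j * cnj (v z)"
      by (intro AE_I2) simp
    show meas_S: "S N \<in> borel_measurable disk_measure" for N
      unfolding S_def using int[of 0, THEN borel_measurable_integrable]
      by (intro borel_measurable_times L2_disk_measurable \<psi> meas_sgn measurable_disk_measure_borel) measurable
    show "(\<lambda>z. \<psi> z * sgn z ^ j * cnj (v z)) \<in> borel_measurable disk_measure"
      by (rule borel_measurable_LIMSEQ_metric[OF meas_S lim]) simp
    have "cmod (S N z) \<le> K * cmod (\<psi> z)" if z: "z \<in> unit_disk" for N z
    proof (cases "cmod z \<le> \<rho>")
      case True
      have "cmod (\<Sum>i<N. c i * z ^ i) \<le> (\<Sum>i<N. cmod (c i) * \<rho> ^ i)"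
        using True by (intro sum_norm_le) (auto simp: norm_mult norm_power intro!: mult_left_mono power_mono)
      also have "\<dots> \<le> K"
        unfolding K_def using summ \<rho> by (intro sum_le_suminf) auto
      finally have "cmod (sgn z ^ j) * cmod (\<Sum>i<N. c i * z ^ i) \<le> 1 * K"
        by (intro mult_mono) (auto simp: norm_power norm_sgn intro: power_le_one)
      from mult_left_mono[OF this, of "cmod (\<psi> z)"] show ?thesis
        by (simp add: S_def norm_mult mult_ac del: cnj_sum)
    next
      case False
      then show ?thesis using supp[OF z] by (simp add: S_def)
    qed
    then show "AE z in disk_measure. norm (S N z) \<le> K * cmod (\<psi> z)" for N
      by (intro AE_I2) simp
  qed
  moreover have "(\<lambda>N. LINT z|disk_measure. S N z) \<longlonglongrightarrow> cnj (c j) * (LINT z|disk_measure. \<psi> z * of_real (cmod z ^ j))"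
    using int_S by (intro tendsto_eventually) (auto simp: eventually_sequentially intro!: exI[of _ "Suc j"])
  ultimately show ?thesis
    by (rule LIMSEQ_unique)
qed

text \<open>The Taylor series of \<open>v\<close> need not be bounded up to the boundary, so
  \<open>\<psi>\<close> is cut off at radii \<open>\<rho> n\<close> tending to one. The Taylor
  coefficient \<open>c j\<close> is the same for every cut-off, while the truncated moments tend to
  the vanishing moment of \<open>\<psi>\<close>.\<close>

lemma radial_inner_zero:
  assumes \<psi>: "radial \<psi>" "\<psi> \<in> L2_disk" and v: "v \<in> bergman_space"
    and zero: "(LINT z|disk_measure. \<psi> z * of_real (cmod z ^ j)) = 0"
  shows "(LINT z|disk_measure. \<psi> z * sgn z ^ j * cnj (v z)) = 0"
proof -
  obtain c where c: "\<And>z. z \<in> unit_disk \<Longrightarrow> (\<lambda>i. c i * z ^ i) sums v z"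
    using bergman_power_series[OF v] by blast
  define \<rho> where "\<rho> n = 1 - 1 / (real n + 2)" for n
  have \<rho>: "0 \<le> \<rho> n" "\<rho> n < 1" for n
    by (auto simp: \<rho>_def field_simps)
  have \<rho>_lim: "\<rho> \<longlonglongrightarrow> 1"
    unfolding \<rho>_def by real_asymp
  define \<psi>' where "\<psi>' n z = \<psi> z * (if cmod z \<le> \<rho> n then 1 else 0)" for n z
  have radial': "radial (\<psi>' n)" for n
    unfolding \<psi>'_def by (rule radial_mult_cmod[OF \<psi>(1)])
  have cut: "(\<lambda>z. if cmod z \<le> \<rho> n then 1 else (0::complex)) \<in> borel_measurable disk_measure" for n
    by (rule measurable_disk_measure_borel) measurable
  have L2': "\<psi>' n \<in> L2_disk" for n
    using L2_disk_bounded_mult[OF \<psi>(2) cut[of n], of 1] by (simp add: \<psi>'_def[abs_def] mult.commute)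
  have lim: "(\<lambda>n. \<psi>' n z) \<longlonglongrightarrow> \<psi> z" if "z \<in> unit_disk" for z
  proof (rule tendsto_eventually)
    have "\<forall>\<^sub>F n in sequentially. cmod z < \<rho> n"
      using order_tendstoD(1)[OF \<rho>_lim] that by simp
    then show "\<forall>\<^sub>F n in sequentially. \<psi>' n z = \<psi> z"
      by eventually_elim (simp add: \<psi>'_def)
  qed
  have meas_sgn: "(\<lambda>z. sgn z ^ j) \<in> borel_measurable disk_measure"
    by (rule measurable_disk_measure_borel) measurable
  have sgn_L2: "(\<lambda>z. sgn z ^ j * u z) \<in> L2_disk" if "u \<in> L2_disk" for u
    using meas_sgn by (intro L2_disk_bounded_mult[OF that, of _ 1]) (auto simp: norm_power norm_sgn intro: power_le_one)
  have conv: "(\<lambda>n. LINT z|disk_measure. \<psi>' n z * w z) \<longlonglongrightarrow> (LINT z|disk_measure. \<psi> z * w z)" if w: "w \<in> L2_disk" for w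
  proof (rule integral_dominated_convergence)
    show "integrable disk_measure (\<lambda>z. cmod (\<psi> z * w z))"
      using L2_disk_mult_integrable[OF \<psi>(2) w] by simp
    show "AE z in disk_measure. (\<lambda>n. \<psi>' n z * w z) \<longlonglongrightarrow> \<psi> z * w z"
      by (intro AE_I2 tendsto_mult tendsto_const lim) simp
    show "AE z in disk_measure. norm (\<psi>' n z * w z) \<le> cmod (\<psi> z * w z)" for n
      by (simp add: \<psi>'_def norm_mult)
  qed (use L2_disk_measurable \<psi>(2) L2' w in \<open>auto intro!: borel_measurable_times\<close>)
  have w1: "(\<lambda>z. sgn z ^ j * cnj (v z)) \<in> L2_disk"
    by (intro sgn_L2 L2_disk_cnj bergman_spaceD v)
  have "(\<lambda>z. complex_of_real (cmod z ^ j)) \<in> borel_measurable disk_measure"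
    by (rule measurable_disk_measure_borel) measurable
  then have w2: "(\<lambda>z. complex_of_real (cmod z ^ j)) \<in> L2_disk"
    by (rule L2_disk_bounded[of _ 1]) (auto intro: power_le_one simp: norm_power)
  have "(LINT z|disk_measure. \<psi>' n z * (sgn z ^ j * cnj (v z))) = cnj (c j) * (LINT z|disk_measure. \<psi>' n z * of_real (cmod z ^ j))" for n
    using truncated_radial_inner[OF radial' L2' c \<rho>, of n n j] by (simp add: \<psi>'_def mult.assoc)
  with conv[OF w1] have "(\<lambda>n. cnj (c j) * (LINT z|disk_measure. \<psi>' n z * of_real (cmod z ^ j))) \<longlonglongrightarrow> (LINT z|disk_measure. \<psi> z * (sgn z ^ j * cnj (v z)))"
    by simp
  moreover have "(\<lambda>n. cnj (c j) * (LINT z|disk_measure. \<psi>' n z * of_real (cmod z ^ j))) \<longlonglongrightarrow> cnj (c j) * 0"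
    using conv[OF w2] zero by (intro tendsto_mult tendsto_const) simp
  ultimately show ?thesis
    using LIMSEQ_unique by (fastforce simp: mult.assoc)
qed

section \<open>Toeplitz operators with quasihomogeneous symbols\<close>

lemma cis_Arg_power: "cis (of_int (int q) * Arg z) = (if z = 0 then 1 else sgn z ^ q)"
proof (cases "z = 0")
  case False
  then have "cis (of_int (int q) * Arg z) = cis (Arg z) ^ q"
    by (simp add: Complex.DeMoivre)
  with False show ?thesis by (simp add: cis_Arg)
qed (simp add: Arg_zero)

lemma power_le_one_disk: "z \<in> unit_disk \<Longrightarrow> cmod z ^ n \<le> 1"
  by (intro power_le_one) auto

lemma L2_disk_mult_cmod_power:
  assumes "\<phi> \<in> L2_disk"
  shows "(\<lambda>z. \<phi> z * of_real (cmod z ^ n)) \<in> L2_disk"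
proof -
  have "(\<lambda>z. complex_of_real (cmod z ^ n)) \<in> borel_measurable disk_measure"
    by (rule measurable_disk_measure_borel) measurable
  from L2_disk_bounded_mult[OF assms this, of 1] show ?thesis
    using power_le_one_disk by (simp add: mult.commute norm_power)
qed

lemma cmod_power_L2: "(\<lambda>z. of_real (cmod z ^ n)) \<in> L2_disk"
  using L2_disk_mult_cmod_power[OF L2_disk_1, of n] by simp

lemma cmod_power_radial: "radial (\<lambda>z. of_real (cmod z ^ n))"
  by (simp add: radial_def)

lemma radial_power_eq: "radial_power n = (\<lambda>z. of_real (cmod z ^ n))"
  by (simp add: radial_power_def)

definition moment :: "(complex \<Rightarrow> complex) \<Rightarrow> nat \<Rightarrow> complex"
  where "moment \<phi> n = (LINT z|disk_measure. \<phi> z * of_real (cmod z ^ n))"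

lemma moment_radial_power: "moment (radial_power n) k = 2 / of_nat (n + k + 2)"
proof -
  have "moment (radial_power n) k = (LINT z|disk_measure. complex_of_real (cmod z ^ (n + k)))"
    by (simp add: moment_def radial_power_def power_add)
  also have "\<dots> = complex_of_real (2 / (real (n + k) + 2))"
    by (simp only: integral_complex_of_real integral_disk_measure_power)
  finally show ?thesis by simp
qed

text \<open>The factor \<open>k + q + 1\<close> is the inverse of the squared norm of
  \<open>monomial (k + q)\<close>; the index \<open>2 * k + q\<close> combines the modulus of the
  argument \<open>z ^ k\<close> with that of the image \<open>z ^ (k + q)\<close>.\<close>

definition toeplitz_weight :: "(complex \<Rightarrow> complex) \<Rightarrow> nat \<Rightarrow> nat \<Rightarrow> complex"
  where "toeplitz_weight \<phi> q k = of_nat (k + q + 1) * moment \<phi> (2 * k + q)"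

lemma quasihom_L2:
  assumes "\<phi> \<in> L2_disk"
  shows "quasihom (int q) \<phi> \<in> L2_disk"
proof -
  have "(\<lambda>z. if z = 0 then 1 else sgn z ^ q :: complex) \<in> borel_measurable disk_measure"
    by (rule measurable_disk_measure_borel) measurable
  then have "(\<lambda>z. cis (of_int (int q) * Arg z)) \<in> borel_measurable disk_measure"
    by (simp only: cis_Arg_power)
  from L2_disk_bounded_mult[OF assms this, of 1] show ?thesis
    by (simp add: quasihom_def[abs_def])
qed

lemma quasihom_monomial_L2:
  assumes "\<phi> \<in> L2_disk"
  shows "(\<lambda>z. quasihom (int q) \<phi> z * monomial k z) \<in> L2_disk"
  using L2_disk_bounded_mult[OF quasihom_L2[OF assms, of q] monomial_measurable[of k], of 1]
  by (simp add: monomial_def norm_power power_le_one mult.commute)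

text \<open>Apart from the angular factor \<open>sgn z ^ (k + q)\<close> the difference is a radial
  function \<open>\<psi>\<close>, and the weight is chosen so that its moment of index
  \<open>k + q\<close> vanishes. Then \<open>radial_inner_zero\<close> applies to every
  \<open>v\<close>.\<close>

lemma quasihom_monomial_inner:
  assumes \<phi>: "radial \<phi>" "\<phi> \<in> L2_disk" and v: "v \<in> bergman_space"
  shows "inner_disk (\<lambda>z. quasihom (int q) \<phi> z * monomial k z - toeplitz_weight \<phi> q k * monomial (k + q) z) v = 0"
proof -
  define c where "c = toeplitz_weight \<phi> q k"
  define \<psi> where "\<psi> z = \<phi> z * of_real (cmod z ^ k) - c * of_real (cmod z ^ (k + q))" for z
  have "radial \<psi>"
    unfolding radial_def
  proof (intro ballI impI)
    fix z w assume "z \<in> unit_disk" "w \<in> unit_disk" and eq: "cmod z = cmod w"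
    from radialD[OF \<phi>(1) this] show "\<psi> z = \<psi> w"
      by (simp only: \<psi>_def eq)
  qed
  moreover have \<psi>_L2: "\<psi> \<in> L2_disk"
    unfolding \<psi>_def[abs_def] by (intro L2_disk_diff L2_disk_mult_cmod_power L2_disk_cmult cmod_power_L2 \<phi>)
  moreover have "(LINT z|disk_measure. \<psi> z * of_real (cmod z ^ (k + q))) = 0"
  proof -
    have "(LINT z|disk_measure. \<psi> z * of_real (cmod z ^ (k + q))) =
      (LINT z|disk_measure. \<phi> z * of_real (cmod z ^ (2 * k + q)) - c * (radial_power (k + q) z * of_real (cmod z ^ (k + q))))"
      by (intro Bochner_Integration.integral_cong refl)
         (simp add: \<psi>_def radial_power_def algebra_simps power_add mult_2 mult_2_right)
    also have "\<dots> = moment \<phi> (2 * k + q) - c * moment (radial_power (k + q)) (k + q)"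
    proof -
      have 1: "integrable disk_measure (\<lambda>z. \<phi> z * of_real (cmod z ^ (2 * k + q)))"
        by (intro L2_disk_integrable L2_disk_mult_cmod_power \<phi>)
      have "radial_power (k + q) \<in> L2_disk"
        by (simp only: radial_power_eq cmod_power_L2)
      then have 2: "integrable disk_measure (\<lambda>z. c * (radial_power (k + q) z * of_real (cmod z ^ (k + q))))"
        by (intro L2_disk_integrable L2_disk_cmult L2_disk_mult_cmod_power)
      show ?thesis
        unfolding moment_def Bochner_Integration.integral_diff[OF 1 2] by simp
    qed
    also have "\<dots> = 0"
    proof -
      have "of_nat (k + q + (k + q) + 2) = (2 * of_nat (k + q + 1) :: complex)" by simp
      moreover have "of_nat (k + q + 1) \<noteq> (0 :: complex)" by (simp del: of_nat_Suc)
      moreover have "x - N * x * (2 / (2 * N)) = 0" if "N \<noteq> 0" for x N :: complex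
        using that by simp
      ultimately show ?thesis
        unfolding moment_radial_power c_def toeplitz_weight_def by presburger
    qed
    finally show ?thesis .
  qed
  ultimately have inner_zero: "(LINT z|disk_measure. \<psi> z * sgn z ^ (k + q) * cnj (v z)) = 0"
    by (intro radial_inner_zero v)
  \<comment> \<open>At the origin \<open>cis (of_int (int q) * Arg z)\<close> is one whereas
    \<open>sgn z\<close> is zero, hence only almost everywhere.\<close>
  have ae: "AE z in disk_measure. (quasihom (int q) \<phi> z * monomial k z - c * monomial (k + q) z) * cnj (v z) = \<psi> z * sgn z ^ (k + q) * cnj (v z)"
    using AE_disk_nonzero AE_space
  proof eventually_elim
    case (elim z)
    then have "quasihom (int q) \<phi> z = sgn z ^ q * \<phi> z" "monomial k z = of_real (cmod z ^ k) * sgn z ^ k"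
      "monomial (k + q) z = of_real (cmod z ^ (k + q)) * sgn z ^ (k + q)"
      using power_sgn[of z k] power_sgn[of z "k + q"]
      unfolding quasihom_def cis_Arg_power by (simp_all add: monomial_def)
    then show ?case
      by (simp add: \<psi>_def power_add algebra_simps)
  qed
  have meas1: "(\<lambda>z. (quasihom (int q) \<phi> z * monomial k z - c * monomial (k + q) z) * cnj (v z)) \<in> borel_measurable disk_measure"
    by (intro borel_measurable_times L2_disk_measurable L2_disk_diff quasihom_monomial_L2 L2_disk_cmult L2_disk_cnj
        bergman_spaceD monomial_in_bergman v \<phi>)
  have meas2: "(\<lambda>z. \<psi> z * sgn z ^ (k + q) * cnj (v z)) \<in> borel_measurable disk_measure"
  proof -
    have "(\<lambda>z. sgn z ^ (k + q) :: complex) \<in> borel_measurable disk_measure"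
      by (rule measurable_disk_measure_borel) measurable
    moreover have "(\<lambda>z. cnj (v z)) \<in> borel_measurable disk_measure"
      by (intro L2_disk_measurable L2_disk_cnj bergman_spaceD v)
    ultimately show ?thesis
      using L2_disk_measurable[OF \<psi>_L2] by (intro borel_measurable_times)
  qed
  show ?thesis
    unfolding inner_disk_def c_def[symmetric] integral_cong_AE[OF meas1 meas2 ae] by (rule inner_zero)
qed

text \<open>Two terms, because a sum of two such operators sends a monomial to a combination of two
  monomials, to which the other factor of a product is then applied.\<close>

lemma toeplitz_lincomb:
  assumes \<phi>: "radial \<phi>" "\<phi> \<in> L2_disk"
  shows "toeplitz (quasihom (int q) \<phi>) (\<lambda>z. x * monomial i z + y * monomial j z) =
    (\<lambda>z. x * toeplitz_weight \<phi> q i * monomial (i + q) z + y * toeplitz_weight \<phi> q j * monomial (j + q) z)"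
proof -
  define u where "u z = quasihom (int q) \<phi> z * (x * monomial i z + y * monomial j z)" for z
  define h where "h z = x * toeplitz_weight \<phi> q i * monomial (i + q) z + y * toeplitz_weight \<phi> q j * monomial (j + q) z" for z
  have u_eq: "u z = x * (quasihom (int q) \<phi> z * monomial i z) + y * (quasihom (int q) \<phi> z * monomial j z)" for z
    by (simp add: u_def algebra_simps)
  have u: "u \<in> L2_disk"
    unfolding u_eq[abs_def] by (intro L2_disk_add L2_disk_cmult quasihom_monomial_L2 \<phi>)
  have "(\<lambda>z. x * monomial i z + y * monomial j z) \<in> bergman_space"
    by (intro bergman_space_lincomb monomial_in_bergman)
  with u have dom: "(\<lambda>z. x * monomial i z + y * monomial j z) \<in> toeplitz_domain (quasihom (int q) \<phi>)"
    by (simp add: toeplitz_domain_def u_def[abs_def])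
  have "bergman_proj u = h"
  proof (rule bergman_proj_eqI[OF u])
    show "h \<in> bergman_space"
      unfolding h_def[abs_def] by (intro bergman_space_lincomb monomial_in_bergman)
    fix v assume v: "v \<in> bergman_space"
    define e where "e k z = quasihom (int q) \<phi> z * monomial k z - toeplitz_weight \<phi> q k * monomial (k + q) z" for k z
    have e: "e k \<in> L2_disk" for k
      unfolding e_def[abs_def]
      by (intro L2_disk_diff quasihom_monomial_L2 L2_disk_cmult bergman_spaceD monomial_in_bergman \<phi>)
    have int: "integrable disk_measure (\<lambda>z. e k z * cnj (v z))" for k
      by (intro L2_disk_mult_integrable e L2_disk_cnj bergman_spaceD v)
    have "inner_disk (\<lambda>z. u z - h z) v = (LINT z|disk_measure. x * (e i z * cnj (v z)) + y * (e j z * cnj (v z)))"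
      unfolding inner_disk_def by (intro Bochner_Integration.integral_cong refl) (simp add: u_eq h_def e_def algebra_simps)
    also have "\<dots> = x * (LINT z|disk_measure. e i z * cnj (v z)) + y * (LINT z|disk_measure. e j z * cnj (v z))"
      using int by (subst Bochner_Integration.integral_add) auto
    also have "\<dots> = 0"
      using quasihom_monomial_inner[OF \<phi> v, of q] by (simp add: inner_disk_def e_def)
    finally show "inner_disk (\<lambda>z. u z - h z) v = 0" .
  qed
  then show ?thesis
    using dom by (simp add: toeplitz_def u_def[abs_def] h_def[abs_def])
qed

lemma toeplitz_monomial:
  assumes "radial \<phi>" "\<phi> \<in> L2_disk"
  shows "toeplitz (quasihom (int q) \<phi>) (monomial k) = (\<lambda>z. toeplitz_weight \<phi> q k * monomial (k + q) z)"
  using toeplitz_lincomb[OF assms, of q 1 k 0 k] by simp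

section \<open>Uniqueness of radial functions with given moments\<close>

inductive zpoly :: "(complex \<Rightarrow> complex) \<Rightarrow> bool" where
  zpoly_monomial: "zpoly (\<lambda>z. c * z ^ i * cnj z ^ j)"
| zpoly_add: "zpoly f \<Longrightarrow> zpoly g \<Longrightarrow> zpoly (\<lambda>z. f z + g z)"

lemma zpoly_mult_monomial:
  assumes "zpoly f"
  shows "zpoly (\<lambda>z. f z * (c * z ^ i * cnj z ^ j))"
  using assms
proof induction
  case (zpoly_monomial d k l)
  have "(\<lambda>z. d * z ^ k * cnj z ^ l * (c * z ^ i * cnj z ^ j)) = (\<lambda>z. (d * c) * z ^ (k + i) * cnj z ^ (l + j))"
    by (simp add: fun_eq_iff power_add mult_ac)
  then show ?case by (simp add: zpoly.zpoly_monomial)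
next
  case (zpoly_add f g)
  from zpoly.zpoly_add[OF zpoly_add.IH] show ?case
    by (simp only: distrib_right)
qed

lemma zpoly_mult:
  assumes "zpoly f" "zpoly g"
  shows "zpoly (\<lambda>z. f z * g z)"
  using assms(2)
proof induction
  case (zpoly_monomial c i j)
  show ?case by (rule zpoly_mult_monomial[OF assms(1)])
next
  case (zpoly_add g h)
  from zpoly.zpoly_add[OF zpoly_add.IH] show ?case
    by (simp only: distrib_left)
qed

text \<open>Stone-Weierstrass delivers polynomials in the real coordinates. Written in
  \<open>z\<close> and \<open>cnj z\<close>, their monomials split into a radial and an angular
  part.\<close>

lemma real_polynomial_function_zpoly:
  fixes P :: "complex \<Rightarrow> real"
  assumes "real_polynomial_function P"
  shows "zpoly (\<lambda>z. of_real (P z))"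
  using assms
proof induction
  case (linear f)
  interpret bounded_linear f by (rule linear)
  define x where "x = complex_of_real (f 1)"
  define y where "y = complex_of_real (f \<i>)"
  have "of_real (f z) = (x - \<i> * y) / 2 * z ^ 1 * cnj z ^ 0 + (x + \<i> * y) / 2 * z ^ 0 * cnj z ^ 1" for z
  proof -
    have "z = Re z *\<^sub>R 1 + Im z *\<^sub>R \<i>" by (simp add: complex_eq_iff)
    then have "f z = Re z * f 1 + Im z * f \<i>"
      by (metis add scaleR real_scaleR_def)
    then show ?thesis
      by (simp add: x_def y_def complex_eq_iff field_simps)
  qed
  then show ?case
    by (simp only: zpoly.intros)
next
  case (const c)
  show ?case using zpoly_monomial[of "of_real c" 0 0] by simp
next
  case (add f g)
  then show ?case using zpoly_add by simp
next
  case (mult f g)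
  then show ?case using zpoly_mult by simp
qed

lemma norm_integral_le_uniform:
  assumes f: "integrable disk_measure f" and w: "w \<in> borel_measurable disk_measure"
    and e: "\<And>z. z \<in> unit_disk \<Longrightarrow> cmod (w z) \<le> e"
  shows "integrable disk_measure (\<lambda>z. f z * w z)"
    and "cmod (LINT z|disk_measure. f z * w z) \<le> e * (LINT z|disk_measure. cmod (f z))"
proof -
  have bound: "cmod (f z * w z) \<le> e * cmod (f z)" if "z \<in> unit_disk" for z
    using mult_left_mono[OF e[OF that], of "cmod (f z)"] by (simp add: norm_mult mult.commute)
  have int: "integrable disk_measure (\<lambda>z. e * cmod (f z))" using f by simp
  show fw: "integrable disk_measure (\<lambda>z. f z * w z)"
  proof (rule Bochner_Integration.integrable_bound[OF int])
    show "(\<lambda>z. f z * w z) \<in> borel_measurable disk_measure"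
      using f w by (intro borel_measurable_times) auto
    show "AE z in disk_measure. norm (f z * w z) \<le> norm (e * cmod (f z))"
      using bound by (intro AE_I2) (simp, meson abs_ge_self order_trans)
  qed
  have "cmod (LINT z|disk_measure. f z * w z) \<le> (LINT z|disk_measure. e * cmod (f z))"
    by (rule Bochner_Integration.integral_norm_bound_integral[OF fw int]) (use bound in simp)
  then show "cmod (LINT z|disk_measure. f z * w z) \<le> e * (LINT z|disk_measure. cmod (f z))" by simp
qed

lemma integral_zero_uniform_limit:
  assumes f: "integrable disk_measure f" and w: "w \<in> borel_measurable disk_measure"
    and approx: "\<And>e::real. e > 0 \<Longrightarrow> \<exists>u. u \<in> borel_measurable disk_measure \<and> (\<forall>z\<in>unit_disk. cmod (w z - u z) \<le> e)
      \<and> integrable disk_measure (\<lambda>z. f z * u z) \<and> (LINT z|disk_measure. f z * u z) = 0"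
  shows "(LINT z|disk_measure. f z * w z) = 0"
proof -
  define K where "K = (LINT z|disk_measure. cmod (f z))"
  have K: "K \<ge> 0" by (simp add: K_def)
  have "cmod (LINT z|disk_measure. f z * w z) \<le> e * K" if "e > 0" for e
  proof -
    from approx[OF that] obtain u where u: "u \<in> borel_measurable disk_measure" "\<And>z. z \<in> unit_disk \<Longrightarrow> cmod (w z - u z) \<le> e"
      "integrable disk_measure (\<lambda>z. f z * u z)" "(LINT z|disk_measure. f z * u z) = 0" by blast
    have wu: "(\<lambda>z. w z - u z) \<in> borel_measurable disk_measure"
      using w u(1) by (rule borel_measurable_diff)
    note bound = norm_integral_le_uniform[OF f wu u(2)]
    have "f z * w z = f z * (w z - u z) + f z * u z" for z by (simp add: algebra_simps)
    then have "(LINT z|disk_measure. f z * w z) = (LINT z|disk_measure. f z * (w z - u z)) + (LINT z|disk_measure. f z * u z)"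
      using Bochner_Integration.integral_add[OF bound(1) u(3)] by (simp only:)
    then show ?thesis
      using bound(2) u(4) by (simp add: K_def)
  qed
  note small = this
  have "cmod (LINT z|disk_measure. f z * w z) \<le> 0 + e" if "e > 0" for e
  proof -
    have "cmod (LINT z|disk_measure. f z * w z) \<le> e / (K + 1) * K"
      using K that by (intro small) auto
    also have "\<dots> \<le> e" using K that by (simp add: field_simps)
    finally show ?thesis by simp
  qed
  then have "cmod (LINT z|disk_measure. f z * w z) \<le> 0"
    by (rule field_le_epsilon)
  then show ?thesis by simp
qed

text \<open>The ideal test function is \<open>cnj (sgn (f z))\<close>, which turns the integral into
  that of \<open>cmod (f z)\<close>. Being merely measurable, it is approached almost everywhere by
  continuous functions.\<close>

lemma integral_zero_imp_AE_zero:
  assumes f: "integrable disk_measure f"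
    and zero: "\<And>g. continuous_on UNIV g \<Longrightarrow> (\<And>z. cmod (g z) \<le> 1) \<Longrightarrow> (LINT z|disk_measure. f z * g z) = 0"
  shows "AE z in disk_measure. f z = 0"
proof -
  define s where "s z = cnj (sgn (f z))" for z
  have meas: "f \<in> borel_measurable disk_measure" using f by auto
  have s_meas: "s \<in> borel_measurable disk_measure"
    unfolding s_def[abs_def] by (intro measurable_compose[OF _ measurable_cnj] measurable_compose[OF meas borel_measurable_sgn])
  then have "s measurable_on unit_disk"
    by (subst measurable_on_iff_borel_measurable) (auto simp: borel_measurable_disk_measure borel_open)
  then obtain N g where N: "negligible N" and g: "\<And>n::nat. continuous_on UNIV (g n)"
    "\<And>z. z \<notin> N \<Longrightarrow> (\<lambda>n. g n z) \<longlonglongrightarrow> (if z \<in> unit_disk then s z else 0)"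
    unfolding measurable_on_def by blast
  \<comment> \<open>Scaling to modulus at most one provides a dominating function and leaves the
    limit alone, whose modulus is at most one already.\<close>
  define h where "h n z = g n z / of_real (max 1 (cmod (g n z)))" for n z
  have h_cont: "continuous_on UNIV (h n)" for n
    unfolding h_def by (intro continuous_intros g) (auto simp: max_def)
  have h_le: "cmod (h n z) \<le> 1" for n z
    by (simp add: h_def norm_divide divide_le_eq max_def)
  have "AE z in disk_measure. z \<notin> N"
  proof (rule AE_I[where N = "N \<inter> unit_disk"])
    have N': "N \<inter> unit_disk \<in> null_sets lebesgue"
      using N by (meson negligible_Int negligible_iff_null_sets)
    then show sets: "N \<inter> unit_disk \<in> sets disk_measure"
      by (auto simp: sets_disk_measure)
    show "emeasure disk_measure (N \<inter> unit_disk) = 0"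
      using null_setsD1[OF N'] by (simp add: emeasure_disk_measure[OF sets])
  qed auto
  then have lim: "AE z in disk_measure. (\<lambda>n. f z * h n z) \<longlonglongrightarrow> of_real (cmod (f z))"
    using AE_space
  proof eventually_elim
    case (elim z)
    then have gs: "(\<lambda>n. g n z) \<longlonglongrightarrow> s z" using g(2)[of z] by simp
    have "cmod (s z) \<le> 1" by (simp add: s_def norm_sgn)
    then have m: "max 1 (cmod (s z)) = 1" by simp
    have "(\<lambda>n. f z * h n z) \<longlonglongrightarrow> f z * (s z / of_real (max 1 (cmod (s z))))"
      unfolding h_def by (intro tendsto_intros gs) (simp add: m)
    moreover have "f z * (s z / of_real (max 1 (cmod (s z)))) = of_real (cmod (f z))"
    proof -
      have "f z * cnj (sgn (f z)) = of_real (cmod (f z)) * (sgn (f z) * cnj (sgn (f z)))"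
        by (subst (1) cmod_mult_sgn[of "f z", symmetric]) (simp only: mult.assoc)
      also have "\<dots> = of_real (cmod (f z))"
        using sgn_power_cancel[of "f z" 1] by simp
      finally have "f z * s z = of_real (cmod (f z))" by (simp only: s_def)
      then show ?thesis by (simp add: m)
    qed
    ultimately show ?case by simp
  qed
  have conv: "(\<lambda>n. LINT z|disk_measure. f z * h n z) \<longlonglongrightarrow> (LINT z|disk_measure. complex_of_real (cmod (f z)))"
  proof (rule integral_dominated_convergence[OF _ _ _ lim])
    show "integrable disk_measure (\<lambda>z. cmod (f z))" using f by simp
    show "(\<lambda>z. complex_of_real (cmod (f z))) \<in> borel_measurable disk_measure"
      using meas by measurable
    show "(\<lambda>z. f z * h n z) \<in> borel_measurable disk_measure" for n
      by (intro borel_measurable_times meas measurable_disk_measure_borel borel_measurable_continuous_onI h_cont)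
    show "AE z in disk_measure. norm (f z * h n z) \<le> cmod (f z)" for n
      using h_le by (intro AE_I2) (simp add: norm_mult mult_left_le)
  qed
  have "(\<lambda>n. 0) \<longlonglongrightarrow> (LINT z|disk_measure. complex_of_real (cmod (f z)))"
    using conv by (simp only: zero[OF h_cont h_le])
  from LIMSEQ_unique[OF this tendsto_const]
  have "(LINT z|disk_measure. complex_of_real (cmod (f z))) = 0" .
  then have "(LINT z|disk_measure. cmod (f z)) = 0"
    by (metis integral_complex_of_real of_real_eq_0_iff)
  then have "AE z in disk_measure. cmod (f z) = 0"
    using f by (subst (asm) integral_nonneg_eq_0_iff_AE) auto
  then show ?thesis by simp
qed

lemma continuous_comp_cmod_measurable:
  assumes "continuous_on {0..1} (h :: real \<Rightarrow> real)"
  shows "(\<lambda>z. complex_of_real (h (cmod z))) \<in> borel_measurable disk_measure"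
proof (rule measurable_disk_measure_continuous_on)
  have "continuous_on unit_disk (h \<circ> cmod)"
    by (intro continuous_on_compose continuous_intros continuous_on_subset[OF assms]) auto
  then show "continuous_on unit_disk (\<lambda>z. complex_of_real (h (cmod z)))"
    by (intro continuous_intros) (simp add: o_def)
qed

text \<open>In the variable \<open>t = r ^ e\<close> the given exponents become all powers of
  \<open>t\<close> once \<open>r ^ a\<close> is moved into \<open>f\<close>, so Weierstrass
  approximation makes the integral of \<open>f\<close> against every continuous function of
  \<open>cmod z\<close> vanish. Angular orthogonality extends this to polynomials in
  \<open>z\<close> and \<open>cnj z\<close>, and Stone-Weierstrass to all continuous test
  functions.\<close>

lemma radial_zero_by_moments:
  assumes \<phi>: "radial \<phi>" "\<phi> \<in> L2_disk" and e: "e > 0"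
    and zero: "\<And>i. moment \<phi> (a + e * i) = 0"
  shows "AE z in disk_measure. \<phi> z = 0"
proof -
  define f where "f z = \<phi> z * of_real (cmod z ^ a)" for z
  have f_L2: "f \<in> L2_disk"
    unfolding f_def[abs_def] by (rule L2_disk_mult_cmod_power[OF \<phi>(2)])
  have f_radial: "radial f"
    unfolding f_def[abs_def] by (rule radial_mult_cmod[OF \<phi>(1), of "\<lambda>r. of_real (r ^ a)"])
  note f_int = L2_disk_integrable[OF f_L2]
  have radial_zero: "(LINT z|disk_measure. f z * of_real (h (cmod z))) = 0"
    if h: "continuous_on {0..1} (h :: real \<Rightarrow> real)" for h
  proof (rule integral_zero_uniform_limit[OF f_int continuous_comp_cmod_measurable[OF h]])
    fix \<epsilon> :: real assume "\<epsilon> > 0"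
    have "continuous_on {0..1} (h \<circ> root e)"
      using e by (intro continuous_on_compose continuous_on_subset[OF h] continuous_intros) (auto simp: real_root_le_1_iff)
    from Stone_Weierstrass_real_polynomial_function[OF compact_Icc this \<open>\<epsilon> > 0\<close>]
    obtain g where g: "real_polynomial_function g" "\<And>t. t \<in> {0..1} \<Longrightarrow> \<bar>(h \<circ> root e) t - g t\<bar> < \<epsilon>"
      by blast
    obtain c n where gc: "g = (\<lambda>t. \<Sum>i\<le>n. c i * t ^ i)"
      using g(1) unfolding real_polynomial_function_iff_sum by blast
    define u where "u z = complex_of_real (g (cmod z ^ e))" for z
    have "continuous_on {0..1} (\<lambda>r. g (r ^ e))"
      unfolding gc by (intro continuous_intros)
    from continuous_comp_cmod_measurable[OF this] have u1: "u \<in> borel_measurable disk_measure"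
      by (simp add: u_def[abs_def])
    have u2: "cmod (of_real (h (cmod z)) - u z) \<le> \<epsilon>" if "z \<in> unit_disk" for z
    proof -
      have "cmod z ^ e \<in> {0..1}" using power_le_one_disk[OF that] by simp
      from g(2)[OF this] have "\<bar>h (cmod z) - g (cmod z ^ e)\<bar> < \<epsilon>"
        using e by (simp add: real_root_power_cancel)
      then show ?thesis
        unfolding u_def of_real_diff[symmetric] norm_of_real by simp
    qed
    have fu: "f z * u z = (\<Sum>i\<le>n. of_real (c i) * (\<phi> z * of_real (cmod z ^ (a + e * i))))" for z
      by (simp add: f_def u_def gc sum_distrib_left power_add power_mult[symmetric] mult_ac)
    have int: "integrable disk_measure (\<lambda>z. of_real (c i) * (\<phi> z * of_real (cmod z ^ (a + e * i))))" for i
      by (intro L2_disk_integrable L2_disk_cmult L2_disk_mult_cmod_power \<phi>)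
    have "(LINT z|disk_measure. f z * u z) = (\<Sum>i\<le>n. of_real (c i) * moment \<phi> (a + e * i))"
      unfolding fu moment_def using int by (subst Bochner_Integration.integral_sum) auto
    then have u4: "(LINT z|disk_measure. f z * u z) = 0"
      by (simp add: zero)
    have u3: "integrable disk_measure (\<lambda>z. f z * u z)"
      unfolding fu by (intro Bochner_Integration.integrable_sum int)
    show "\<exists>u. u \<in> borel_measurable disk_measure \<and> (\<forall>z\<in>unit_disk. cmod (of_real (h (cmod z)) - u z) \<le> \<epsilon>)
      \<and> integrable disk_measure (\<lambda>z. f z * u z) \<and> (LINT z|disk_measure. f z * u z) = 0"
      using u1 u2 u3 u4 by blast
  qed
  have zpoly_zero: "integrable disk_measure (\<lambda>z. f z * w z) \<and> (LINT z|disk_measure. f z * w z) = 0" if "zpoly w" for w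
    using that
  proof induction
    case (zpoly_monomial c i j)
    have eq: "f z * (c * z ^ i * cnj z ^ j) = c * ((f z * of_real (cmod z ^ (i + j))) * sgn z ^ i * cnj (sgn z) ^ j)" for z
    proof -
      have "cnj z ^ j = of_real (cmod z ^ j) * cnj (sgn z) ^ j"
        using arg_cong[OF power_sgn[of z j], of cnj] by simp
      then show ?thesis
        using power_sgn[of z i] by (simp add: power_add mult_ac)
    qed
    have meas: "(\<lambda>z. f z * of_real (cmod z ^ (i + j))) \<in> borel_measurable disk_measure"
      by (intro L2_disk_measurable L2_disk_mult_cmod_power f_L2)
    have "(LINT z|disk_measure. (f z * of_real (cmod z ^ (i + j))) * sgn z ^ i * cnj (sgn z) ^ j) = 0"
    proof (cases "i = j")
      case True
      have "of_real (cmod z ^ (j + j)) * (sgn z ^ j * cnj (sgn z) ^ j) = complex_of_real (cmod z ^ (j + j))" for z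
        using sgn_power_cancel[of z j] by (simp add: power_add mult.assoc)
      then have "(f z * of_real (cmod z ^ (j + j))) * sgn z ^ j * cnj (sgn z) ^ j = f z * of_real (cmod z ^ (j + j))" for z
        by (simp only: mult.assoc)
      moreover have "continuous_on {0..1} (\<lambda>r::real. r ^ (j + j))"
        by (intro continuous_intros)
      ultimately show ?thesis
        unfolding True using radial_zero[of "\<lambda>r. r ^ (j + j)"] by (simp only:)
    next
      case False
      then show ?thesis
        by (intro integral_angular_zero radial_mult_cmod[OF f_radial, of "\<lambda>r. of_real (r ^ (i + j))"] meas)
    qed
    moreover have "integrable disk_measure (\<lambda>z. f z * (c * z ^ i * cnj z ^ j))"
    proof (rule norm_integral_le_uniform(1)[OF f_int])
      show "(\<lambda>z. c * z ^ i * cnj z ^ j) \<in> borel_measurable disk_measure"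
        by (intro measurable_disk_measure_continuous_on continuous_intros)
      show "cmod (c * z ^ i * cnj z ^ j) \<le> cmod c" if "z \<in> unit_disk" for z
        using power_le_one_disk[OF that, of i] power_le_one_disk[OF that, of j]
        by (simp add: norm_mult norm_power mult.assoc mult_le_one mult_left_le)
    qed
    ultimately show ?case
      by (simp only: eq integral_mult_right_zero mult_zero_right simp_thms)
  next
    case (zpoly_add w1 w2)
    then show ?case
      by (simp add: distrib_left)
  qed
  have continuous_zero: "(LINT z|disk_measure. f z * of_real (H z)) = 0" if H: "continuous_on UNIV (H :: complex \<Rightarrow> real)" for H
  proof (rule integral_zero_uniform_limit[OF f_int])
    show "(\<lambda>z. complex_of_real (H z)) \<in> borel_measurable disk_measure"
      by (intro measurable_disk_measure_borel borel_measurable_continuous_onI continuous_intros H)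
    fix \<epsilon> :: real assume "\<epsilon> > 0"
    from Stone_Weierstrass_real_polynomial_function[OF compact_cball[of 0 1] continuous_on_subset[OF H] this]
    obtain P where P: "real_polynomial_function P" "\<And>z. z \<in> cball 0 1 \<Longrightarrow> \<bar>H z - P z\<bar> < \<epsilon>"
      by auto
    have "(\<lambda>z. complex_of_real (P z)) \<in> borel_measurable disk_measure"
      by (intro measurable_disk_measure_borel borel_measurable_continuous_onI continuous_intros
          continuous_on_polymonial_function) (use P(1) real_polynomial_function_eq in blast)
    moreover have "cmod (of_real (H z) - of_real (P z)) \<le> \<epsilon>" if "z \<in> unit_disk" for z
      unfolding of_real_diff[symmetric] norm_of_real using P(2)[of z] that by simp
    ultimately show "\<exists>u. u \<in> borel_measurable disk_measure \<and> (\<forall>z\<in>unit_disk. cmod (of_real (H z) - u z) \<le> \<epsilon>)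
      \<and> integrable disk_measure (\<lambda>z. f z * u z) \<and> (LINT z|disk_measure. f z * u z) = 0"
      using zpoly_zero[OF real_polynomial_function_zpoly[OF P(1)]] by blast
  qed
  have "AE z in disk_measure. f z = 0"
  proof (rule integral_zero_imp_AE_zero[OF f_int])
    fix g :: "complex \<Rightarrow> complex" assume g: "continuous_on UNIV g" "\<And>z. cmod (g z) \<le> 1"
    have cont: "continuous_on UNIV (\<lambda>z. Re (g z))" "continuous_on UNIV (\<lambda>z. Im (g z))"
      by (intro continuous_intros g)+
    have int: "integrable disk_measure (\<lambda>z. f z * of_real (H z))" if "continuous_on UNIV H" "\<And>z. \<bar>H z\<bar> \<le> 1" for H :: "complex \<Rightarrow> real"
    proof (rule norm_integral_le_uniform(1)[OF f_int])
      show "(\<lambda>z. complex_of_real (H z)) \<in> borel_measurable disk_measure"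
        by (intro measurable_disk_measure_borel borel_measurable_continuous_onI continuous_intros that)
    qed (use that(2) in simp)
    have int2: "integrable disk_measure (\<lambda>z. f z * of_real (Re (g z)))" "integrable disk_measure (\<lambda>z. f z * of_real (Im (g z)))"
      using cont g(2) by (auto intro!: int intro: order_trans[OF abs_Re_le_cmod] order_trans[OF abs_Im_le_cmod])
    have int3: "integrable disk_measure (\<lambda>z. \<i> * (f z * of_real (Im (g z))))"
      using int2(2) by (rule integrable_mult_right)
    have "f z * g z = f z * of_real (Re (g z)) + \<i> * (f z * of_real (Im (g z)))" for z
      by (subst complex_eq[of "g z"]) (simp add: algebra_simps)
    then have "(LINT z|disk_measure. f z * g z) = (LINT z|disk_measure. f z * of_real (Re (g z)) + \<i> * (f z * of_real (Im (g z))))"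
      by (rule Bochner_Integration.integral_cong[OF refl])
    also have "\<dots> = (LINT z|disk_measure. f z * of_real (Re (g z))) + \<i> * (LINT z|disk_measure. f z * of_real (Im (g z)))"
      unfolding Bochner_Integration.integral_add[OF int2(1) int3] by simp
    finally show "(LINT z|disk_measure. f z * g z) = 0"
      by (simp add: continuous_zero cont)
  qed
  with AE_disk_nonzero show ?thesis
    by eventually_elim (simp add: f_def)
qed

section \<open>Commuting Toeplitz operators\<close>

lemma three_powers_zero:
  fixes x1 x2 x3 :: complex
  assumes N: "N1 < N2" "N2 < N3"
    and zero: "\<And>z. z \<in> unit_disk \<Longrightarrow> x1 * z ^ N1 + x2 * z ^ N2 + x3 * z ^ N3 = 0"
  shows "x1 = 0" "x2 = 0" "x3 = 0"
proof -
  define P where "P = monom x1 N1 + monom x2 N2 + monom x3 N3"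
  have "P = 0"
  proof (rule ccontr)
    assume "P \<noteq> 0"
    then have "finite {z. poly P z = 0}" by (rule poly_roots_finite)
    moreover have "unit_disk \<subseteq> {z. poly P z = 0}"
      using zero by (auto simp: P_def poly_monom)
    ultimately have "finite unit_disk" by (rule rev_finite_subset)
    then show False
      using uncountable_ball[of 1 "0 :: complex"] countable_finite by auto
  qed
  then have "coeff P N = 0" for N by simp
  from this[of N1] this[of N2] this[of N3] show "x1 = 0" "x2 = 0" "x3 = 0"
    using N by (auto simp: P_def)
qed

lemma toeplitz_weight_radial_power:
  "toeplitz_weight (radial_power n) q k =
    of_real ((real k + 1 + real q) / (real k + 1 + (real q + real n) / 2))"
proof -
  have "toeplitz_weight (radial_power n) q k = of_real ((real k + 1 + real q) * (2 / (real n + (2 * real k + real q) + 2)))"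
    by (simp add: toeplitz_weight_def moment_radial_power add_ac)
  also have "(real k + 1 + real q) * (2 / (real n + (2 * real k + real q) + 2)) = (real k + 1 + real q) / (real k + 1 + (real q + real n) / 2)"
  proof -
    have "real n + (2 * real k + real q) + 2 = 2 * (real k + 1 + (real q + real n) / 2)" by simp
    moreover have "x * (2 / (2 * y)) = x / y" for x y :: real by simp
    ultimately show ?thesis by (simp only:)
  qed
  finally show ?thesis .
qed

lemma radial_power_radial: "radial (radial_power n)"
  unfolding radial_power_eq by (rule cmod_power_radial)

lemma radial_power_L2: "radial_power n \<in> L2_disk"
  unfolding radial_power_eq by (rule cmod_power_L2)

lemma sum_toeplitz_monomial:
  assumes "radial f" "f \<in> L2_disk" "radial g" "g \<in> L2_disk"
  shows "(toeplitz (quasihom (int m) f) \<oplus>\<^sub>T toeplitz (quasihom (int l) g)) (monomial k) =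
    (\<lambda>z. toeplitz_weight f m k * monomial (k + m) z + toeplitz_weight g l k * monomial (k + l) z)"
  by (simp add: op_add_def toeplitz_monomial assms)

lemma sum_toeplitz_lincomb:
  assumes "radial f" "f \<in> L2_disk" "radial g" "g \<in> L2_disk"
  shows "(toeplitz (quasihom (int m) f) \<oplus>\<^sub>T toeplitz (quasihom (int l) g)) (\<lambda>z. x * monomial i z + y * monomial j z) =
    (\<lambda>z. x * toeplitz_weight f m i * monomial (i + m) z + y * toeplitz_weight f m j * monomial (j + m) z
      + (x * toeplitz_weight g l i * monomial (i + l) z + y * toeplitz_weight g l j * monomial (j + l) z))"
  by (simp add: op_add_def toeplitz_lincomb assms)

text \<open>The images of \<open>monomial k\<close> contain the powers \<open>k + p + m\<close>,
  \<open>k + p + l\<close>, \<open>k + s + m\<close> and \<open>k + s + l\<close>. The hypothesis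
  \<open>l + p = m + s\<close> merges the middle two, which is why one relation mixes the weights of
  \<open>f\<close> and \<open>g\<close>.\<close>

lemma commuting_sums_weights:
  assumes fg: "radial f" "f \<in> L2_disk" "radial g" "g \<in> L2_disk" and uv: "radial u" "u \<in> L2_disk" "radial v" "v \<in> L2_disk"
    and deg: "p < s" "m < l" "l + p = m + s"
    and comm: "op_commute (toeplitz (quasihom (int m) f) \<oplus>\<^sub>T toeplitz (quasihom (int l) g))
      (toeplitz (quasihom (int p) u) \<oplus>\<^sub>T toeplitz (quasihom (int s) v))"
  shows "toeplitz_weight u p k * toeplitz_weight f m (k + p) = toeplitz_weight u p (k + m) * toeplitz_weight f m k"
    and "toeplitz_weight u p k * toeplitz_weight g l (k + p) + toeplitz_weight v s k * toeplitz_weight f m (k + s)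
      = toeplitz_weight f m k * toeplitz_weight v s (k + m) + toeplitz_weight g l k * toeplitz_weight u p (k + l)"
    and "toeplitz_weight v s k * toeplitz_weight g l (k + s) = toeplitz_weight v s (k + l) * toeplitz_weight g l k"
proof -
  let ?a = "toeplitz_weight f m" and ?b = "toeplitz_weight g l"
  let ?\<alpha> = "toeplitz_weight u p" and ?\<beta> = "toeplitz_weight v s"
  define x1 where "x1 = ?\<alpha> k * ?a (k + p) - ?\<alpha> (k + m) * ?a k"
  define x2 where "x2 = ?\<alpha> k * ?b (k + p) + ?\<beta> k * ?a (k + s) - (?a k * ?\<beta> (k + m) + ?b k * ?\<alpha> (k + l))"
  define x3 where "x3 = ?\<beta> k * ?b (k + s) - ?\<beta> (k + l) * ?b k"
  have idx: "k + s + m = k + p + l" "k + l + p = k + p + l" "k + m + s = k + p + l" "k + m + p = k + p + m" "k + l + s = k + s + l"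
    using deg(3) by simp_all
  have "x1 * z ^ (k + p + m) + x2 * z ^ (k + p + l) + x3 * z ^ (k + s + l) = 0" if "z \<in> unit_disk" for z
  proof -
    have mono: "monomial i z = z ^ i" for i using that by (simp add: monomial_def)
    have "?\<alpha> k * ?a (k + p) * monomial (k + p + m) z + ?\<beta> k * ?a (k + s) * monomial (k + s + m) z
      + (?\<alpha> k * ?b (k + p) * monomial (k + p + l) z + ?\<beta> k * ?b (k + s) * monomial (k + s + l) z)
      = ?a k * ?\<alpha> (k + m) * monomial (k + m + p) z + ?b k * ?\<alpha> (k + l) * monomial (k + l + p) z
      + (?a k * ?\<beta> (k + m) * monomial (k + m + s) z + ?b k * ?\<beta> (k + l) * monomial (k + l + s) z)"
      using comm[unfolded op_commute_def, rule_format, of k]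
      unfolding sum_toeplitz_monomial[OF fg] sum_toeplitz_monomial[OF uv] sum_toeplitz_lincomb[OF fg] sum_toeplitz_lincomb[OF uv]
      by (rule fun_cong)
    then show ?thesis
      unfolding idx mono x1_def x2_def x3_def by (simp add: algebra_simps)
  qed
  from three_powers_zero[OF _ _ this] deg have "x1 = 0" "x2 = 0" "x3 = 0" by auto
  then show "?\<alpha> k * ?a (k + p) = ?\<alpha> (k + m) * ?a k"
    "?\<alpha> k * ?b (k + p) + ?\<beta> k * ?a (k + s) = ?a k * ?\<beta> (k + m) + ?b k * ?\<alpha> (k + l)"
    "?\<beta> k * ?b (k + s) = ?\<beta> (k + l) * ?b k"
    by (simp_all add: x1_def x2_def x3_def)
qed

text \<open>Uniqueness applied to \<open>f - c * radial_power n\<close> shows that this difference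
  vanishes almost everywhere. The moment of index zero is a common quantity by which the constants
  of different progressions can be compared.\<close>

lemma proportional_moments:
  assumes f: "radial f" "f \<in> L2_disk" and e: "e > 0"
    and "\<And>i. moment f (a + e * i) = c * moment (radial_power n) (a + e * i)"
  shows "moment f 0 = c * moment (radial_power n) 0"
proof -
  define h where "h z = f z - c * radial_power n z" for z
  have L2: "h \<in> L2_disk"
    unfolding h_def[abs_def] by (intro L2_disk_diff L2_disk_cmult f radial_power_L2)
  have "radial h"
    unfolding radial_def
  proof (intro ballI impI)
    fix z w assume zw: "z \<in> unit_disk" "w \<in> unit_disk" "cmod z = cmod w"
    from radialD[OF f(1) zw] radialD[OF radial_power_radial zw] show "h z = h w"
      by (simp only: h_def)
  qed
  have moment_h: "moment h j = moment f j - c * moment (radial_power n) j" for j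
  proof -
    have 1: "integrable disk_measure (\<lambda>z. f z * of_real (cmod z ^ j))"
      by (intro L2_disk_integrable L2_disk_mult_cmod_power f)
    have 2: "integrable disk_measure (\<lambda>z. c * (radial_power n z * of_real (cmod z ^ j)))"
      by (intro L2_disk_integrable L2_disk_cmult L2_disk_mult_cmod_power radial_power_L2)
    have "moment h j = (LINT z|disk_measure. f z * of_real (cmod z ^ j) - c * (radial_power n z * of_real (cmod z ^ j)))"
      unfolding moment_def by (intro Bochner_Integration.integral_cong refl) (simp add: h_def algebra_simps)
    then show ?thesis
      unfolding moment_def Bochner_Integration.integral_diff[OF 1 2] by simp
  qed
  have "AE z in disk_measure. h z = 0"
    by (rule radial_zero_by_moments[OF \<open>radial h\<close> L2 e, of a]) (simp add: moment_h assms(4))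
  then have "AE z in disk_measure. h z * of_real (cmod z ^ 0) = 0"
    by eventually_elim simp
  then have "moment h 0 = 0"
    unfolding moment_def by (rule integral_eq_zero_AE)
  then show ?thesis by (simp add: moment_h)
qed

theorem theorem4:
  fixes p s m l n d :: nat
    and f g :: "complex \<Rightarrow> complex"
  assumes "1 \<le> p" "p < s"
    and "1 \<le> m" "m < l"
    and "l + p = m + s"
    and "1 \<le> n" "1 \<le> d"
    and "radial f" "f \<in> L2_disk" "nontrivial f"
    and "radial g" "g \<in> L2_disk" "nontrivial g"
    and "\<not> op_commute (toeplitz (quasihom (int p) (radial_power n)))
                      (toeplitz (quasihom (int s) (radial_power d)))"
    and "op_commute
           (toeplitz (quasihom (int m) f) \<oplus>\<^sub>T toeplitz (quasihom (int l) g))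
           (toeplitz (quasihom (int p) (radial_power n)) \<oplus>\<^sub>T
            toeplitz (quasihom (int s) (radial_power d)))"
  shows "m = p \<and> l = s \<and>
    (\<exists>c :: complex.
       toeplitz (quasihom (int m) f) \<oplus>\<^sub>T toeplitz (quasihom (int s) g) =\<^sub>T
       c \<cdot>\<^sub>T (toeplitz (quasihom (int p) (radial_power n)) \<oplus>\<^sub>T
            toeplitz (quasihom (int s) (radial_power d))))"
  proof -
  define q where "q = (real p + real n) / 2"
  define r where "r = (real s + real d) / 2"
  define a where "a = toeplitz_weight f m"
  define b where "b = toeplitz_weight g l"
  note f = assms(8,9) and g = assms(11,12)
  note u = radial_power_radial[of n] radial_power_L2[of n] and v = radial_power_radial[of d] radial_power_L2[of d]
  interpret commuting_weights p s m l q r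
    using assms by unfold_locales (auto simp: q_def r_def)
  have \<alpha>: "toeplitz_weight (radial_power n) p k = of_real (\<alpha> k)" for k
    unfolding toeplitz_weight_radial_power \<alpha>_def by (simp only: q_def)
  have \<beta>: "toeplitz_weight (radial_power d) s k = of_real (\<beta> k)" for k
    unfolding toeplitz_weight_radial_power \<beta>_def by (simp only: r_def)
  note weights = commuting_sums_weights[OF f g u v assms(2,4,5,15)]
  interpret commuting_weights_solution p s m l q r a b
    by unfold_locales (use weights in \<open>simp_all only: a_def b_def \<alpha> \<beta>\<close>)
  \<comment> \<open>If \<open>q = p\<close> and \<open>r = s\<close>, then \<open>n = p\<close> and
    \<open>d = s\<close>, the symbols are \<open>z ^ p\<close> and \<open>z ^ s\<close>, and all
    weights are one.\<close>
  have not_analytic: "\<not> (q = p \<and> r = s)"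
  proof
    assume "q = p \<and> r = s"
    then have qr: "q = p" "r = s" by auto
    have nz: "real k + 1 + real j \<noteq> 0" for k j :: nat
      using add_pos_nonneg[of "real k + 1" "real j"] by linarith
    have one: "\<alpha> k = 1" "\<beta> k = 1" for k
      unfolding \<alpha>_def \<beta>_def by (simp_all only: qr divide_self[OF nz])
    have "op_commute (toeplitz (quasihom (int p) (radial_power n))) (toeplitz (quasihom (int s) (radial_power d)))"
      unfolding op_commute_def
      by (simp add: toeplitz_monomial[OF u] toeplitz_monomial[OF v] \<alpha> \<beta> one add_ac)
    with assms(14) show False by contradiction
  qed
  \<comment> \<open>Otherwise the moments of \<open>f\<close> of index \<open>m + 2 * k\<close> all
    vanish, against its nontriviality.\<close>
  have "\<exists>k. a k \<noteq> 0"
  proof (rule ccontr)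
    assume "\<not> (\<exists>k. a k \<noteq> 0)"
    then have "of_nat (k + m + 1) * moment f (2 * k + m) = 0" for k
      by (simp add: a_def toeplitz_weight_def)
    then have "moment f (m + 2 * k) = 0" for k
      by (metis Suc_eq_plus1 add.commute mult_eq_0_iff of_nat_eq_0_iff nat.distinct(1))
    then have "AE z in disk_measure. f z = 0"
      using radial_zero_by_moments[OF f, of 2 m] by simp
    with assms(10) show False by (simp add: nontrivial_def)
  qed
  then obtain k0 where "a k0 \<noteq> 0" by blast
  from weights_determined[OF not_analytic this] obtain C where ml: "m = p" "l = s"
    and C: "\<And>k. C (k + p) = C k" "\<And>k. a k = C k * of_real (\<alpha> k)" "\<And>k. b k = C k * of_real (\<beta> k)"
    by blast
  have moments: "moment f (2 * k + p) = C k * moment (radial_power n) (2 * k + p)" for k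
  proof -
    have "of_nat (k + p + 1) * moment f (2 * k + p) = of_nat (k + p + 1) * (C k * moment (radial_power n) (2 * k + p))"
      using C(2)[of k] unfolding a_def ml \<alpha>[symmetric] toeplitz_weight_def by (simp only: mult_ac)
    moreover have "of_nat (k + p + 1) \<noteq> (0 :: complex)" by (simp del: of_nat_Suc)
    ultimately show ?thesis by (metis mult_left_cancel)
  qed
  \<comment> \<open>On each residue class modulo \<open>p\<close> the constant is fixed and the
    moment indices \<open>2 * k + p\<close> advance by \<open>2 * p\<close>. One class thus already
    identifies \<open>f\<close>, which ties the constants of all classes to the same moment.\<close>
  have "moment f 0 = C k * moment (radial_power n) 0" for k
  proof (rule proportional_moments[OF f])
    show "0 < 2 * p" using assms(1) by simp
    show "moment f (2 * k + p + 2 * p * i) = C k * moment (radial_power n) (2 * k + p + 2 * p * i)" for i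
      using moments[of "k + i * p"] periodic_mult[of C p k i, OF C(1)] by (simp add: algebra_simps)
  qed
  moreover have "moment (radial_power n) 0 \<noteq> 0"
  proof -
    have "of_nat (n + 0 + 2) \<noteq> (0 :: complex)" by (simp only: of_nat_eq_0_iff)
    then show ?thesis unfolding moment_radial_power by (metis divide_eq_0_iff zero_neq_numeral)
  qed
  ultimately have const: "C k = C 0" for k
    by (metis mult_right_cancel)
  define c where "c = C 0"
  have weights_c: "a k = c * of_real (\<alpha> k)" "b k = c * of_real (\<beta> k)" for k
    using C(2,3)[of k] const[of k] by (simp_all add: c_def)
  have "toeplitz (quasihom (int m) f) \<oplus>\<^sub>T toeplitz (quasihom (int s) g) =\<^sub>T
       c \<cdot>\<^sub>T (toeplitz (quasihom (int p) (radial_power n)) \<oplus>\<^sub>T toeplitz (quasihom (int s) (radial_power d)))"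
    unfolding op_eq_def op_scale_def sum_toeplitz_monomial[OF f g] sum_toeplitz_monomial[OF u v]
    by (simp add: weights_c[unfolded a_def b_def ml] ml \<alpha> \<beta> algebra_simps)
  with ml show ?thesis by blast
qed

end
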